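(* Let $\mathcal{H}$ be a Hilbert space, let $\mathbf{\Psi}=\{\Psi_t\}_{t\geq0}$ be a strongly continuous one-parameter semigroup of stochastic maps on $\mathcal{B}_1(\mathcal{H})$, let $\psi$ be its infinitesimal generator, let $\{\Psi_t^\sharp\}_{t\ge0}$ be the dual semigroup on $\mathcal{B}(\mathcal{H})$ and $\psi^\sharp$ its $w^*$-infinitesimal generator, and let $A\in\mathcal{B}(\mathcal{H})$ be positive. The following assertions are equivalent: (i) $\Psi_t^\sharp(A)=A$ and $\Psi_t^\sharp(A^2)=A^2$ for all $t\geq0$. (ii) $[M_{A^{1/2}},\Psi_t]=0$ for all $t\geq0$. (iii) $[M_{A^{1/2}},\Psi_t^\sharp]=0$ for all $t\geq0$. (iv) $[M_{A^{1/2}},\psi]=0$, that is, for all $T\in\operatorname{Dom}(\psi)$ we have $A^{1/2}TA^{1/2}\in\operatorname{Dom}(\psi)$ and $\psi(A^{1/2}TA^{1/2})=A^{1/2}\psi(T)A^{1/2}$. (v) $[M_{A^{1/2}},\psi^\sharp]=0$, that is, for all $S\in\operatorname{Dom}(\psi^\sharp)$ we have $A^{1/2}SA^{1/2}\in\operatorname{Dom}(\psi^\sharp)$ and $\psi^\sharp(A^{1/2}SA^{1/2})=A^{1/2}\psi^\sharp(S)A^{1/2}$. (vi) $A,A^2\in\ker(\psi^\sharp)$, that is, $A,A^2\in\operatorname{Dom}(\psi^\sharp)$ and $\psi^\sharp(A)=\psi^\sharp(A^2)=0$.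
   Context: $\mathcal{B}(\mathcal{H})$ is the algebra of bounded linear operators on $\mathcal{H}$ and $\mathcal{B}_1(\mathcal{H})$ the trace class with norm $\|T\|_1=\operatorname{tr}(|T|)$; $\mathcal{B}(\mathcal{H})$ is identified with the dual of $\mathcal{B}_1(\mathcal{H})$ via $\langle T,S\rangle=\operatorname{tr}(TS)$. A stochastic map is a linear map $\mathcal{B}_1(\mathcal{H})\to\mathcal{B}_1(\mathcal{H})$ that is positive (maps positive operators to positive operators) and trace-preserving. Strongly continuous semigroup: $\Psi_s\Psi_t=\Psi_{s+t}$, $\Psi_0=I$, and $t\mapsto\Psi_t(T)$ is $\|\cdot\|_1$-continuous on $[0,\infty)$ for every $T\in\mathcal{B}_1(\mathcal{H})$. The infinitesimal generator is $\psi(T)=\lim_{t\to0+}(\Psi_t(T)-T)/t$, with domain $\operatorname{Dom}(\psi)$ all $T\in\mathcal{B}_1(\mathcal{H})$ for which the limit exists in $\mathcal{B}_1(\mathcal{H})$. $\Psi_t^\sharp\colon\mathcal{B}(\mathcal{H})\to\mathcal{B}(\mathcal{H})$ is given by $\operatorname{tr}(\Psi_t(T)S)=\operatorname{tr}(T\Psi_t^\sharp(S))$ for $T\in\mathcal{B}_1(\mathcal{H})$, $S\in\mathcal{B}(\mathcal{H})$, and $\psi^\sharp(S)=w^*\text{-}\lim_{t\to0+}(\Psi_t^\sharp(S)-S)/t$, with domain $\operatorname{Dom}(\psi^\sharp)$ all $S\in\mathcal{B}(\mathcal{H})$ for which this $w^*$-limit exists. $M_{A^{1/2}}(T)=A^{1/2}TA^{1/2}$,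 regarded as a map on $\mathcal{B}_1(\mathcal{H})$ or on $\mathcal{B}(\mathcal{H})$ according to context, and $[\Phi,\Psi]=\Phi\Psi-\Psi\Phi$. *)

theory Defs
  imports "HOL-Analysis.Analysis"
begin

section \<open>Complex Hilbert spaces\<close>

class complex_vector = real_vector +
  fixes scaleC :: "complex \<Rightarrow> 'a \<Rightarrow> 'a"  (infixr \<open>*\<^sub>C\<close> 75)
  assumes scaleC_add_right: "c *\<^sub>C (x + y) = c *\<^sub>C x + c *\<^sub>C y"
    and scaleC_add_left: "(c + d) *\<^sub>C x = c *\<^sub>C x + d *\<^sub>C x"
    and scaleC_scaleC: "c *\<^sub>C (d *\<^sub>C x) = (c * d) *\<^sub>C x"
    and scaleC_of_real: "complex_of_real r *\<^sub>C x = r *\<^sub>R x"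

text \<open>
  The complex inner product is antilinear in its first argument.  Its real part is the
  inner product of the underlying real inner product space, so that
  \<open>norm x = sqrt (Re (cinner x x))\<close> and \<open>cinner x x\<close> is positive for \<open>x \<noteq> 0\<close>.
\<close>

class complex_inner = complex_vector + real_inner +
  fixes cinner :: "'a \<Rightarrow> 'a \<Rightarrow> complex"
  assumes cinner_commute: "cinner x y = cnj (cinner y x)"
    and cinner_add_right: "cinner x (y + z) = cinner x y + cinner x z"
    and cinner_scaleC_right: "cinner x (c *\<^sub>C y) = c * cinner x y"
    and Re_cinner: "Re (cinner x y) = inner x y"

class chilbert_space = complex_inner + complete_space

instantiation complex :: chilbert_space
begin

definition scaleC_complex :: "complex \<Rightarrow> complex \<Rightarrow> complex"
  where "scaleC_complex c x = c * x"

definition cinner_complex :: "complex \<Rightarrow> complex \<Rightarrow> complex"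
  where "cinner_complex x y = cnj x * y"

instance
  by standard
    (auto simp: scaleC_complex_def cinner_complex_def algebra_simps scaleR_conv_of_real
      inner_complex_def)

end

lemma cinner_self: "cinner x x = complex_of_real ((norm x)\<^sup>2)"
proof (rule complex_eqI)
  show "Re (cinner x x) = Re (complex_of_real ((norm x)\<^sup>2))"
    by (simp add: Re_cinner power2_norm_eq_inner)
  have "Im (cinner x x) = - Im (cinner x x)"
    by (metis cinner_commute cnj.sel(2))
  then show "Im (cinner x x) = Im (complex_of_real ((norm x)\<^sup>2))"
    by simp
qed

lemma norm_scaleC: "norm (c *\<^sub>C x) = cmod c * norm (x :: 'a::complex_inner)"
proof -
  have "cinner (c *\<^sub>C x) (c *\<^sub>C x) = c * (cnj c * cinner x x)"
    by (metis cinner_commute cinner_scaleC_right complex_cnj_mult complex_cnj_cnj)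
  then have "complex_of_real ((norm (c *\<^sub>C x))\<^sup>2) = complex_of_real ((cmod c * norm x)\<^sup>2)"
    by (simp add: cinner_self power_mult_distrib complex_norm_square mult.assoc
        flip: of_real_power)
  then have "(norm (c *\<^sub>C x))\<^sup>2 = (cmod c * norm x)\<^sup>2"
    using of_real_eq_iff by blast
  then show ?thesis
    by (simp add: power2_eq_iff_nonneg)
qed

lemma bounded_linear_scaleC: "bounded_linear (\<lambda>x :: 'a::complex_inner. c *\<^sub>C x)"
proof (rule bounded_linear_intro)
  fix r and x y :: 'a
  show "c *\<^sub>C (x + y) = c *\<^sub>C x + c *\<^sub>C y"
    by (rule scaleC_add_right)
  show "c *\<^sub>C (r *\<^sub>R x) = r *\<^sub>R (c *\<^sub>C x)"
    by (simp add: scaleC_scaleC mult.commute flip: scaleC_of_real)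
  show "norm (c *\<^sub>C x) \<le> norm x * cmod c"
    by (simp add: norm_scaleC)
qed

instantiation blinfun :: (real_normed_vector, complex_inner) complex_vector
begin

definition scaleC_blinfun :: "complex \<Rightarrow> ('a \<Rightarrow>\<^sub>L 'b) \<Rightarrow> ('a \<Rightarrow>\<^sub>L 'b)"
  where "scaleC_blinfun c T = Blinfun (\<lambda>x. c *\<^sub>C blinfun_apply T x)"

lemma blinfun_apply_scaleC [simp]:
  "blinfun_apply (c *\<^sub>C T) x = c *\<^sub>C blinfun_apply T (x :: 'a)"
  unfolding scaleC_blinfun_def
  by (simp add: bounded_linear_Blinfun_apply
      bounded_linear_compose[OF bounded_linear_scaleC blinfun.bounded_linear_right])

instance
  by standard
    (auto intro!: blinfun_eqI simp: blinfun.add_left blinfun.scaleR_left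
      scaleC_add_right scaleC_add_left scaleC_scaleC scaleC_of_real)

end


section \<open>Bounded and trace class operators\<close>

text \<open>
  The type of bounded real-linear maps provides norm, sums and composition; the algebra of
  bounded operators is the subset of its complex-linear elements.
\<close>

type_synonym 'a op = "'a \<Rightarrow>\<^sub>L 'a"

definition bounded_ops :: "'a::chilbert_space op set" where
  "bounded_ops = {T. \<forall>c x. blinfun_apply T (c *\<^sub>C x) = c *\<^sub>C blinfun_apply T x}"

definition positive_op :: "'a::chilbert_space op \<Rightarrow> bool" where
  "positive_op T \<longleftrightarrow> T \<in> bounded_ops \<and> (\<forall>x. cinner x (T x) \<in> \<real>\<^sub>\<ge>\<^sub>0)"

definition adj_op :: "'a::chilbert_space op \<Rightarrow> 'a op" where
  "adj_op T = (THE R. R \<in> bounded_ops \<and> (\<forall>x y. cinner (T x) y = cinner x (R y)))"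

definition sqrt_op :: "'a::chilbert_space op \<Rightarrow> 'a op" where
  "sqrt_op T = (THE R. positive_op R \<and> R o\<^sub>L R = T)"

definition abs_op :: "'a::chilbert_space op \<Rightarrow> 'a op" where
  "abs_op T = sqrt_op (adj_op T o\<^sub>L T)"

definition is_onb :: "'a::chilbert_space set \<Rightarrow> bool" where
  "is_onb E \<longleftrightarrow>
     (\<forall>e\<in>E. norm e = 1) \<and>
     (\<forall>e\<in>E. \<forall>f\<in>E. e \<noteq> f \<longrightarrow> cinner e f = 0) \<and>
     (\<forall>x. (\<forall>e\<in>E. cinner e x = 0) \<longrightarrow> x = 0)"

definition trace_class :: "'a::chilbert_space op set" where
  "trace_class = {T \<in> bounded_ops.
     \<exists>E. is_onb E \<and> (\<lambda>e. cinner e (abs_op T e)) summable_on E}"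

text \<open>
  The trace does not depend on the chosen orthonormal basis; it is only used for trace
  class operators.
\<close>

definition trace_op :: "'a::chilbert_space op \<Rightarrow> complex" where
  "trace_op T = (\<Sum>\<^sub>\<infinity>e\<in>(SOME E. is_onb E). cinner e (T e))"

definition trace_norm :: "'a::chilbert_space op \<Rightarrow> real" where
  "trace_norm T = Re (trace_op (abs_op T))"

definition trace_norm_tendsto :: "('b \<Rightarrow> 'a::chilbert_space op) \<Rightarrow> 'a op \<Rightarrow> 'b filter \<Rightarrow> bool"
  where "trace_norm_tendsto f L F \<longleftrightarrow> ((\<lambda>t. trace_norm (f t - L)) \<longlongrightarrow> 0) F"

text \<open>Weak-star convergence, for the bounded operators as the dual of the trace class.\<close>

definition wstar_tendsto :: "('b \<Rightarrow> 'a::chilbert_space op) \<Rightarrow> 'a op \<Rightarrow> 'b filter \<Rightarrow> bool"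
  where "wstar_tendsto f L F \<longleftrightarrow>
    (\<forall>T\<in>trace_class. ((\<lambda>t. trace_op (T o\<^sub>L f t)) \<longlongrightarrow> trace_op (T o\<^sub>L L)) F)"


section \<open>Stochastic semigroups, dual semigroups and generators\<close>

text \<open>
  Maps on trace class (bounded) operators are total functions on \<open>'a op\<close> of which only the
  restriction to \<open>trace_class\<close> (\<open>bounded_ops\<close>) is relevant; likewise only the members of a
  semigroup with nonnegative index are relevant.
\<close>

definition stochastic_map :: "('a::chilbert_space op \<Rightarrow> 'a op) \<Rightarrow> bool" where
  "stochastic_map \<Phi> \<longleftrightarrow>
     (\<forall>T\<in>trace_class. \<Phi> T \<in> trace_class) \<and>
     (\<forall>T\<in>trace_class. \<forall>R\<in>trace_class. \<Phi> (T + R) = \<Phi> T + \<Phi> R) \<and>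
     (\<forall>c. \<forall>T\<in>trace_class. \<Phi> (c *\<^sub>C T) = c *\<^sub>C \<Phi> T) \<and>
     (\<forall>T\<in>trace_class. positive_op T \<longrightarrow> positive_op (\<Phi> T)) \<and>
     (\<forall>T\<in>trace_class. trace_op (\<Phi> T) = trace_op T)"

definition stochastic_semigroup :: "(real \<Rightarrow> 'a::chilbert_space op \<Rightarrow> 'a op) \<Rightarrow> bool" where
  "stochastic_semigroup \<Psi> \<longleftrightarrow>
     (\<forall>t\<ge>0. stochastic_map (\<Psi> t)) \<and>
     (\<forall>s\<ge>0. \<forall>t\<ge>0. \<forall>T\<in>trace_class. \<Psi> s (\<Psi> t T) = \<Psi> (s + t) T) \<and>
     (\<forall>T\<in>trace_class. \<Psi> 0 T = T) \<and>
     (\<forall>T\<in>trace_class. \<forall>t\<ge>0. trace_norm_tendsto (\<lambda>s. \<Psi> s T) (\<Psi> t T) (at t within {0..}))"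

definition generator_dom :: "(real \<Rightarrow> 'a::chilbert_space op \<Rightarrow> 'a op) \<Rightarrow> 'a op set" where
  "generator_dom \<Psi> = {T \<in> trace_class. \<exists>L\<in>trace_class.
     trace_norm_tendsto (\<lambda>t. (\<Psi> t T - T) /\<^sub>R t) L (at_right 0)}"

definition generator :: "(real \<Rightarrow> 'a::chilbert_space op \<Rightarrow> 'a op) \<Rightarrow> 'a op \<Rightarrow> 'a op" where
  "generator \<Psi> T = (THE L. L \<in> trace_class \<and>
     trace_norm_tendsto (\<lambda>t. (\<Psi> t T - T) /\<^sub>R t) L (at_right 0))"

definition dual_map :: "('a::chilbert_space op \<Rightarrow> 'a op) \<Rightarrow> 'a op \<Rightarrow> 'a op" where
  "dual_map \<Phi> S = (THE R. R \<in> bounded_ops \<and>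
     (\<forall>T\<in>trace_class. trace_op (\<Phi> T o\<^sub>L S) = trace_op (T o\<^sub>L R)))"

text \<open>The following two are applied to a dual semigroup on the bounded operators.\<close>

definition wstar_generator_dom :: "(real \<Rightarrow> 'a::chilbert_space op \<Rightarrow> 'a op) \<Rightarrow> 'a op set" where
  "wstar_generator_dom \<Theta> = {S \<in> bounded_ops. \<exists>L\<in>bounded_ops.
     wstar_tendsto (\<lambda>t. (\<Theta> t S - S) /\<^sub>R t) L (at_right 0)}"

definition wstar_generator :: "(real \<Rightarrow> 'a::chilbert_space op \<Rightarrow> 'a op) \<Rightarrow> 'a op \<Rightarrow> 'a op" where
  "wstar_generator \<Theta> S = (THE L. L \<in> bounded_ops \<and>
     wstar_tendsto (\<lambda>t. (\<Theta> t S - S) /\<^sub>R t) L (at_right 0))"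

definition conj_by :: "'a::chilbert_space op \<Rightarrow> 'a op \<Rightarrow> 'a op" where
  "conj_by B T = B o\<^sub>L T o\<^sub>L B"

end

theory Submission
  imports Defs
begin

text \<open>
  Write \<open>\<Theta>\<^sub>t\<close> for the dual semigroup, \<open>B = A\<^sup>1\<^sup>/\<^sup>2\<close> and \<open>M S = B S B\<close>.  The heart of the matter is
  that (i) implies (iii), for a single \<open>\<Theta> = \<Theta>\<^sub>t\<close>.  The map \<open>\<Theta>\<close> is positive and unital, but it need not be
  completely positive, so only Kadison's inequality \<open>\<Theta> (X\<^sup>2) \<ge> (\<Theta> X)\<^sup>2\<close> for hermitian \<open>X\<close> is available.
  It comes from writing \<open>X\<close> and, up to \<open>1/n\<close>, \<open>X\<^sup>2\<close> as combinations of the Bernstein polynomials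
  in \<open>X\<close>, which are positive operators with sum 1 (\<open>kadison\<close>).  If \<open>\<Theta>\<close> fixes \<open>X\<close> and \<open>X\<^sup>2\<close>, then the
  inequality for \<open>X + r S\<close> is an equality at \<open>r = 0\<close>; its first order term in \<open>r\<close> gives
  \<open>\<Theta> (X S + S X) = X \<Theta> S + \<Theta> S X\<close> (\<open>fixed_squares_anticomm\<close>).  Hence the operators \<open>X\<close> such that
  \<open>\<Theta>\<close> fixes \<open>X\<close> and \<open>X\<^sup>2\<close> form a norm closed Jordan algebra.  It contains \<open>B\<close>, because \<open>B\<close> is obtained
  from \<open>A\<close> by linear operations, squaring and norm limits, and \<open>B S B\<close> is a Jordan polynomial in \<open>B\<close>
  and \<open>S\<close> (\<open>fixed_conj_sqrt\<close>).  Conversely (iii), evaluated at \<open>S = 1\<close> and \<open>S = A\<close>, is (i).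

  The other assertions are tied to these two by duality.  As \<open>tr (M(T) S) = tr (T M(S))\<close>, (ii) and (iii) are
  adjoint to each other (\<open>commute_iff_dual_commute\<close>), and \<open>M\<close>, being continuous, passes to the
  generators: (ii) gives (iv) and (iii) gives (v).  From (v) at \<open>S = 1\<close> and \<open>S = A\<close> follows (vi),
  since \<open>1\<close> lies in the kernel of the dual generator.  To return to (i) from (vi), the function \<open>t \<mapsto> tr (\<Psi>\<^sub>t T A)\<close> is
  continuous with vanishing right derivative, so it is constant (\<open>wstar_generator_kernel_fixed\<close>).
  From (iv), \<open>tr (\<psi> T A) = tr (M (\<psi> T)) = tr (\<psi> (M T)) = 0\<close> on the domain of \<open>\<psi>\<close>, and likewise for
  \<open>A\<^sup>2\<close>; again the functions are constant, first for \<open>T\<close> in the domain and then, the domain being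
  dense (\<open>generator_dom_dense\<close>), for all \<open>T\<close> (\<open>generator_annihilator_fixed\<close>).

  All this rests on the elementary theory of square roots, polar decomposition and trace class
  operators on an arbitrary complex Hilbert space.  The trace norm is handled through the
  predicate \<open>tc_bound\<close>, a supremum of moduli of finite sums of matrix entries, from which the ideal
  property, the triangle inequality and completeness are immediate.
\<close>

section \<open>Complex Hilbert spaces\<close>

instance chilbert_space \<subseteq> banach ..

lemma cinner_add_left: "cinner (x + y) z = cinner x z + cinner y (z :: 'a::complex_inner)"
  by (metis cinner_add_right cinner_commute complex_cnj_add)

lemma cinner_scaleC_left: "cinner (c *\<^sub>C x) y = cnj c * cinner x (y :: 'a::complex_inner)"
  by (metis cinner_scaleC_right cinner_commute complex_cnj_mult)

lemma cinner_scaleR_right: "cinner x (r *\<^sub>R y) = r *\<^sub>R cinner x (y :: 'a::complex_inner)"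
  by (metis cinner_scaleC_right scaleC_of_real scaleR_conv_of_real)

lemma cinner_scaleR_left: "cinner (r *\<^sub>R x) y = r *\<^sub>R cinner x (y :: 'a::complex_inner)"
  by (metis cinner_scaleC_left scaleC_of_real scaleR_conv_of_real complex_cnj_complex_of_real)

lemma cmod_cinner_le: "cmod (cinner x y) \<le> norm x * norm (y :: 'a::complex_inner)"
proof -
  define u where "u = (if cinner x y = 0 then 1 else cnj (sgn (cinner x y)))"
  have u: "cmod u = 1" by (simp add: u_def norm_sgn)
  have "u * cinner x y = complex_of_real (cmod (cinner x y))"
  proof (cases "cinner x y = 0")
    case False
    have "cnj (cinner x y) * cinner x y = complex_of_real (cmod (cinner x y)) * complex_of_real (cmod (cinner x y))"
      by (metis complex_norm_square mult.commute power2_eq_square of_real_mult)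
    with False show ?thesis by (simp add: u_def sgn_eq)
  qed simp
  then have "cmod (cinner x y) = Re (cinner x (u *\<^sub>C y))"
    by (simp add: cinner_scaleC_right)
  also have "\<dots> = inner x (u *\<^sub>C y)" by (rule Re_cinner)
  also have "\<dots> \<le> norm x * norm (u *\<^sub>C y)" by (rule norm_cauchy_schwarz)
  finally show ?thesis by (simp add: norm_scaleC u)
qed

lemma bounded_bilinear_cinner [bounded_bilinear]:
  "bounded_bilinear (cinner :: 'a::complex_inner \<Rightarrow> 'a \<Rightarrow> complex)"
  by (rule bounded_bilinear.intro)
    (auto simp: cinner_add_left cinner_add_right cinner_scaleR_left cinner_scaleR_right
      intro!: exI[of _ 1] cmod_cinner_le)

interpretation cinner: bounded_bilinear "cinner :: 'a::complex_inner \<Rightarrow> 'a \<Rightarrow> complex"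
  by (rule bounded_bilinear_cinner)

interpretation blinfun_compose:
  bounded_bilinear "blinfun_compose ::
    'b::real_normed_vector \<Rightarrow>\<^sub>L 'c::real_normed_vector \<Rightarrow> 'a::real_normed_vector \<Rightarrow>\<^sub>L 'b \<Rightarrow> 'a \<Rightarrow>\<^sub>L 'c"
  by (rule bounded_bilinear_blinfun_compose)

lemma cinner_eqI: "(\<And>y. cinner y x = cinner y z) \<Longrightarrow> x = (z :: 'a::complex_inner)"
  by (metis Re_cinner inner_commute vector_eq_rdot)

lemma Im_cinner: "Im (cinner x y) = inner (\<i> *\<^sub>C x) (y :: 'a::complex_inner)"
  by (simp flip: Re_cinner add: cinner_scaleC_left)

lemma cnj_cinner [simp]: "cnj (cinner x y) = cinner y (x :: 'a::complex_inner)"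
  by (rule cinner_commute[symmetric])

lemma cinner_self_mult: "cinner x (y :: 'a::complex_inner) * cinner y x = complex_of_real ((cmod (cinner x y))\<^sup>2)"
  by (metis cinner_commute complex_norm_square)

lemma scaleC_one [simp]: "1 *\<^sub>C x = (x :: 'a::complex_vector)"
  by (metis of_real_1 scaleC_of_real scaleR_one)

lemma scaleC_minus_one: "(-1) *\<^sub>C x = - (x :: 'a::complex_vector)"
  by (metis of_real_1 of_real_minus scaleC_of_real scaleR_minus1_left)

lemma scaleC_zero_left [simp]: "0 *\<^sub>C x = (0 :: 'a::complex_vector)"
  by (metis of_real_0 scaleC_of_real scaleR_zero_left)

lemma scaleC_zero_right [simp]: "c *\<^sub>C 0 = (0 :: 'a::complex_vector)"
  by (metis mult_zero_right scaleC_scaleC scaleC_zero_left)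

lemma scaleC_minus_right [simp]: "c *\<^sub>C (- x) = - (c *\<^sub>C (x :: 'a::complex_vector))"
  by (metis add.right_inverse add_eq_0_iff scaleC_add_right scaleC_zero_right)

lemma scaleC_minus_left [simp]: "(- c) *\<^sub>C x = - (c *\<^sub>C (x :: 'a::complex_vector))"
  by (metis mult_minus1 scaleC_scaleC scaleC_minus_one)

lemma scaleC_diff_right: "c *\<^sub>C (x - y) = c *\<^sub>C x - c *\<^sub>C (y :: 'a::complex_vector)"
  by (metis diff_conv_add_uminus scaleC_add_right scaleC_minus_right)

lemma scaleC_scaleR: "c *\<^sub>C (r *\<^sub>R x) = r *\<^sub>R (c *\<^sub>C (x :: 'a::complex_vector))"
  by (simp add: scaleC_scaleC mult.commute flip: scaleC_of_real)

text \<open>A minimising sequence is Cauchy by the parallelogram law.  The real inner product suffices: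
  on a complex subspace real and complex orthogonality agree.\<close>

lemma orthogonal_projection_exists:
  fixes M :: "'a::{real_inner, complete_space} set"
  assumes "closed M" "subspace M"
  obtains m where "m \<in> M" "\<And>u. u \<in> M \<Longrightarrow> inner (w - m) u = 0"
proof -
  define D where "D = (INF m\<in>M. (norm (w - m))\<^sup>2)"
  have ne: "M \<noteq> {}" using assms(2) subspace_0 by blast
  have bdd: "bdd_below ((\<lambda>m. (norm (w - m))\<^sup>2) ` M)"
    by (rule bdd_belowI[of _ 0]) auto
  have D: "D \<le> (norm (w - m))\<^sup>2" if "m \<in> M" for m
    unfolding D_def by (rule cINF_lower[OF bdd that])
  have "\<exists>m\<in>M. (norm (w - m))\<^sup>2 < D + 1 / (real n + 1)" for n
  proof (rule ccontr)
    assume "\<not> ?thesis"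
    then have "D + 1 / (real n + 1) \<le> D"
      unfolding D_def by (intro cINF_greatest[OF ne]) (auto simp: not_less)
    then show False by (simp add: field_simps)
  qed
  then obtain s where s: "s n \<in> M" "(norm (w - s n))\<^sup>2 < D + 1 / (real n + 1)" for n
    by metis
  have dist: "(norm (s i - s j))\<^sup>2 \<le> 2 / (real i + 1) + 2 / (real j + 1)" for i j
  proof -
    have "(1/2) *\<^sub>R (s i + s j) \<in> M"
      using s assms(2) by (simp add: subspace_add subspace_scale)
    from D[OF this] have "D \<le> (norm (w - (1/2) *\<^sub>R (s i + s j)))\<^sup>2" .
    moreover have "(norm (s i - s j))\<^sup>2 + 4 * (norm (w - (1/2) *\<^sub>R (s i + s j)))\<^sup>2
        = 2 * (norm (w - s i))\<^sup>2 + 2 * (norm (w - s j))\<^sup>2"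
      unfolding power2_norm_eq_inner
      by (simp add: inner_diff_left inner_diff_right inner_add_left inner_add_right inner_commute
          algebra_simps)
    moreover note s(2)[of i] s(2)[of j]
    ultimately show ?thesis by linarith
  qed
  have "Cauchy s"
  proof (rule metric_CauchyI)
    fix e :: real assume e: "e > 0"
    obtain N where N: "4 / e\<^sup>2 < real N" using reals_Archimedean2 by blast
    show "\<exists>N. \<forall>i\<ge>N. \<forall>j\<ge>N. dist (s i) (s j) < e"
    proof (intro exI allI impI)
      fix i j assume ij: "i \<ge> N" "j \<ge> N"
      have "2 / (real i + 1) \<le> 2 / (real N + 1)" "2 / (real j + 1) \<le> 2 / (real N + 1)"
        using ij by (auto intro!: divide_left_mono)
      with dist[of i j] have "(norm (s i - s j))\<^sup>2 \<le> 4 / (real N + 1)" by simp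
      also have "\<dots> < e\<^sup>2"
        using N e by (simp add: field_simps) (metis add_strict_increasing mult.commute less_imp_le zero_less_power)
      finally show "dist (s i) (s j) < e"
        using e by (simp add: dist_norm power2_less_imp_less)
    qed
  qed
  then obtain m where m: "s \<longlonglongrightarrow> m" using Cauchy_convergent convergent_def by blast
  have mM: "m \<in> M" using closed_sequentially[OF assms(1) _ m] s(1) by blast
  have "(norm (w - m))\<^sup>2 \<le> D"
  proof (rule LIMSEQ_le)
    show "(\<lambda>n. (norm (w - s n))\<^sup>2) \<longlonglongrightarrow> (norm (w - m))\<^sup>2"
      by (intro tendsto_intros m)
    have "(\<lambda>n. inverse (real (Suc n))) \<longlonglongrightarrow> 0" by (rule LIMSEQ_inverse_real_of_nat)
    then show "(\<lambda>n. D + inverse (real (Suc n))) \<longlonglongrightarrow> D" using tendsto_add[OF tendsto_const] by force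
    show "\<exists>N. \<forall>n\<ge>N. (norm (w - s n))\<^sup>2 \<le> D + inverse (real (Suc n))"
      using s(2) by (auto intro!: exI[of _ 0] less_imp_le simp: inverse_eq_divide add.commute)
  qed
  then have min: "(norm (w - m))\<^sup>2 \<le> (norm (w - u))\<^sup>2" if "u \<in> M" for u
    using D[OF that] by linarith
  show thesis
  proof (rule that[OF mM])
    fix u assume u: "u \<in> M"
    show "inner (w - m) u = 0"
    proof (cases "u = 0")
      case False
      define c where "c = inner (w - m) u / (norm u)\<^sup>2"
      have "m + c *\<^sub>R u \<in> M" using mM u assms(2) by (simp add: subspace_add subspace_scale)
      from min[OF this] have "(norm (w - m))\<^sup>2 \<le> (norm ((w - m) - c *\<^sub>R u))\<^sup>2"
        by (simp add: algebra_simps)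
      also have "\<dots> = (norm (w - m))\<^sup>2 - 2 * c * inner (w - m) u + c\<^sup>2 * (norm u)\<^sup>2"
        unfolding power2_norm_eq_inner
        by (simp add: inner_diff_left inner_diff_right inner_commute algebra_simps power2_eq_square)
      also have "\<dots> = (norm (w - m))\<^sup>2 - (inner (w - m) u)\<^sup>2 / (norm u)\<^sup>2"
        using False by (simp add: c_def power2_eq_square field_simps)
      finally have "(inner (w - m) u)\<^sup>2 / (norm u)\<^sup>2 \<le> 0" by simp
      then show ?thesis using False
        by (simp add: divide_le_0_iff)
    qed simp
  qed
qed

lemma riesz_real:
  fixes f :: "'a::{real_inner, complete_space} \<Rightarrow> real"
  assumes "bounded_linear f"
  obtains z where "\<And>x. f x = inner z x"
proof -
  interpret f: bounded_linear f by fact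
  show thesis
  proof (cases "\<forall>x. f x = 0")
    case True
    then show ?thesis using that[of 0] by simp
  next
    case False
    then obtain w where w: "f w \<noteq> 0" by blast
    define M where "M = {x. f x = 0}"
    have "closed M" unfolding M_def
      by (intro closed_Collect_eq continuous_intros f.continuous_on)
    moreover have "subspace M"
      by (auto simp: subspace_def M_def f.add f.scaleR f.zero)
    ultimately obtain m where m: "m \<in> M" "\<And>u. u \<in> M \<Longrightarrow> inner (w - m) u = 0"
      using orthogonal_projection_exists by blast
    define z where "z = w - m"
    have fz: "f z \<noteq> 0" using w m(1) by (simp add: z_def f.diff M_def)
    then have z0: "z \<noteq> 0" using f.zero by auto
    have "f x = inner ((f z / inner z z) *\<^sub>R z) x" for x
    proof -
      have "x - (f x / f z) *\<^sub>R z \<in> M" using fz by (simp add: M_def f.diff f.scaleR)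
      from m(2)[OF this] have "inner z x = f x / f z * inner z z"
        by (simp add: z_def[symmetric] inner_diff_right)
      then show ?thesis using fz z0 by simp
    qed
    then show ?thesis using that by blast
  qed
qed

text \<open>The vector that represents the real part of \<open>g\<close> for the real inner product represents \<open>g\<close>,
  because the imaginary part of \<open>g x\<close> is minus the real part of \<open>g (\<i> x)\<close>.\<close>

lemma riesz:
  fixes g :: "'a::chilbert_space \<Rightarrow> complex"
  assumes add: "\<And>x y. g (x + y) = g x + g y" and scale: "\<And>c x. g (c *\<^sub>C x) = c * g x"
    and bound: "\<And>x. cmod (g x) \<le> norm x * K"
  obtains z where "\<And>x. g x = cinner z x"
proof -
  have "bounded_linear (\<lambda>x. Re (g x))"
  proof (rule bounded_linear_intro)
    show "Re (g (r *\<^sub>R x)) = r *\<^sub>R Re (g x)" for r x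
      using scale[of "complex_of_real r" x] by (simp add: scaleC_of_real)
    show "norm (Re (g x)) \<le> norm x * K" for x
      using abs_Re_le_cmod[of "g x"] bound[of x] by simp
  qed (simp add: add)
  then obtain z where z: "\<And>x. Re (g x) = inner z x" using riesz_real by blast
  have "g x = cinner z x" for x
  proof (rule complex_eqI)
    show "Re (g x) = Re (cinner z x)" by (simp add: z Re_cinner)
    have "Im (g x) = - Re (g (\<i> *\<^sub>C x))" by (simp add: scale)
    also have "\<dots> = - Re (cinner z (\<i> *\<^sub>C x))" by (simp add: z Re_cinner)
    also have "\<dots> = Im (cinner z x)" by (simp add: cinner_scaleC_right)
    finally show "Im (g x) = Im (cinner z x)" .
  qed
  then show thesis using that by blast
qed


section \<open>Bounded operators and their adjoints\<close>

lemma bounded_ops_scaleC: "T \<in> bounded_ops \<Longrightarrow> blinfun_apply T (c *\<^sub>C x) = c *\<^sub>C blinfun_apply T x"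
  by (simp add: bounded_ops_def)

lemma bounded_ops_add [simp]: "T \<in> bounded_ops \<Longrightarrow> S \<in> bounded_ops \<Longrightarrow> T + S \<in> bounded_ops"
  by (simp add: bounded_ops_def blinfun.add_left scaleC_add_right)
lemma bounded_ops_diff [simp]: "T \<in> bounded_ops \<Longrightarrow> S \<in> bounded_ops \<Longrightarrow> T - S \<in> bounded_ops"
  by (simp add: bounded_ops_def blinfun.diff_left scaleC_diff_right)
lemma bounded_ops_compose [simp]: "T \<in> bounded_ops \<Longrightarrow> S \<in> bounded_ops \<Longrightarrow> T o\<^sub>L S \<in> bounded_ops"
  by (simp add: bounded_ops_def)
lemma bounded_ops_scaleC_op [simp]: "T \<in> bounded_ops \<Longrightarrow> c *\<^sub>C T \<in> bounded_ops"
  by (simp add: bounded_ops_def scaleC_scaleC mult.commute)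
lemma bounded_ops_scaleR [simp]: "T \<in> bounded_ops \<Longrightarrow> r *\<^sub>R T \<in> bounded_ops"
  by (simp flip: scaleC_of_real)
lemma bounded_ops_0 [simp]: "0 \<in> bounded_ops"
  by (simp add: bounded_ops_def)
lemma bounded_ops_id [simp]: "id_blinfun \<in> bounded_ops"
  by (simp add: bounded_ops_def)
lemma bounded_ops_sum: "(\<And>i. i \<in> F \<Longrightarrow> f i \<in> bounded_ops) \<Longrightarrow> sum f F \<in> bounded_ops"
  by (induction F rule: infinite_finite_induct) auto

lemma closed_bounded_ops: "closed (bounded_ops :: 'a::chilbert_space op set)"
proof -
  have eq: "bounded_ops = (\<Inter>c x. {T :: 'a op. T (c *\<^sub>C x) = c *\<^sub>C T x})"
    by (auto simp: bounded_ops_def)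
  have cl: "closed {T :: 'a op. T (c *\<^sub>C x) = c *\<^sub>C T x}" for c x
    by (intro closed_Collect_eq continuous_intros
        bounded_linear.continuous_on[OF bounded_linear_scaleC])
  show ?thesis unfolding eq by (intro closed_INT ballI cl)
qed

lemma op_eqI:
  fixes T S :: "'a::chilbert_space op"
  shows "(\<And>x y. cinner x (T y) = cinner x (S y)) \<Longrightarrow> T = S"
  by (metis blinfun_eqI cinner_eqI)

text \<open>The Riesz representation turns bounded sesquilinear forms into operators; both the
  adjoint and the dual of a stochastic map arise this way.\<close>

lemma bounded_form_represented:
  fixes B :: "'a::chilbert_space \<Rightarrow> 'a \<Rightarrow> complex"
  assumes addl: "\<And>x y z. B (x + y) z = B x z + B y z"
    and addr: "\<And>x y z. B x (y + z) = B x y + B x z"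
    and scl: "\<And>c x y. B (c *\<^sub>C x) y = cnj c * B x y"
    and scr: "\<And>c x y. B x (c *\<^sub>C y) = c * B x y"
    and bound: "\<And>x y. cmod (B x y) \<le> K * norm x * norm y"
  obtains R where "R \<in> bounded_ops" "\<And>x y. B x y = cinner x (R y)"
proof -
  have "\<exists>z. \<forall>x. B x y = cinner x z" for y
  proof -
    obtain z where "\<And>x. cnj (B x y) = cinner z x"
      by (rule riesz[of "\<lambda>x. cnj (B x y)" "K * norm y"])
        (auto simp: addl scl mult_ac intro: order_trans[OF bound])
    then have "B x y = cinner x z" for x
      by (metis cnj_cinner complex_cnj_cnj)
    then show ?thesis by blast
  qed
  then obtain r where r: "\<And>x y. B x y = cinner x (r y)" by metis
  have "bounded_linear r"
  proof (rule bounded_linear_intro)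
    show "r (x + y) = r x + r y" for x y
      by (rule cinner_eqI) (simp add: cinner_add_right addr flip: r)
    show "r (c *\<^sub>R x) = c *\<^sub>R r x" for c x
      by (rule cinner_eqI)
        (metis r scr cinner_scaleC_right scaleC_of_real)
    show "norm (r x) \<le> norm x * \<bar>K\<bar>" for x
    proof (cases "r x = 0")
      case False
      have "norm (r x) * norm (r x) = cmod (cinner (r x) (r x))"
        by (simp add: cinner_self power2_eq_square norm_mult)
      also have "\<dots> \<le> K * norm (r x) * norm x" by (metis bound r)
      finally have "norm (r x) \<le> K * norm x" using False
        by (metis mult.commute mult.left_commute mult_le_cancel_left_pos zero_less_norm_iff)
      also have "\<dots> \<le> norm x * \<bar>K\<bar>" by (simp add: mult.commute mult_right_mono)
      finally show ?thesis .
    qed simp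
  qed
  then have app: "blinfun_apply (Blinfun r) = r" by (rule bounded_linear_Blinfun_apply)
  have "r (c *\<^sub>C x) = c *\<^sub>C r x" for c x
    by (rule cinner_eqI) (metis r scr cinner_scaleC_right)
  then have "Blinfun r \<in> bounded_ops"
    by (simp add: bounded_ops_def app)
  then show thesis using that app r by simp
qed

lemma adj_op_works:
  fixes T :: "'a::chilbert_space op"
  assumes "T \<in> bounded_ops"
  shows adj_op_bounded: "adj_op T \<in> bounded_ops"
    and cinner_adj_right: "cinner x (adj_op T y) = cinner (T x) y"
proof -
  obtain R where R: "R \<in> bounded_ops" "\<And>x y. cinner (T x) y = cinner x (R y)"
    by (rule bounded_form_represented[of "\<lambda>x y. cinner (T x) y" "norm T"])
      (auto simp: blinfun.add_right cinner_add_left cinner_add_right bounded_ops_scaleC[OF assms]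
        cinner_scaleC_left cinner_scaleC_right
        intro!: order_trans[OF cmod_cinner_le] mult_right_mono norm_blinfun)
  have "adj_op T = R"
    unfolding adj_op_def using R by (intro the_equality) (auto intro!: op_eqI)
  then show "adj_op T \<in> bounded_ops" "cinner x (adj_op T y) = cinner (T x) y"
    using R by auto
qed

lemma cinner_adj_left: "T \<in> bounded_ops \<Longrightarrow> cinner (adj_op T x) y = cinner x (blinfun_apply T y)"
  by (metis cinner_adj_right cinner_commute)

lemma adj_op_eqI:
  fixes T :: "'a::chilbert_space op"
  assumes "T \<in> bounded_ops" "\<And>x y. cinner (T x) y = cinner x (blinfun_apply R y)"
  shows "adj_op T = R"
  by (rule op_eqI) (simp add: assms cinner_adj_right)

lemma adj_adj [simp]: "T \<in> bounded_ops \<Longrightarrow> adj_op (adj_op T) = T"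
  by (intro adj_op_eqI) (simp_all add: adj_op_bounded cinner_adj_left)

lemma adj_compose:
  "T \<in> bounded_ops \<Longrightarrow> S \<in> bounded_ops \<Longrightarrow> adj_op (T o\<^sub>L S) = adj_op S o\<^sub>L adj_op T"
  by (intro adj_op_eqI) (simp_all add: cinner_adj_right)

definition hermitian :: "'a::chilbert_space op \<Rightarrow> bool" where
  "hermitian T \<longleftrightarrow> T \<in> bounded_ops \<and> adj_op T = T"

lemma hermitianI:
  "T \<in> bounded_ops \<Longrightarrow> (\<And>x y. cinner (blinfun_apply T x) y = cinner x (blinfun_apply T y)) \<Longrightarrow> hermitian T"
  by (simp add: hermitian_def adj_op_eqI)

lemma hermitianD: "hermitian T \<Longrightarrow> cinner (blinfun_apply T x) y = cinner x (blinfun_apply T y)"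
  unfolding hermitian_def by (metis cinner_adj_right)

lemma hermitian_iff:
  "hermitian T \<longleftrightarrow> T \<in> bounded_ops \<and> (\<forall>x y. cinner (blinfun_apply T x) y = cinner x (blinfun_apply T y))"
  using hermitianI hermitianD hermitian_def by metis

lemma hermitian_bounded: "hermitian T \<Longrightarrow> T \<in> bounded_ops"
  by (simp add: hermitian_def)

lemma hermitian_add: "hermitian T \<Longrightarrow> hermitian S \<Longrightarrow> hermitian (T + S)"
  by (intro hermitianI)
    (simp_all add: hermitian_bounded blinfun.add_left cinner_add_left cinner_add_right hermitianD)
lemma hermitian_diff: "hermitian T \<Longrightarrow> hermitian S \<Longrightarrow> hermitian (T - S)"
  by (intro hermitianI)
    (simp_all add: hermitian_bounded blinfun.diff_left cinner.diff_left cinner.diff_right hermitianD)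
lemma hermitian_scaleR: "hermitian T \<Longrightarrow> hermitian (r *\<^sub>R T)"
  by (intro hermitianI)
    (simp_all add: hermitian_bounded blinfun.scaleR_left cinner_scaleR_left cinner_scaleR_right hermitianD)
lemma hermitian_id: "hermitian id_blinfun"
  by (intro hermitianI) simp_all
lemma hermitian_0: "hermitian 0"
  by (intro hermitianI) (simp_all add: cinner.zero_left cinner.zero_right)
lemma hermitian_compose_self: "hermitian T \<Longrightarrow> hermitian (T o\<^sub>L T)"
  by (intro hermitianI) (simp_all add: hermitian_bounded hermitianD)

lemma closed_hermitian: "closed {T :: 'a::chilbert_space op. hermitian T}"
proof -
  have "{T :: 'a op. hermitian T} = bounded_ops \<inter> (\<Inter>x y. {T :: 'a op. cinner (T x) y = cinner x (T y)})"
    unfolding hermitian_iff by blast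
  moreover have "closed {T :: 'a op. cinner (T x) y = cinner x (T y)}" for x y
    by (intro closed_Collect_eq continuous_intros cinner.continuous_on)
  ultimately show ?thesis by (auto intro!: closed_INT closed_Int closed_bounded_ops)
qed


section \<open>Positive operators\<close>

text \<open>Polarisation: reality of the form at \<open>x + y\<close> controls the imaginary parts of the two mixed
  entries, reality at \<open>x + \<i> y\<close> their real parts.\<close>

lemma positive_hermitian:
  assumes "positive_op T" shows "hermitian T"
proof (rule hermitianI)
  show T: "T \<in> bounded_ops" using assms by (simp add: positive_op_def)
  have real: "Im (cinner x (T x)) = 0" for x
    using assms by (auto simp: positive_op_def complex_nonneg_Reals_iff)
  fix x y
  have 1: "Im (cinner x (T y)) + Im (cinner y (T x)) = 0"
    using real[of "x + y"] real[of x] real[of y]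
    by (simp add: blinfun.add_right cinner_add_left cinner_add_right)
  have 2: "Re (cinner x (T y)) - Re (cinner y (T x)) = 0"
    using real[of "x + \<i> *\<^sub>C y"] real[of x] real[of y]
    by (simp add: blinfun.add_right cinner_add_left cinner_add_right bounded_ops_scaleC[OF T]
        cinner_scaleC_left cinner_scaleC_right)
  have "cinner x (T y) = cnj (cinner y (T x))"
    by (rule complex_eqI) (use 1 2 in \<open>simp_all del: cnj_cinner\<close>)
  then show "cinner (T x) y = cinner x (T y)" by simp
qed

lemma positive_bounded: "positive_op T \<Longrightarrow> T \<in> bounded_ops"
  by (simp add: positive_op_def)

lemma positive_inner_nonneg: "positive_op T \<Longrightarrow> 0 \<le> inner x (blinfun_apply T x)"
  by (auto simp: positive_op_def complex_nonneg_Reals_iff Re_cinner)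

lemma hermitian_quadratic_real:
  "hermitian T \<Longrightarrow> cinner x (blinfun_apply T x) = complex_of_real (inner x (blinfun_apply T x))"
  by (metis Reals_cnj_iff Re_cinner cnj_cinner hermitianD of_real_Re)

lemma positive_iff: "positive_op T \<longleftrightarrow> hermitian T \<and> (\<forall>x. 0 \<le> inner x (blinfun_apply T x))"
proof
  assume "hermitian T \<and> (\<forall>x. 0 \<le> inner x (T x))"
  then show "positive_op T"
    by (auto simp: positive_op_def hermitian_bounded hermitian_quadratic_real complex_nonneg_Reals_iff)
qed (auto simp: positive_hermitian positive_inner_nonneg)

lemma positive_add: "positive_op T \<Longrightarrow> positive_op S \<Longrightarrow> positive_op (T + S)"
  by (auto simp: positive_iff hermitian_add blinfun.add_left inner_add_right)
lemma positive_scaleR: "positive_op T \<Longrightarrow> 0 \<le> r \<Longrightarrow> positive_op (r *\<^sub>R T)"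
  by (auto simp: positive_iff hermitian_scaleR blinfun.scaleR_left)
lemma positive_id: "positive_op id_blinfun"
  by (auto simp: positive_iff hermitian_id)
lemma positive_0: "positive_op 0"
  by (auto simp: positive_iff hermitian_0)
lemma positive_adj_compose: "T \<in> bounded_ops \<Longrightarrow> positive_op (adj_op T o\<^sub>L T)"
  by (auto simp: positive_op_def adj_op_bounded cinner_adj_right cinner_self complex_nonneg_Reals_iff)
lemma positive_square: "hermitian T \<Longrightarrow> positive_op (T o\<^sub>L T)"
  by (metis hermitian_def positive_adj_compose)
lemma positive_sandwich: "hermitian T \<Longrightarrow> positive_op P \<Longrightarrow> positive_op (T o\<^sub>L P o\<^sub>L T)"
  by (simp add: positive_op_def hermitian_bounded hermitianD[of T, symmetric])
lemma positive_conj: "W \<in> bounded_ops \<Longrightarrow> positive_op P \<Longrightarrow> positive_op (W o\<^sub>L P o\<^sub>L adj_op W)"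
  by (simp add: positive_op_def adj_op_bounded cinner_adj_left[of W, symmetric])

lemma norm_sq_apply_le:
  fixes T :: "'a::chilbert_space op" 
  shows "(norm (T x))\<^sup>2 \<le> (norm T)\<^sup>2 * (norm x)\<^sup>2"
  by (metis norm_blinfun norm_ge_zero power_mono power_mult_distrib)

lemma positive_cauchy_schwarz:
  assumes "positive_op P"
  shows "(inner x (blinfun_apply P y))\<^sup>2 \<le> inner x (P x) * inner y (P y)"
proof -
  have sym: "inner y (P x) = inner x (P y)"
    by (metis Re_cinner assms hermitianD inner_commute positive_hermitian)
  have q: "0 \<le> inner x (P x) + 2 * r * inner x (P y) + r\<^sup>2 * inner y (P y)" for r
    using positive_inner_nonneg[OF assms, of "x + r *\<^sub>R y"]
    by (simp add: blinfun.add_right blinfun.scaleR_right inner_add_left inner_add_right sym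
        algebra_simps power2_eq_square)
  define a b c where "a = inner x (P x)" and "b = inner x (P y)" and "c = inner y (P y)"
  have c: "c \<ge> 0" "a \<ge> 0" by (simp_all add: c_def a_def positive_inner_nonneg assms)
  have q: "0 \<le> a + 2 * r * b + r\<^sup>2 * c" for r using q by (simp add: a_def b_def c_def)
  have "b\<^sup>2 \<le> a * c"
  proof (cases "c = 0")
    case True
    have "b = 0"
    proof (rule ccontr)
      assume b: "b \<noteq> 0"
      show False using q[of "- (a + 1) / (2 * b)"] b True c by (simp add: field_simps)
    qed
    then show ?thesis using c by simp
  next
    case False
    show ?thesis using q[of "- b / c"] False c by (simp add: field_simps power2_eq_square)
  qed
  then show ?thesis by (simp add: a_def b_def c_def)
qed

lemma positive_apply_eq_0:
  assumes "positive_op P" "inner x (blinfun_apply P x) = 0"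
  shows "P x = 0"
  using positive_cauchy_schwarz[OF assms(1), of "P x" x] assms(2) by simp

text \<open>Cauchy-Schwarz for the form of \<open>P\<close>, applied to the pair \<open>P x\<close>, \<open>x\<close>.\<close>

lemma positive_norm_le:
  assumes "positive_op P" "\<And>x. inner x (blinfun_apply P x) \<le> K * (norm x)\<^sup>2" "K \<ge> 0"
  shows "norm P \<le> K"
proof (rule norm_blinfun_bound[OF assms(3)])
  fix x
  have "(inner (P x) (P x))\<^sup>2 \<le> inner (P x) (P (P x)) * inner x (P x)"
    by (rule positive_cauchy_schwarz[OF assms(1)])
  also have "\<dots> \<le> (K * (norm (P x))\<^sup>2) * (K * (norm x)\<^sup>2)"
    by (intro mult_mono assms positive_inner_nonneg) (simp_all add: assms)
  finally have "((norm (P x))\<^sup>2)\<^sup>2 \<le> (K * norm x * norm (P x))\<^sup>2"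
    by (simp add: power2_norm_eq_inner[symmetric] power_mult_distrib algebra_simps power2_eq_square)
  then have "(norm (P x))\<^sup>2 \<le> K * norm x * norm (P x)"
    by (rule power2_le_imp_le) (simp add: assms)
  then show "norm (P x) \<le> K * norm x"
    by (cases "P x = 0") (auto simp: power2_eq_square assms)
qed


section \<open>Square roots of positive operators\<close>

lemma op_assoc: "(A o\<^sub>L B) o\<^sub>L C = A o\<^sub>L (B o\<^sub>L C)"
  by (rule blinfun_eqI) simp

lemma op_id [simp]: "id_blinfun o\<^sub>L A = A" "A o\<^sub>L id_blinfun = A"
  by (auto intro: blinfun_eqI)

text \<open>A fixed point \<open>Y\<close> of \<open>Y \<mapsto> (X + Y\<^sup>2) / 2\<close> satisfies \<open>(1 - Y)\<^sup>2 = 1 - X\<close>, so a root of \<open>T\<close> with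
  \<open>0 \<le> T \<le> 1\<close> is found by iterating from \<open>0\<close> with \<open>X = 1 - T\<close>.  The same iteration for the number \<open>1\<close>
  is increasing and bounded; it majorises the norms and the increments of the operator iteration.\<close>

fun sqrt_iter :: "'a::real_normed_vector op \<Rightarrow> nat \<Rightarrow> 'a op" where
  "sqrt_iter X 0 = 0"
| "sqrt_iter X (Suc n) = (1/2) *\<^sub>R (X + (sqrt_iter X n o\<^sub>L sqrt_iter X n))"

fun sqrt_majorant :: "nat \<Rightarrow> real" where
  "sqrt_majorant 0 = 0"
| "sqrt_majorant (Suc n) = (1 + (sqrt_majorant n)\<^sup>2) / 2"

lemma sqrt_majorant_bounds: "0 \<le> sqrt_majorant n \<and> sqrt_majorant n \<le> 1"
  by (induction n) (auto simp: power_le_one)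

lemma sqrt_iter_norm:
  assumes "norm X \<le> 1"
  shows "norm (sqrt_iter X n) \<le> sqrt_majorant n"
proof (induction n)
  case (Suc n)
  have "norm (sqrt_iter X n o\<^sub>L sqrt_iter X n) \<le> (sqrt_majorant n)\<^sup>2"
    using norm_blinfun_compose[of "sqrt_iter X n" "sqrt_iter X n"] Suc
      mult_mono'[OF Suc Suc] by (simp add: power2_eq_square)
  then have "norm (X + (sqrt_iter X n o\<^sub>L sqrt_iter X n)) \<le> 1 + (sqrt_majorant n)\<^sup>2"
    using assms norm_triangle_ineq[of X "sqrt_iter X n o\<^sub>L sqrt_iter X n"] by linarith
  then show ?case by simp
qed simp

text \<open>The increment is \<open>(Y (Y - Z) + (Y - Z) Z) / 2\<close> for consecutive iterates \<open>Y\<close>, \<open>Z\<close>, which carries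
  the majorant from one step to the next without any commutation.\<close>

lemma sqrt_iter_step:
  assumes "norm X \<le> 1"
  shows "norm (sqrt_iter X (Suc n) - sqrt_iter X n) \<le> sqrt_majorant (Suc n) - sqrt_majorant n"
proof (induction n)
  case (Suc n)
  let ?Y = "sqrt_iter X (Suc n)" and ?Z = "sqrt_iter X n"
  let ?y = "sqrt_majorant (Suc n)" and ?z = "sqrt_majorant n"
  have "sqrt_iter X (Suc (Suc n)) - ?Y = (1/2) *\<^sub>R (?Y o\<^sub>L ?Y) - (1/2) *\<^sub>R (?Z o\<^sub>L ?Z)"
    unfolding sqrt_iter.simps(2)[of X "Suc n"]
    by (subst (3) sqrt_iter.simps(2)) (simp add: scaleR_add_right del: sqrt_iter.simps)
  also have "\<dots> = (1/2) *\<^sub>R ((?Y o\<^sub>L (?Y - ?Z)) + ((?Y - ?Z) o\<^sub>L ?Z))"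
    by (simp only: blinfun_compose.diff_left blinfun_compose.diff_right scaleR_diff_right
        scaleR_add_right) simp
  finally have eq: "sqrt_iter X (Suc (Suc n)) - ?Y = \<dots>" .
  have "norm (?Y o\<^sub>L (?Y - ?Z)) \<le> ?y * (?y - ?z)"
    by (rule order_trans[OF norm_blinfun_compose mult_mono'[OF sqrt_iter_norm[OF assms] Suc]]) auto
  moreover have "norm ((?Y - ?Z) o\<^sub>L ?Z) \<le> (?y - ?z) * ?z"
    by (rule order_trans[OF norm_blinfun_compose mult_mono'[OF Suc sqrt_iter_norm[OF assms]]]) auto
  ultimately have "norm ((?Y o\<^sub>L (?Y - ?Z)) + ((?Y - ?Z) o\<^sub>L ?Z)) \<le> ?y * (?y - ?z) + (?y - ?z) * ?z"
    using norm_triangle_ineq[of "?Y o\<^sub>L (?Y - ?Z)" "(?Y - ?Z) o\<^sub>L ?Z"] by linarith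
  also have "\<dots> = ?y\<^sup>2 - ?z\<^sup>2" by (simp add: algebra_simps power2_eq_square)
  finally have "norm (sqrt_iter X (Suc (Suc n)) - ?Y) \<le> (?y\<^sup>2 - ?z\<^sup>2) / 2"
    unfolding eq by simp
  also have "\<dots> = sqrt_majorant (Suc (Suc n)) - ?y"
    by (simp only: sqrt_majorant.simps(2)[of "Suc n"]) (simp add: field_simps)
  finally show ?case .
qed (use assms in simp)

lemma sqrt_iter_convergent:
  fixes X :: "'a::banach op"
  assumes "norm X \<le> 1"
  obtains Y where "sqrt_iter X \<longlonglongrightarrow> Y"
proof -
  have mono: "sqrt_majorant n \<le> sqrt_majorant (Suc n)" for n
    using order_trans[OF norm_ge_zero sqrt_iter_step[of "0 :: 'a op" n]] by simp
  have "convergent sqrt_majorant"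
    by (rule Bseq_monoseq_convergent)
      (use sqrt_majorant_bounds mono in \<open>auto intro!: BseqI'[of _ 1] simp: monoseq_Suc\<close>)
  then have C: "Cauchy sqrt_majorant" by (rule convergent_Cauchy)
  have diff: "norm (sqrt_iter X (n + k) - sqrt_iter X n) \<le> sqrt_majorant (n + k) - sqrt_majorant n" for n k
  proof (induction k)
    case (Suc k)
    have "norm (sqrt_iter X (Suc (n + k)) - sqrt_iter X n)
        \<le> norm (sqrt_iter X (Suc (n + k)) - sqrt_iter X (n + k)) + norm (sqrt_iter X (n + k) - sqrt_iter X n)"
      using norm_triangle_ineq[of "sqrt_iter X (Suc (n + k)) - sqrt_iter X (n + k)"
          "sqrt_iter X (n + k) - sqrt_iter X n"] by simp
    then show ?case using Suc sqrt_iter_step[OF assms, of "n + k"] by simp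
  qed simp
  have "Cauchy (sqrt_iter X)"
  proof (rule metric_CauchyI)
    fix e :: real assume "e > 0"
    then obtain N where N: "\<And>m n. m \<ge> N \<Longrightarrow> n \<ge> N \<Longrightarrow> dist (sqrt_majorant m) (sqrt_majorant n) < e"
      using C unfolding Cauchy_def by blast
    have "dist (sqrt_iter X m) (sqrt_iter X n) < e" if "m \<ge> n" "n \<ge> N" for m n
      using N[of m n] diff[of n "m - n"] that by (simp add: dist_norm)
    then show "\<exists>M. \<forall>m\<ge>M. \<forall>n\<ge>M. dist (sqrt_iter X m) (sqrt_iter X n) < e"
      by (metis dist_commute nle_le)
  qed
  then show thesis using that Cauchy_convergent convergent_def by blast
qed

text \<open>An induction principle for square roots: the root iteration stays in every set of this kind.
  Closure under squares replaces closure under products, so that besides commutants also the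
  Jordan algebra of operators fixed together with their square is an instance.\<close>

definition closed_square_algebra :: "'a::real_normed_vector op set \<Rightarrow> bool" where
  "closed_square_algebra C \<longleftrightarrow> closed C \<and> subspace C \<and> id_blinfun \<in> C \<and> (\<forall>S\<in>C. S o\<^sub>L S \<in> C)"

lemma sqrt_exists:
  fixes T :: "'a::chilbert_space op"
  assumes "positive_op T"
  obtains R where "positive_op R" "R o\<^sub>L R = T"
    "\<And>C. closed_square_algebra C \<Longrightarrow> T \<in> C \<Longrightarrow> R \<in> C"
proof -
  \<comment> \<open>Scaling by \<open>c\<close> moves \<open>T\<close> below the identity; the summand 1 covers \<open>T = 0\<close>.\<close>
  define c where "c = norm T + 1"
  have c: "c > 0" by (simp add: c_def add_nonneg_pos)
  define X where "X = id_blinfun - (1/c) *\<^sub>R T"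
  have herm: "hermitian X"
    unfolding X_def using assms
    by (intro hermitian_diff hermitian_id hermitian_scaleR positive_hermitian)
  have Tle: "inner x (T x) \<le> c * (norm x)\<^sup>2" for x
  proof -
    have "inner x (T x) \<le> norm x * (norm T * norm x)"
      by (rule order_trans[OF norm_cauchy_schwarz]) (simp add: mult_left_mono norm_blinfun)
    also have "\<dots> \<le> c * (norm x)\<^sup>2" by (simp add: c_def power2_eq_square algebra_simps)
    finally show ?thesis .
  qed
  have Xq: "inner x (X x) = (norm x)\<^sup>2 - inner x (T x) / c" for x
    by (simp add: X_def blinfun.diff_left blinfun.scaleR_left inner_diff_right power2_norm_eq_inner)
  have pos: "positive_op X"
    using Tle c herm by (simp add: positive_iff Xq field_simps)
  have "norm X \<le> 1"
    using positive_inner_nonneg[OF assms] c by (intro positive_norm_le[OF pos]) (simp_all add: Xq)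
  then obtain Y where Y: "sqrt_iter X \<longlonglongrightarrow> Y" by (rule sqrt_iter_convergent)
  have "(\<lambda>n. sqrt_iter X (Suc n)) \<longlonglongrightarrow> (1/2) *\<^sub>R (X + (Y o\<^sub>L Y))"
    unfolding sqrt_iter.simps by (intro tendsto_intros blinfun_compose.tendsto Y)
  then have fixpoint: "Y = (1/2) *\<^sub>R (X + (Y o\<^sub>L Y))"
    using LIMSEQ_Suc[OF Y] LIMSEQ_unique by blast
  have nY: "norm Y \<le> 1"
    using sqrt_iter_norm[OF \<open>norm X \<le> 1\<close>] sqrt_majorant_bounds
    by (intro LIMSEQ_le_const2[OF tendsto_norm[OF Y]]) (meson order_trans)
  have "hermitian (sqrt_iter X n)" for n
    by (induction n) (auto intro!: hermitian_0 hermitian_scaleR hermitian_add herm hermitian_compose_self)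
  then have hY: "hermitian Y"
    using closed_sequentially[OF closed_hermitian _ Y] by simp
  define R where "R = sqrt c *\<^sub>R (id_blinfun - Y)"
  have "inner x (Y x) \<le> inner x x" for x
  proof -
    have "inner x (Y x) \<le> norm x * (norm Y * norm x)"
      by (rule order_trans[OF norm_cauchy_schwarz]) (simp add: mult_left_mono norm_blinfun)
    also have "\<dots> \<le> norm x * (1 * norm x)" by (intro mult_left_mono mult_right_mono nY) auto
    finally show ?thesis by (simp add: power2_norm_eq_inner[symmetric] power2_eq_square)
  qed
  then have "positive_op (id_blinfun - Y)"
    by (simp add: positive_iff hermitian_diff hermitian_id hY blinfun.diff_left inner_diff_right)
  then have 1: "positive_op R" unfolding R_def using c by (intro positive_scaleR) auto
  have "Y o\<^sub>L Y = 2 *\<^sub>R Y - X"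
    using arg_cong[OF fixpoint, of "\<lambda>Z. 2 *\<^sub>R Z"] by simp
  then have "(id_blinfun - Y) o\<^sub>L (id_blinfun - Y) = (1/c) *\<^sub>R T"
    by (simp add: blinfun_compose.diff_left blinfun_compose.diff_right X_def scaleR_2)
  then have 2: "R o\<^sub>L R = T"
    using c by (simp add: R_def blinfun_compose.scaleR_left blinfun_compose.scaleR_right)
  show thesis
  proof (rule that[OF 1 2])
    fix C :: "'a op set" assume C: "closed_square_algebra C" and T: "T \<in> C"
    have sub: "subspace C" using C by (simp add: closed_square_algebra_def)
    have "X \<in> C" using C T unfolding X_def closed_square_algebra_def
      by (auto intro!: subspace_diff subspace_scale)
    then have "sqrt_iter X n \<in> C" for n
      using C by (induction n) (auto simp: closed_square_algebra_def subspace_0 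
          intro!: subspace_scale subspace_add simp del: scaleR_half_double)
    then have "Y \<in> C" using C closed_sequentially[OF _ _ Y] by (auto simp: closed_square_algebra_def)
    then show "R \<in> C" using C unfolding R_def closed_square_algebra_def
      by (auto intro!: subspace_diff subspace_scale)
  qed
qed

lemma commutant_closed_square_algebra:
  fixes K :: "'a::real_normed_vector op"
  shows "closed_square_algebra {S. K o\<^sub>L S = S o\<^sub>L K}"
proof -
  have "closed {S. K o\<^sub>L S = S o\<^sub>L K}"
    by (intro closed_Collect_eq blinfun_compose.continuous_on continuous_intros)
  moreover have "K o\<^sub>L (S o\<^sub>L S) = (S o\<^sub>L S) o\<^sub>L K" if "K o\<^sub>L S = S o\<^sub>L K" for S
    by (metis op_assoc that)
  ultimately show ?thesis
    by (auto simp: closed_square_algebra_def subspace_def blinfun_compose.add_left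
        blinfun_compose.add_right blinfun_compose.scaleR_left blinfun_compose.scaleR_right)
qed

text \<open>A second root commutes with the operator, hence with the root obtained by iteration, and
  on the range of the difference of the two roots both vanish.\<close>

lemma sqrt_unique:
  fixes T :: "'a::chilbert_space op"
  assumes "positive_op R" "R o\<^sub>L R = T" and "positive_op Q" "Q o\<^sub>L Q = T"
    and Q: "\<And>C. closed_square_algebra C \<Longrightarrow> T \<in> C \<Longrightarrow> Q \<in> C"
  shows "R = Q"
proof (rule blinfun_eqI)
  fix x
  have "R o\<^sub>L T = T o\<^sub>L R" using assms(2) op_assoc by metis
  with Q[OF commutant_closed_square_algebra, of R] have comm: "R o\<^sub>L Q = Q o\<^sub>L R" by simp
  define y where "y = R x - Q x"
  have "R y + Q y = (R o\<^sub>L R) x - (R o\<^sub>L Q) x + (Q o\<^sub>L R) x - (Q o\<^sub>L Q) x"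
    by (simp add: y_def blinfun.diff_right)
  then have "R y + Q y = 0" by (simp only: comm assms(2,4)) simp
  then have "inner y (R y) + inner y (Q y) = 0" by (metis inner_add_right inner_zero_right)
  then have "inner y (R y) = 0" "inner y (Q y) = 0"
    using positive_inner_nonneg[OF assms(1), of y] positive_inner_nonneg[OF assms(3), of y] by linarith+
  then have "R y = 0" "Q y = 0" using assms positive_apply_eq_0 by blast+
  then have "cinner y y = 0"
    using hermitianD[OF positive_hermitian[OF assms(1)], of x y]
      hermitianD[OF positive_hermitian[OF assms(3)], of x y]
    by (subst y_def) (simp add: cinner.diff_left cinner.zero_right)
  then show "R x = Q x" by (simp add: cinner_self y_def)
qed

lemma sqrt_op_works:
  assumes "positive_op T"
  shows positive_sqrt: "positive_op (sqrt_op T)"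
    and sqrt_square: "sqrt_op T o\<^sub>L sqrt_op T = T"
    and sqrt_in_closed_square_algebra: "closed_square_algebra C \<Longrightarrow> T \<in> C \<Longrightarrow> sqrt_op T \<in> C"
    and sqrt_eqI: "positive_op R \<Longrightarrow> R o\<^sub>L R = T \<Longrightarrow> sqrt_op T = R"
proof -
  obtain Q where Q: "positive_op Q" "Q o\<^sub>L Q = T"
    "\<And>C. closed_square_algebra C \<Longrightarrow> T \<in> C \<Longrightarrow> Q \<in> C"
    using sqrt_exists[OF assms] by blast
  have uniq: "R = Q" if "positive_op R" "R o\<^sub>L R = T" for R
    by (rule sqrt_unique[OF that Q])
  have sqrt: "sqrt_op T = Q"
    unfolding sqrt_op_def by (rule the_equality) (auto intro: uniq simp: Q(1,2))
  show "positive_op (sqrt_op T)" "sqrt_op T o\<^sub>L sqrt_op T = T" by (simp_all add: sqrt Q(1,2))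
  show "sqrt_op T \<in> C" if "closed_square_algebra C" "T \<in> C"
    using Q(3)[OF that] by (simp add: sqrt)
  show "sqrt_op T = R" if "positive_op R" "R o\<^sub>L R = T"
    using uniq[OF that] by (simp add: sqrt)
qed

lemma hermitian_sqrt: "positive_op T \<Longrightarrow> hermitian (sqrt_op T)"
  by (simp add: positive_hermitian positive_sqrt)

text \<open>The root of \<open>P\<close> commutes with \<open>Q\<close> as well, so that \<open>P Q\<close> is \<open>Q\<close> sandwiched between two
  copies of this root.\<close>

lemma positive_commuting_product:
  assumes "positive_op P" "positive_op Q" "P o\<^sub>L Q = Q o\<^sub>L P"
  shows "positive_op (P o\<^sub>L Q)"
proof -
  have "Q o\<^sub>L sqrt_op P = sqrt_op P o\<^sub>L Q"
    using sqrt_in_closed_square_algebra[OF assms(1) commutant_closed_square_algebra, of Q] assms(3) by simp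
  then have "P o\<^sub>L Q = sqrt_op P o\<^sub>L Q o\<^sub>L sqrt_op P"
    by (metis assms(1) op_assoc sqrt_square)
  then show ?thesis using positive_sandwich[OF hermitian_sqrt[OF assms(1)] assms(2)] by simp
qed


section \<open>Polar decomposition\<close>

lemma abs_op_works:
  assumes "T \<in> bounded_ops"
  shows positive_abs: "positive_op (abs_op T)"
    and abs_square: "abs_op T o\<^sub>L abs_op T = adj_op T o\<^sub>L T"
  unfolding abs_op_def
  by (rule positive_sqrt[OF positive_adj_compose[OF assms]] sqrt_square[OF positive_adj_compose[OF assms]])+

lemma abs_op_positive: "positive_op T \<Longrightarrow> abs_op T = T"
  unfolding abs_op_def by (metis hermitian_def positive_hermitian positive_square sqrt_eqI)

lemma norm_abs_op:
  assumes "T \<in> bounded_ops"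
  shows "norm (abs_op T x) = norm (T x)"
proof -
  have "cinner (abs_op T x) (abs_op T x) = cinner x ((abs_op T o\<^sub>L abs_op T) x)"
    by (simp add: hermitianD[OF positive_hermitian[OF positive_abs[OF assms]]])
  also have "\<dots> = cinner (T x) (T x)"
    by (simp add: abs_square[OF assms] cinner_adj_right assms)
  finally have "(norm (abs_op T x))\<^sup>2 = (norm (T x))\<^sup>2" by (simp add: cinner_self flip: of_real_power)
  then show ?thesis by simp
qed

lemma inner_scaleC_left: "inner (c *\<^sub>C x) y = inner x (cnj c *\<^sub>C (y :: 'a::complex_inner))"
  by (simp flip: Re_cinner add: cinner_scaleC_left cinner_scaleC_right)

lemma subspace_closure:
  fixes S :: "'a::real_normed_vector set"
  assumes "subspace S"
  shows "subspace (closure S)"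
  unfolding subspace_def
proof (intro conjI ballI allI)
  show "0 \<in> closure S" using assms closure_subset subspace_0 by blast
  fix x r assume "x \<in> closure S"
  then obtain f where f: "\<And>n. f n \<in> S" "f \<longlonglongrightarrow> x" using closure_sequential by metis
  show "r *\<^sub>R x \<in> closure S"
    unfolding closure_sequential using f assms
    by (intro exI[of _ "\<lambda>n. r *\<^sub>R f n"]) (auto intro!: tendsto_intros simp: subspace_scale)
  fix y assume "y \<in> closure S"
  then obtain g where g: "\<And>n. g n \<in> S" "g \<longlonglongrightarrow> y" using closure_sequential by metis
  show "x + y \<in> closure S"
    unfolding closure_sequential using f g assms
    by (intro exI[of _ "\<lambda>n. f n + g n"]) (auto intro!: tendsto_intros simp: subspace_add)
qed

text \<open>The factor sends \<open>S x\<close> to \<open>T x\<close>, is extended by continuity to the closure of the range of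
  \<open>S\<close> and by zero to its orthogonal complement.\<close>

lemma contraction_factor:
  fixes T S :: "'a::chilbert_space op"
  assumes T: "T \<in> bounded_ops" and S: "S \<in> bounded_ops"
    and le: "\<And>x. norm (T x) \<le> norm (S x)"
  obtains C where "C \<in> bounded_ops" "norm C \<le> 1" "T = C o\<^sub>L S"
proof -
  \<comment> \<open>The graph of the factor: \<open>m\<close> is the projection of \<open>w\<close> to the closure of the range of \<open>S\<close>.\<close>
  define G where "G w v \<longleftrightarrow> (\<exists>x m. (\<lambda>n. S (x n)) \<longlonglongrightarrow> m \<and> (\<lambda>n. T (x n)) \<longlonglongrightarrow> v \<and>
      (\<forall>u. inner (w - m) (S u) = 0))" for w v
  have ex: "\<exists>v. G w v" for w
  proof -
    have "subspace (range (blinfun_apply S))"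
      by (intro linear_subspace_image blinfun.bounded_linear_right bounded_linear.linear) simp
    then obtain m where m: "m \<in> closure (range (blinfun_apply S))"
      "\<And>u. u \<in> closure (range (blinfun_apply S)) \<Longrightarrow> inner (w - m) u = 0"
      using orthogonal_projection_exists[of "closure (range (blinfun_apply S))" w]
      by (metis closed_closure subspace_closure)
    obtain y where y: "\<And>n. y n \<in> range (blinfun_apply S)" "y \<longlonglongrightarrow> m"
      using m(1) closure_sequential by blast
    then obtain x where "\<And>n. y n = S (x n)" unfolding image_iff by metis
    then have "y = (\<lambda>n. S (x n))" by blast
    with y have x: "(\<lambda>n. S (x n)) \<longlonglongrightarrow> m" by simp
    have "Cauchy (\<lambda>n. T (x n))"
    proof (rule metric_CauchyI)
      fix e :: real assume "e > 0"
      then obtain N where N: "\<And>i j. i \<ge> N \<Longrightarrow> j \<ge> N \<Longrightarrow> dist (S (x i)) (S (x j)) < e"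
        using LIMSEQ_imp_Cauchy[OF x] unfolding Cauchy_def by blast
      have "dist (T (x i)) (T (x j)) \<le> dist (S (x i)) (S (x j))" for i j
        using le[of "x i - x j"] by (simp add: dist_norm blinfun.diff_right)
      then show "\<exists>N. \<forall>i\<ge>N. \<forall>j\<ge>N. dist (T (x i)) (T (x j)) < e"
        using N by (meson le_less_trans)
    qed
    then obtain v where "(\<lambda>n. T (x n)) \<longlonglongrightarrow> v" using Cauchy_convergent convergent_def by blast
    moreover have "inner (w - m) (S u) = 0" for u
      by (rule m(2)) (meson closure_subset rangeI subsetD)
    ultimately show ?thesis using x unfolding G_def by blast
  qed
  have bound: "norm v \<le> norm w" if "G w v" for w v
  proof -
    obtain x m where x: "(\<lambda>n. S (x n)) \<longlonglongrightarrow> m" "(\<lambda>n. T (x n)) \<longlonglongrightarrow> v"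
      and orth: "\<And>u. inner (w - m) (S u) = 0" using \<open>G w v\<close> unfolding G_def by blast
    have "norm v \<le> norm m"
      by (rule LIMSEQ_le[OF tendsto_norm[OF x(2)] tendsto_norm[OF x(1)]]) (use le in blast)
    moreover have "(\<lambda>n. inner (w - m) (S (x n))) \<longlonglongrightarrow> inner (w - m) m"
      by (intro tendsto_intros x)
    then have "inner (w - m) m = 0" by (simp add: orth LIMSEQ_const_iff)
    then have "inner w m = (norm m)\<^sup>2" by (simp add: inner_diff_left power2_norm_eq_inner)
    then have "norm m * norm m \<le> norm w * norm m"
      using norm_cauchy_schwarz[of w m] by (simp add: power2_eq_square)
    then have "norm m \<le> norm w" by (cases "m = 0") auto
    ultimately show ?thesis by linarith
  qed
  have add: "G (w + w') (v + v')" if G: "G w v" "G w' v'" for w w' v v'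
  proof -
    from G obtain x m x' m' where "(\<lambda>n. S (x n)) \<longlonglongrightarrow> m" "(\<lambda>n. T (x n)) \<longlonglongrightarrow> v"
      "\<forall>u. inner (w - m) (S u) = 0" "(\<lambda>n. S (x' n)) \<longlonglongrightarrow> m'" "(\<lambda>n. T (x' n)) \<longlonglongrightarrow> v'"
      "\<forall>u. inner (w' - m') (S u) = 0" unfolding G_def by metis
    then show ?thesis unfolding G_def
      by (intro exI[of _ "\<lambda>n. x n + x' n"] exI[of _ "m + m'"])
        (auto simp: blinfun.add_right inner_diff_left inner_add_left intro!: tendsto_add)
  qed
  have scale: "G (c *\<^sub>C w) (c *\<^sub>C v)" if G: "G w v" for c w v
  proof -
    from G obtain x m where x: "(\<lambda>n. S (x n)) \<longlonglongrightarrow> m" "(\<lambda>n. T (x n)) \<longlonglongrightarrow> v"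
      "\<forall>u. inner (w - m) (S u) = 0" unfolding G_def by metis
    have "inner (c *\<^sub>C w - c *\<^sub>C m) (S u) = 0" for u
      using x(3)[rule_format, of "cnj c *\<^sub>C u"]
      by (simp add: scaleC_diff_right[symmetric] inner_scaleC_left bounded_ops_scaleC[OF S])
    then show ?thesis unfolding G_def
      using x(1,2) by (intro exI[of _ "\<lambda>n. c *\<^sub>C x n"] exI[of _ "c *\<^sub>C m"])
        (auto simp: bounded_ops_scaleC[OF S] bounded_ops_scaleC[OF T]
          intro!: bounded_linear.tendsto[OF bounded_linear_scaleC])
  qed
  have uniq: "v = v'" if "G w v" "G w v'" for w v v'
  proof -
    have "G (w + (-1) *\<^sub>C w) (v + (-1) *\<^sub>C v')" using add scale that by blast
    from bound[OF this] have "norm (v - v') \<le> norm (w - w)" by (simp add: scaleC_minus_one)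
    then show ?thesis by simp
  qed
  obtain g where g: "\<And>w. G w (g w)" using ex by metis
  have gscale: "g (c *\<^sub>C w) = c *\<^sub>C g w" for c w using uniq g scale by blast
  have "bounded_linear g"
  proof (rule bounded_linear_intro)
    show "g (x + y) = g x + g y" for x y using uniq g add by blast
    show "g (r *\<^sub>R x) = r *\<^sub>R g x" for r x using gscale by (metis scaleC_of_real)
    show "norm (g x) \<le> norm x * 1" for x using bound g by simp
  qed
  then have app: "blinfun_apply (Blinfun g) = g" by (rule bounded_linear_Blinfun_apply)
  show thesis
  proof (rule that[of "Blinfun g"])
    show "Blinfun g \<in> bounded_ops" by (simp add: bounded_ops_def app gscale)
    show "norm (Blinfun g) \<le> 1" by (rule norm_blinfun_bound) (use bound g in \<open>auto simp: app\<close>)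
    have "G (S x) (T x)" for x
      unfolding G_def by (intro exI[of _ "\<lambda>n. x"] exI[of _ "S x"]) auto
    then have "T x = g (S x)" for x using uniq g by blast
    then show "T = Blinfun g o\<^sub>L S" by (intro blinfun_eqI) (simp add: app)
  qed
qed

text \<open>The contraction \<open>U\<close> with \<open>T = U |T|\<close> preserves norms on the range of \<open>|T|\<close>, so the positive operator
  \<open>1 - U\<^sup>* U\<close> vanishes there; this yields the second equation.\<close>

lemma polar_decomposition:
  fixes T :: "'a::chilbert_space op"
  assumes "T \<in> bounded_ops"
  obtains U where "U \<in> bounded_ops" "norm U \<le> 1" "T = U o\<^sub>L abs_op T" "abs_op T = adj_op U o\<^sub>L T"
proof -
  let ?S = "abs_op T"
  obtain U where U: "U \<in> bounded_ops" "norm U \<le> 1" "T = U o\<^sub>L ?S"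
    using contraction_factor[OF assms positive_bounded[OF positive_abs[OF assms]]]
      norm_abs_op[OF assms] by (metis order_refl)
  define D where "D = id_blinfun - (adj_op U o\<^sub>L U)"
  have Dq: "inner x (D x) = (norm x)\<^sup>2 - (norm (U x))\<^sup>2" for x
  proof -
    have "cinner x (D x) = complex_of_real ((norm x)\<^sup>2 - (norm (U x))\<^sup>2)"
      by (simp add: D_def blinfun.diff_left cinner.diff_right cinner_adj_right U(1) cinner_self)
    then show ?thesis by (metis Re_cinner Re_complex_of_real)
  qed
  have "hermitian D" unfolding D_def
    by (intro hermitian_diff hermitian_id positive_hermitian positive_adj_compose U)
  moreover have "(norm (U x))\<^sup>2 \<le> (norm x)\<^sup>2" for x
    using norm_blinfun[of U x] U(2)
    by (intro power_mono) (metis mult_left_le_one_le norm_ge_zero order_trans, simp)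
  ultimately have pos: "positive_op D" by (simp add: positive_iff Dq)
  have "?S = adj_op U o\<^sub>L T"
  proof (rule blinfun_eqI)
    fix x
    have "U (?S x) = T x" using U(3) by (metis blinfun_apply_blinfun_compose)
    then have "D (?S x) = 0"
      by (intro positive_apply_eq_0[OF pos]) (simp add: Dq norm_abs_op[OF assms])
    then show "?S x = (adj_op U o\<^sub>L T) x"
      using \<open>U (?S x) = T x\<close> by (simp add: D_def blinfun.diff_left)
  qed
  then show thesis using that U by blast
qed

lemma norm_adj_le:
  fixes T :: "'a::chilbert_space op"
  assumes "T \<in> bounded_ops"
  shows "norm (adj_op T) \<le> norm T"
proof (rule norm_blinfun_bound)
  fix x
  let ?y = "adj_op T x"
  have "norm ?y * norm ?y = cmod (cinner ?y ?y)" by (simp add: cinner_self power2_eq_square norm_mult)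
  also have "\<dots> = cmod (cinner (T ?y) x)" by (simp add: cinner_adj_right assms)
  also have "\<dots> \<le> norm (T ?y) * norm x" by (rule cmod_cinner_le)
  also have "\<dots> \<le> norm T * norm ?y * norm x" by (intro mult_right_mono norm_blinfun) simp
  finally show "norm ?y \<le> norm T * norm x"
    by (cases "?y = 0") (auto simp: mult_ac)
qed simp


section \<open>Orthonormal bases\<close>

lemma scaleC_diff_left: "(c - d) *\<^sub>C x = c *\<^sub>C x - d *\<^sub>C (x :: 'a::complex_vector)"
  using scaleC_add_left[of c "- d" x] by simp

text \<open>A maximal orthonormal set is a basis, because a normalised vector orthogonal to it could be
  added.\<close>

lemma is_onb_exists: "\<exists>E :: 'a::chilbert_space set. is_onb E"
proof -
  define ON :: "'a set \<Rightarrow> bool" where "ON E \<longleftrightarrow> (\<forall>e\<in>E. norm e = 1) \<and>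
     (\<forall>e\<in>E. \<forall>f\<in>E. e \<noteq> f \<longrightarrow> cinner e f = 0)" for E
  have "\<exists>E\<in>Collect ON. \<forall>X\<in>Collect ON. E \<subseteq> X \<longrightarrow> X = E"
  proof (rule subset_Zorn')
    fix C :: "'a set set" assume C: "subset.chain (Collect ON) C"
    then have on: "ON E" if "E \<in> C" for E using that by (auto simp: subset_chain_def)
    have "ON (\<Union>C)" unfolding ON_def
    proof (intro conjI ballI impI)
      fix e f assume "e \<in> \<Union>C" "f \<in> \<Union>C" and ne: "e \<noteq> f"
      then obtain E F where "E \<in> C" "F \<in> C" "e \<in> E" "f \<in> F" by blast
      moreover then have "E \<subseteq> F \<or> F \<subseteq> E" using C by (auto simp: subset_chain_def)
      ultimately have "\<exists>G\<in>C. e \<in> G \<and> f \<in> G" by blast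
      then show "cinner e f = 0" using on ne unfolding ON_def by blast
    qed (use on in \<open>auto simp: ON_def\<close>)
    then show "\<Union>C \<in> Collect ON" by simp
  qed
  then obtain E where E: "ON E" and max: "\<And>X. ON X \<Longrightarrow> E \<subseteq> X \<Longrightarrow> X = E" by blast
  have complete: "x = 0" if x: "\<forall>e\<in>E. cinner e x = 0" for x
  proof (rule ccontr)
    assume x0: "x \<noteq> 0"
    define u where "u = (1 / norm x) *\<^sub>R x"
    have nu: "norm u = 1" using x0 by (simp add: u_def)
    have eu: "cinner e u = 0" "cinner u e = 0" if "e \<in> E" for e
      using x that cinner_commute[of u e] by (auto simp: u_def cinner_scaleR_right simp del: cnj_cinner)
    have "ON (insert u E)" using E eu nu unfolding ON_def by auto
    then have "u \<in> E" using max by blast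
    then have "cinner u u = 0" using eu by blast
    then show False using nu by (simp add: cinner_self)
  qed
  have "is_onb E"
    unfolding is_onb_def using E[unfolded ON_def] complete by (intro conjI allI impI) simp_all
  then show ?thesis ..
qed

context
  fixes E :: "'a::chilbert_space set"
  assumes E: "is_onb E"
begin

lemma onb_cinner: "e \<in> E \<Longrightarrow> f \<in> E \<Longrightarrow> cinner e f = (if e = f then 1 else 0)"
  using E by (auto simp: is_onb_def cinner_self)

lemma onb_pythagoras:
  assumes "finite F" "F \<subseteq> E"
  shows "(norm x)\<^sup>2 = (norm (x - (\<Sum>e\<in>F. cinner e x *\<^sub>C e)))\<^sup>2 + (\<Sum>e\<in>F. (cmod (cinner e x))\<^sup>2)"
proof -
  define p where "p = (\<Sum>e\<in>F. cinner e x *\<^sub>C e)"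
  have ep: "cinner e p = cinner e x" if "e \<in> F" for e
  proof -
    have "cinner e p = (\<Sum>f\<in>F. cinner f x * (if e = f then 1 else 0))"
      unfolding p_def cinner.sum_right cinner_scaleC_right
      using that assms(2) by (intro sum.cong) (auto simp: onb_cinner subset_iff)
    then show ?thesis using that assms(1) by (simp add: if_distrib cong: if_cong)
  qed
  have 1: "cinner p y = (\<Sum>e\<in>F. cnj (cinner e x) * cinner e y)" for y
    unfolding p_def cinner.sum_left cinner_scaleC_left ..
  have px: "cinner p x = complex_of_real (\<Sum>e\<in>F. (cmod (cinner e x))\<^sup>2)"
    unfolding 1 of_real_sum complex_norm_square by (simp only: mult.commute)
  have pp: "cinner p p = cinner p x"
    unfolding 1 by (intro sum.cong) (auto simp: ep)
  have xp: "cinner x p = cinner p x" using px cnj_cinner[of p x] by (metis complex_cnj_complex_of_real)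
  have "cinner (x - p) (x - p) = cinner x x - cinner p x"
    by (simp add: cinner.diff_left cinner.diff_right pp xp)
  then have "complex_of_real ((norm (x - p))\<^sup>2) = complex_of_real ((norm x)\<^sup>2 - (\<Sum>e\<in>F. (cmod (cinner e x))\<^sup>2))"
    unfolding cinner_self px by simp
  then show ?thesis unfolding p_def by (simp only: of_real_eq_iff)
qed

text \<open>The vectors that equal their Fourier series form a closed subspace; what is orthogonal to it
  is orthogonal to the basis.\<close>

lemma onb_fourier: "((\<lambda>e. cinner e x *\<^sub>C e) has_sum x) E"
proof -
  define M where "M = {x. ((\<lambda>e. cinner e x *\<^sub>C e) has_sum x) E}"
  have "subspace M"
    unfolding subspace_def
  proof (intro conjI ballI allI)
    show "0 \<in> M" by (simp add: M_def cinner.zero_right)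
    show "x + y \<in> M" if "x \<in> M" "y \<in> M" for x y
      using has_sum_add[where f = "\<lambda>e. cinner e x *\<^sub>C e" and g = "\<lambda>e. cinner e y *\<^sub>C e" and A = E] that
      by (simp add: M_def cinner_add_right scaleC_add_left)
    show "r *\<^sub>R x \<in> M" if "x \<in> M" for r x
    proof -
      have "(cinner e (r *\<^sub>R x)) *\<^sub>C e = r *\<^sub>R (cinner e x *\<^sub>C e)" for e
        by (metis cinner_scaleR_right scaleC_of_real scaleC_scaleC scaleR_conv_of_real)
      then show ?thesis
        using has_sum_bounded_linear[OF bounded_linear_scaleR_right[of r],
            where f = "\<lambda>e. cinner e x *\<^sub>C e" and A = E and S = x] that
        by (simp add: M_def)
    qed
  qed
  moreover have "closed M"
  proof -
    have "x \<in> M" if x: "\<And>e. e > 0 \<Longrightarrow> \<exists>y\<in>M. dist y x < e" for x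
      unfolding M_def mem_Collect_eq has_sum_def tendsto_iff
    proof (intro allI impI)
      fix d :: real assume d: "d > 0"
      then obtain y where y: "y \<in> M" "dist y x < d / 3" using x[of "d / 3"] by auto
      have "\<forall>\<^sub>F F in finite_subsets_at_top E. dist (\<Sum>e\<in>F. cinner e y *\<^sub>C e) y < d / 3"
        using y(1) d unfolding M_def mem_Collect_eq has_sum_def tendsto_iff
        by (meson divide_pos_pos zero_less_numeral)
      moreover have "\<forall>\<^sub>F F in finite_subsets_at_top E. finite F \<and> F \<subseteq> E"
        by (simp add: eventually_finite_subsets_at_top_weakI)
      ultimately show "\<forall>\<^sub>F F in finite_subsets_at_top E. dist (\<Sum>e\<in>F. cinner e x *\<^sub>C e) x < d"
      proof eventually_elim
        case (elim F)
        \<comment> \<open>The partial sums are uniformly bounded in \<open>F\<close>, so the error at \<open>x\<close> is at most the error at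
          \<open>y\<close> plus the norm of \<open>z\<close>.\<close>
        define z where "z = x - y"
        have "(norm (z - (\<Sum>e\<in>F. cinner e z *\<^sub>C e)))\<^sup>2 \<le> (norm z)\<^sup>2"
          using onb_pythagoras[of F z] elim by (simp add: sum_nonneg)
        then have "norm (z - (\<Sum>e\<in>F. cinner e z *\<^sub>C e)) \<le> norm z"
          by (rule power2_le_imp_le) simp
        moreover have "(\<Sum>e\<in>F. cinner e x *\<^sub>C e) - x =
          ((\<Sum>e\<in>F. cinner e y *\<^sub>C e) - y) - (z - (\<Sum>e\<in>F. cinner e z *\<^sub>C e))"
          by (simp add: z_def cinner.diff_right sum_subtractf scaleC_diff_left)
        then have "norm ((\<Sum>e\<in>F. cinner e x *\<^sub>C e) - x) \<le>
          norm ((\<Sum>e\<in>F. cinner e y *\<^sub>C e) - y) + norm (z - (\<Sum>e\<in>F. cinner e z *\<^sub>C e))"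
          by (simp only: norm_triangle_ineq4)
        ultimately show ?case using elim y(2) d by (simp add: dist_norm z_def norm_minus_commute)
      qed
    qed
    then show ?thesis by (metis closure_approachable closure_subset_eq subsetI)
  qed
  ultimately obtain m where m: "m \<in> M" "\<And>u. u \<in> M \<Longrightarrow> inner (x - m) u = 0"
    using orthogonal_projection_exists by blast
  have EM: "c *\<^sub>C e \<in> M" if "e \<in> E" for c e
  proof -
    have "((\<lambda>f. cinner f (c *\<^sub>C e) *\<^sub>C f) has_sum (c *\<^sub>C e)) E \<longleftrightarrow>
          ((\<lambda>f. cinner f (c *\<^sub>C e) *\<^sub>C f) has_sum (c *\<^sub>C e)) {e}"
      using that by (intro has_sum_cong_neutral) (auto simp: cinner_scaleC_right onb_cinner)
    then show ?thesis using that by (simp add: M_def has_sum_finiteI cinner_scaleC_right onb_cinner)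
  qed
  have "cinner e (x - m) = 0" if "e \<in> E" for e
  proof (rule complex_eqI)
    show "Re (cinner e (x - m)) = Re 0"
      using m(2)[OF EM[OF that, of 1]] by (simp add: Re_cinner inner_commute)
    show "Im (cinner e (x - m)) = Im 0"
      using m(2)[OF EM[OF that, of \<i>]] by (simp add: Im_cinner inner_commute)
  qed
  then have "x - m = 0" using E unfolding is_onb_def by blast
  then have "x = m" by simp
  then show ?thesis using m(1) by (simp add: M_def)
qed

lemma parseval: "((\<lambda>e. cinner x e * cinner e y) has_sum cinner x y) E"
  using has_sum_bounded_linear[OF cinner.bounded_linear_right onb_fourier[of y], of x]
  by (simp add: cinner_scaleC_right mult.commute)

lemma parseval_norm: "((\<lambda>e. (cmod (cinner e x))\<^sup>2) has_sum (norm x)\<^sup>2) E"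
  using has_sum_bounded_linear[OF bounded_linear_Re parseval[of x x]]
  by (simp add: cinner_self_mult norm_minus_commute cinner_self)
    (metis (no_types, lifting) cnj_cinner complex_mod_cnj has_sum_cong)

end


section \<open>Trace class operators\<close>

text \<open>Finite Bessel families, unlike orthonormal ones, are preserved by contractions.  They are
  indexed by vectors, so that a finite part of a basis can index itself and its images.\<close>

definition bessel :: "'a::complex_inner set \<Rightarrow> ('a \<Rightarrow> 'a) \<Rightarrow> bool" where
  "bessel F x \<longleftrightarrow> finite F \<and> (\<forall>z. (\<Sum>i\<in>F. (cmod (cinner (x i) z))\<^sup>2) \<le> (norm z)\<^sup>2)"

text \<open>For bounded operators this will say that \<open>T\<close> is trace class with trace norm at most \<open>c\<close>.  As a
  supremum of moduli of linear functionals that are continuous in the operator norm, the bound is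
  visibly subadditive and stable under limits.\<close>

definition tc_bound :: "'a::complex_inner op \<Rightarrow> real \<Rightarrow> bool" where
  "tc_bound T c \<longleftrightarrow> (\<forall>F x y. bessel F x \<longrightarrow> bessel F y \<longrightarrow>
     cmod (\<Sum>i\<in>F. cinner (y i) (blinfun_apply T (x i))) \<le> c)"

lemma tc_boundI:
  "(\<And>F x y. bessel F x \<Longrightarrow> bessel F y \<Longrightarrow> cmod (\<Sum>i\<in>F. cinner (y i) (blinfun_apply T (x i))) \<le> c)
    \<Longrightarrow> tc_bound T c"
  by (auto simp: tc_bound_def)

lemma tc_boundD:
  "tc_bound T c \<Longrightarrow> bessel F x \<Longrightarrow> bessel F y \<Longrightarrow>
    cmod (\<Sum>i\<in>F. cinner (y i) (blinfun_apply T (x i))) \<le> c"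
  unfolding tc_bound_def by blast

lemma bessel_onb: "is_onb E \<Longrightarrow> finite F \<Longrightarrow> F \<subseteq> E \<Longrightarrow> bessel F (\<lambda>e. e)"
  unfolding bessel_def by (intro conjI allI) (simp, subst onb_pythagoras, assumption+, simp)

lemma bessel_single: "norm x \<le> 1 \<Longrightarrow> bessel {i} (\<lambda>_. x)"
  unfolding bessel_def
  by (auto intro!: power_mono order_trans[OF cmod_cinner_le] mult_left_le_one_le)

lemma bessel_image:
  assumes "bessel F x" "C \<in> bounded_ops" "norm C \<le> k" "k > 0"
  shows "bessel F (\<lambda>i. (1/k) *\<^sub>R blinfun_apply C (x i))"
  unfolding bessel_def
proof (intro conjI allI)
  show "finite F" using assms(1) by (simp add: bessel_def)
  fix z
  have "(\<Sum>i\<in>F. (cmod (cinner ((1/k) *\<^sub>R C (x i)) z))\<^sup>2)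
      = (1/k)\<^sup>2 * (\<Sum>i\<in>F. (cmod (cinner (x i) (adj_op C z)))\<^sup>2)"
    using assms(4) by (simp add: cinner_scaleR_left cinner_adj_right assms(2) sum_distrib_left
        power_mult_distrib power_divide sum_divide_distrib)
  also have "\<dots> \<le> (1/k)\<^sup>2 * (norm (adj_op C z))\<^sup>2"
    using assms(1) by (intro mult_left_mono) (auto simp: bessel_def)
  also have "\<dots> \<le> (1/k)\<^sup>2 * (k * norm z)\<^sup>2"
  proof -
    have "norm (adj_op C z) \<le> norm (adj_op C) * norm z" by (rule norm_blinfun)
    also have "\<dots> \<le> k * norm z"
      using norm_adj_le[OF assms(2)] assms(3) by (intro mult_right_mono) auto
    finally show ?thesis by (intro mult_left_mono power_mono) auto
  qed
  also have "\<dots> = (norm z)\<^sup>2" using assms(4) by (simp add: power_mult_distrib power_divide)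
  finally show "(\<Sum>i\<in>F. (cmod (cinner ((1/k) *\<^sub>R C (x i)) z))\<^sup>2) \<le> (norm z)\<^sup>2" .
qed

lemma tc_bound_nonneg: "tc_bound T c \<Longrightarrow> 0 \<le> c"
  using tc_boundD[of T c "{}" "\<lambda>_. 0" "\<lambda>_. 0"] by (simp add: bessel_def)

lemma tc_bound_add:
  assumes "tc_bound T c" "tc_bound S d" shows "tc_bound (T + S) (c + d)"
proof (rule tc_boundI)
  fix F and x y :: "'a \<Rightarrow> 'a" assume B: "bessel F x" "bessel F y"
  have "(\<Sum>i\<in>F. cinner (y i) ((T + S) (x i))) =
    (\<Sum>i\<in>F. cinner (y i) (T (x i))) + (\<Sum>i\<in>F. cinner (y i) (S (x i)))"
    by (simp add: blinfun.add_left cinner_add_right sum.distrib)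
  then show "cmod (\<Sum>i\<in>F. cinner (y i) ((T + S) (x i))) \<le> c + d"
    using norm_triangle_mono[OF tc_boundD[OF assms(1) B] tc_boundD[OF assms(2) B]] by simp
qed

text \<open>\<open>C\<close> and the adjoint of \<open>B\<close>, divided by their norms, are moved to the two Bessel families.\<close>

lemma tc_bound_ideal:
  assumes T: "tc_bound T c" and B: "B \<in> bounded_ops" and C: "C \<in> bounded_ops"
  shows "tc_bound (B o\<^sub>L T o\<^sub>L C) (norm B * c * norm C)"
proof (cases "B = 0 \<or> C = 0")
  case True
  then show ?thesis by (auto simp: tc_bound_def cinner.zero_right blinfun.zero_right)
next
  case False
  then have pos: "norm B > 0" "norm C > 0" by auto
  show ?thesis
  proof (rule tc_boundI)
    fix F and x y :: "'a \<Rightarrow> 'a" assume xy: "bessel F x" "bessel F y"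
    define x' where "x' i = (1 / norm C) *\<^sub>R C (x i)" for i
    define y' where "y' i = (1 / norm B) *\<^sub>R adj_op B (y i)" for i
    have "bessel F x'" unfolding x'_def by (rule bessel_image[OF xy(1) C order_refl pos(2)])
    moreover have "bessel F y'" unfolding y'_def
      by (rule bessel_image[OF xy(2) adj_op_bounded[OF B] norm_adj_le[OF B] pos(1)])
    ultimately have le: "cmod (\<Sum>i\<in>F. cinner (y' i) (T (x' i))) \<le> c" by (rule tc_boundD[OF T])
    have "cinner (y i) ((B o\<^sub>L T o\<^sub>L C) (x i)) = (norm B * norm C) *\<^sub>R cinner (y' i) (T (x' i))" for i
      using pos by (simp add: x'_def y'_def cinner_scaleR_left cinner_scaleR_right blinfun.scaleR_right
          cinner_adj_left B)
    then have "(\<Sum>i\<in>F. cinner (y i) ((B o\<^sub>L T o\<^sub>L C) (x i)))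
        = (norm B * norm C) *\<^sub>R (\<Sum>i\<in>F. cinner (y' i) (T (x' i)))"
      by (simp only: scaleR_sum_right)
    then have "cmod (\<Sum>i\<in>F. cinner (y i) ((B o\<^sub>L T o\<^sub>L C) (x i)))
        = (norm B * norm C) * cmod (\<Sum>i\<in>F. cinner (y' i) (T (x' i)))"
      using pos by simp
    also have "\<dots> \<le> (norm B * norm C) * c" using pos by (intro mult_left_mono le) simp
    finally show "cmod (\<Sum>i\<in>F. cinner (y i) ((B o\<^sub>L T o\<^sub>L C) (x i))) \<le> norm B * c * norm C"
      by (simp add: mult_ac)
  qed
qed

lemma norm_le_tc_bound:
  assumes "tc_bound T c"
  shows "norm T \<le> c"
proof (rule norm_blinfun_bound)
  show c: "0 \<le> c" by (rule tc_bound_nonneg[OF assms])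
  fix x
  show "norm (T x) \<le> c * norm x"
  proof (cases "T x = 0")
    case True
    then show ?thesis using c by simp
  next
    case False
    then have x0: "x \<noteq> 0" using blinfun.zero_right by blast
    have "bessel {0} (\<lambda>_. (1 / norm x) *\<^sub>R x)" "bessel {0} (\<lambda>_. (1 / norm (T x)) *\<^sub>R T x)"
      by (rule bessel_single, simp)+
    from tc_boundD[OF assms this]
    have "cmod (cinner (T x) (T x)) / (norm x * norm (T x)) \<le> c"
      using x0 False by (simp add: cinner_scaleR_left cinner_scaleR_right blinfun.scaleR_right mult.commute)
    then show ?thesis
      using x0 False by (simp add: cinner_self norm_mult power2_eq_square field_simps)
  qed
qed

lemma has_sum_finite_sum:
  fixes f :: "'i \<Rightarrow> 'b \<Rightarrow> 'c::{topological_comm_monoid_add}"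
  assumes "\<And>i. i \<in> F \<Longrightarrow> (f i has_sum s i) A"
  shows "((\<lambda>x. \<Sum>i\<in>F. f i x) has_sum (\<Sum>i\<in>F. s i)) A"
  using assms by (induction F rule: infinite_finite_induct) (auto intro!: has_sum_add)

text \<open>Expanding \<open>Q x\<^sub>i\<close> in the basis and summing over \<open>i\<close> first bounds the Hilbert-Schmidt sum over a Bessel
  family by the one over a basis.\<close>

lemma sum_bessel_le:
  assumes E: "is_onb E" and Q: "hermitian Q"
    and s: "((\<lambda>e. (norm (blinfun_apply Q e))\<^sup>2) has_sum s) E" and x: "bessel F x"
  shows "(\<Sum>i\<in>F. (norm (Q (x i)))\<^sup>2) \<le> s"
proof (rule has_sum_mono[OF _ s])
  show "((\<lambda>e. \<Sum>i\<in>F. (cmod (cinner e (Q (x i))))\<^sup>2) has_sum (\<Sum>i\<in>F. (norm (Q (x i)))\<^sup>2)) E"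
    by (intro has_sum_finite_sum parseval_norm E)
  fix e
  have "cmod (cinner e (Q (x i))) = cmod (cinner (x i) (Q e))" for i
    by (metis Q hermitianD cinner_commute complex_mod_cnj)
  then show "(\<Sum>i\<in>F. (cmod (cinner e (Q (x i))))\<^sup>2) \<le> (norm (Q e))\<^sup>2"
    using x by (simp add: bessel_def)
qed

text \<open>Exchanging the order of summation in the double series of matrix entries: this one
  computation yields that the trace is independent of the basis and that it is cyclic.\<close>

lemma hilbert_schmidt_swap:
  assumes E: "is_onb E" and E': "is_onb E'" and R: "R \<in> bounded_ops" and Q: "Q \<in> bounded_ops"
    and sR: "(\<lambda>e. (norm (blinfun_apply R e))\<^sup>2) summable_on E"
    and sQ: "(\<lambda>e. (norm (blinfun_apply Q e))\<^sup>2) summable_on E"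
  obtains a where "((\<lambda>e. cinner (Q e) (R e)) has_sum a) E"
    "((\<lambda>e. cinner (adj_op R e) (adj_op Q e)) has_sum a) E'"
proof -
  define f where "f = (\<lambda>(e, e'). cinner (Q e) e' * cinner e' (R e))"
  have hs: "(\<lambda>(e, e'). (cmod (cinner e' (V e)))\<^sup>2) summable_on E \<times> E'"
    if "(\<lambda>e. (norm (V e))\<^sup>2) summable_on E" for V :: "'a op"
  proof -
    have ps: "((\<lambda>e'. (cmod (cinner e' (V e)))\<^sup>2) has_sum (norm (V e))\<^sup>2) E'" for e
      by (rule parseval_norm[OF E'])
    have "(\<lambda>p. norm (case p of (e, e') \<Rightarrow> (cmod (cinner e' (V e)))\<^sup>2)) summable_on E \<times> E'"
      unfolding Infinite_Sum.abs_summable_on_Sigma_iff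
      using that by (auto simp: infsumI[OF ps] intro: has_sum_imp_summable[OF ps])
    then show ?thesis by (auto simp: case_prod_unfold)
  qed
  have "(\<lambda>p. norm (f p)) summable_on E \<times> E'"
  proof (rule Infinite_Sum.abs_summable_on_comparison_test)
    show "(\<lambda>p. norm ((case p of (e, e') \<Rightarrow> (cmod (cinner e' (Q e)))\<^sup>2) +
        (case p of (e, e') \<Rightarrow> (cmod (cinner e' (R e)))\<^sup>2))) summable_on E \<times> E'"
      using summable_on_add[OF hs[OF sQ] hs[OF sR]] by (auto simp: case_prod_unfold)
    fix p
    have "a * b \<le> a\<^sup>2 + b\<^sup>2" if "a \<ge> 0" "b \<ge> 0" for a b :: real
      using sum_squares_bound[of a b] mult_nonneg_nonneg[OF that] by linarith
    moreover have "cmod (cinner (Q e) e') = cmod (cinner e' (Q e))" for e e'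
      by (metis cinner_commute complex_mod_cnj)
    ultimately show "norm (f p) \<le> norm ((case p of (e, e') \<Rightarrow> (cmod (cinner e' (Q e)))\<^sup>2) +
        (case p of (e, e') \<Rightarrow> (cmod (cinner e' (R e)))\<^sup>2))"
      by (auto simp: f_def norm_mult split: prod.splits)
  qed
  then obtain a where a: "(f has_sum a) (E \<times> E')"
    using abs_summable_summable summable_on_def by blast
  have 1: "((\<lambda>e. cinner (Q e) (R e)) has_sum a) E"
    by (rule has_sum_Sigma[OF isUCont_plus a]) (simp add: f_def parseval[OF E'])
  have a': "((\<lambda>p. f (prod.swap p)) has_sum a) (E' \<times> E)"
  proof -
    have "bij_betw prod.swap (E' \<times> E) (E \<times> E')"
      by (rule bij_betwI[of _ _ _ prod.swap]) auto
    from has_sum_reindex_bij_betw[OF this, of f a] show ?thesis using a by simp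
  qed
  have 2: "((\<lambda>e. cinner (adj_op R e) (adj_op Q e)) has_sum a) E'"
  proof (rule has_sum_Sigma[OF isUCont_plus a'])
    fix e'
    have "((\<lambda>e. cinner (adj_op R e') e * cinner e (adj_op Q e')) has_sum cinner (adj_op R e') (adj_op Q e')) E"
      by (rule parseval[OF E])
    then show "((\<lambda>e. f (prod.swap (e', e))) has_sum cinner (adj_op R e') (adj_op Q e')) E"
      by (simp add: f_def cinner_adj_left[OF R] cinner_adj_right[OF Q] mult.commute)
  qed
  from 1 2 show thesis by (rule that)
qed

lemma cinner_sqrt:
  assumes "positive_op P"
  shows "cinner x (P x) = complex_of_real ((norm (sqrt_op P x))\<^sup>2)"
proof -
  have "cinner x (P x) = cinner x ((sqrt_op P o\<^sub>L sqrt_op P) x)" by (simp add: sqrt_square assms)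
  also have "\<dots> = cinner (sqrt_op P x) (sqrt_op P x)" by (simp add: hermitianD hermitian_sqrt assms)
  finally show ?thesis by (simp add: cinner_self)
qed

definition std_basis :: "'a::chilbert_space set" where
  "std_basis = (SOME E. is_onb E)"

lemma is_onb_std_basis: "is_onb std_basis"
  unfolding std_basis_def using is_onb_exists by (rule someI_ex)

lemma trace_op_eq: "trace_op T = (\<Sum>\<^sub>\<infinity>e\<in>std_basis. cinner e (blinfun_apply T e))"
  by (simp add: trace_op_def std_basis_def)

lemma trace_class_bounded: "T \<in> trace_class \<Longrightarrow> T \<in> bounded_ops"
  by (simp add: trace_class_def)

text \<open>For the root \<open>Q\<close> of \<open>|T|\<close> the exchange of summation compares the sums of \<open>\<parallel>Q e\<parallel>\<^sup>2\<close> over any two bases: the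
  basis that makes \<open>T\<close> trace class, the one in the definition of the trace, and the given one.\<close>

lemma trace_norm_has_sum:
  assumes T: "T \<in> trace_class" and E': "is_onb E'"
  shows "((\<lambda>e. (norm (sqrt_op (abs_op T) e))\<^sup>2) has_sum trace_norm T) E'"
proof -
  let ?Q = "sqrt_op (abs_op T)"
  obtain E where E: "is_onb E" and s: "(\<lambda>e. cinner e (abs_op T e)) summable_on E"
    and Tb: "T \<in> bounded_ops" using T by (auto simp: trace_class_def)
  have pos: "positive_op (abs_op T)" by (rule positive_abs[OF Tb])
  have sE: "(\<lambda>e. (norm (?Q e))\<^sup>2) summable_on E"
    using summable_on_Re[OF s] by (simp add: cinner_sqrt[OF pos])
  have Qb: "?Q \<in> bounded_ops" and adj: "adj_op ?Q = ?Q"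
    using hermitian_sqrt[OF pos] by (auto simp: hermitian_def)
  have indep: "\<exists>a. ((\<lambda>e. complex_of_real ((norm (?Q e))\<^sup>2)) has_sum a) E \<and>
      ((\<lambda>e. complex_of_real ((norm (?Q e))\<^sup>2)) has_sum a) E''" if "is_onb E''" for E''
    using hilbert_schmidt_swap[OF E that Qb Qb sE sE] unfolding adj cinner_self by blast
  obtain a where a: "((\<lambda>e. complex_of_real ((norm (?Q e))\<^sup>2)) has_sum a) E"
    "((\<lambda>e. complex_of_real ((norm (?Q e))\<^sup>2)) has_sum a) E'"
    using indep[OF E'] by blast
  obtain b where b: "((\<lambda>e. complex_of_real ((norm (?Q e))\<^sup>2)) has_sum b) E"
    "((\<lambda>e. complex_of_real ((norm (?Q e))\<^sup>2)) has_sum b) std_basis"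
    using indep[OF is_onb_std_basis] by blast
  have "b = a" using a(1) b(1) has_sum_unique by blast
  moreover have "trace_norm T = Re b"
    unfolding trace_norm_def trace_op_eq cinner_sqrt[OF pos] using infsumI[OF b(2)] by simp
  ultimately show ?thesis using has_sum_Re[OF a(2)] by simp
qed

text \<open>With \<open>T = U Q\<^sup>2\<close> the entry \<open>\<langle>y, T x\<rangle>\<close> is \<open>\<langle>Q U\<^sup>* y, Q x\<rangle>\<close>, at most half the sum of the squared norms;
  both sums of squares are at most the trace norm, as \<open>U\<^sup>* y\<close> is again a Bessel family.\<close>

lemma tc_bound_trace_norm:
  assumes T: "T \<in> trace_class"
  shows "tc_bound T (trace_norm T)"
proof (rule tc_boundI)
  fix F and x y :: "'a \<Rightarrow> 'a" assume xy: "bessel F x" "bessel F y"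
  have Tb: "T \<in> bounded_ops" by (rule trace_class_bounded[OF T])
  let ?P = "abs_op T" let ?Q = "sqrt_op ?P"
  have pos: "positive_op ?P" by (rule positive_abs[OF Tb])
  have hQ: "hermitian ?Q" by (rule hermitian_sqrt[OF pos])
  obtain U where U: "U \<in> bounded_ops" "norm U \<le> 1" "T = U o\<^sub>L ?P"
    by (rule polar_decomposition[OF Tb])
  note s = trace_norm_has_sum[OF T is_onb_std_basis]
  define y' where "y' i = adj_op U (y i)" for i
  have y': "bessel F y'"
    using bessel_image[OF xy(2) adj_op_bounded[OF U(1)], of 1] norm_adj_le[OF U(1)] U(2)
    by (simp add: y'_def[abs_def])
  have eq: "cinner (y i) (T (x i)) = cinner (?Q (y' i)) (?Q (x i))" for i
  proof -
    have "cinner (y i) (T (x i)) = cinner (y' i) (?P (x i))"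
      by (subst U(3)) (simp add: y'_def cinner_adj_left U(1))
    also have "\<dots> = cinner (y' i) ((?Q o\<^sub>L ?Q) (x i))" by (simp only: sqrt_square[OF pos])
    finally show ?thesis by (simp add: hermitianD[OF hQ])
  qed
  have "cmod (\<Sum>i\<in>F. cinner (y i) (T (x i))) \<le> (\<Sum>i\<in>F. cmod (cinner (y i) (T (x i))))"
    by (rule norm_sum)
  also have "\<dots> \<le> (\<Sum>i\<in>F. ((norm (?Q (y' i)))\<^sup>2 + (norm (?Q (x i)))\<^sup>2) / 2)"
  proof (rule sum_mono)
    fix i
    have "cmod (cinner (y i) (T (x i))) \<le> norm (?Q (y' i)) * norm (?Q (x i))"
      unfolding eq by (rule cmod_cinner_le)
    then show "cmod (cinner (y i) (T (x i))) \<le> ((norm (?Q (y' i)))\<^sup>2 + (norm (?Q (x i)))\<^sup>2) / 2"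
      using sum_squares_bound[of "norm (?Q (y' i))" "norm (?Q (x i))"] by simp
  qed
  also have "\<dots> = ((\<Sum>i\<in>F. (norm (?Q (y' i)))\<^sup>2) + (\<Sum>i\<in>F. (norm (?Q (x i)))\<^sup>2)) / 2"
    by (simp add: sum.distrib sum_divide_distrib[symmetric])
  also have "\<dots> \<le> (trace_norm T + trace_norm T) / 2"
    by (intro divide_right_mono add_mono sum_bessel_le[OF is_onb_std_basis hQ s] y' xy) simp
  finally show "cmod (\<Sum>i\<in>F. cinner (y i) (T (x i))) \<le> trace_norm T" by simp
qed

text \<open>Since \<open>|T| = U\<^sup>* T\<close>, the diagonal entries of \<open>|T|\<close> are entries of \<open>T\<close> between the Bessel families \<open>e\<close> and
  \<open>U e\<close>.\<close>

lemma tc_bound_imp_trace_class: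
  assumes Tb: "T \<in> bounded_ops" and c: "tc_bound T c"
  shows "T \<in> trace_class" and trace_norm_le: "trace_norm T \<le> c"
proof -
  let ?P = "abs_op T"
  have pos: "positive_op ?P" by (rule positive_abs[OF Tb])
  obtain U where U: "U \<in> bounded_ops" "norm U \<le> 1" "?P = adj_op U o\<^sub>L T"
    by (rule polar_decomposition[OF Tb])
  have "(\<Sum>e\<in>F. (norm (sqrt_op ?P e))\<^sup>2) \<le> c" if F: "finite F" "F \<subseteq> std_basis" for F
  proof -
    have b: "bessel F (\<lambda>e. e)" by (rule bessel_onb[OF is_onb_std_basis F])
    have "bessel F (\<lambda>e. U e)" using bessel_image[OF b U(1), of 1] U(2) by simp
    from tc_boundD[OF c b this] have "cmod (\<Sum>e\<in>F. cinner (U e) (T e)) \<le> c" .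
    moreover have "cinner (U e) (T e) = complex_of_real ((norm (sqrt_op ?P e))\<^sup>2)" for e
      unfolding cinner_sqrt[OF pos, symmetric] by (subst U(3)) (simp add: cinner_adj_right U(1))
    ultimately have "cmod (complex_of_real (\<Sum>e\<in>F. (norm (sqrt_op ?P e))\<^sup>2)) \<le> c" by simp
    then show ?thesis by (simp only: norm_of_real)
  qed
  note le = this
  have s: "(\<lambda>e. (norm (sqrt_op ?P e))\<^sup>2) summable_on std_basis"
    by (rule nonneg_bdd_above_summable_on) (auto intro!: bdd_aboveI[of _ c] le)
  then have "(\<lambda>e. cinner e (?P e)) summable_on std_basis"
    unfolding cinner_sqrt[OF pos] by (rule summable_on_of_real)
  then show T: "T \<in> trace_class" using Tb is_onb_std_basis by (auto simp: trace_class_def)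
  show "trace_norm T \<le> c"
    by (rule has_sum_le_finite_sums[OF trace_norm_has_sum[OF T is_onb_std_basis] le])
qed

lemma trace_norm_nonneg: "T \<in> trace_class \<Longrightarrow> 0 \<le> trace_norm T"
  by (meson tc_bound_nonneg tc_bound_trace_norm)

lemma norm_le_trace_norm: "T \<in> trace_class \<Longrightarrow> norm T \<le> trace_norm T"
  by (meson norm_le_tc_bound tc_bound_trace_norm)

lemma
  assumes "T \<in> trace_class" "S \<in> trace_class"
  shows trace_class_add [simp]: "T + S \<in> trace_class"
    and trace_norm_triangle: "trace_norm (T + S) \<le> trace_norm T + trace_norm S"
proof -
  note tc = tc_bound_add[OF assms[THEN tc_bound_trace_norm]]
  have b: "T + S \<in> bounded_ops" using assms by (simp add: trace_class_bounded)
  show "T + S \<in> trace_class" "trace_norm (T + S) \<le> trace_norm T + trace_norm S"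
    using tc_bound_imp_trace_class[OF b tc] by auto
qed

lemma
  assumes "T \<in> trace_class" "B \<in> bounded_ops" "C \<in> bounded_ops"
  shows trace_class_ideal: "B o\<^sub>L T o\<^sub>L C \<in> trace_class"
    and trace_norm_ideal: "trace_norm (B o\<^sub>L T o\<^sub>L C) \<le> norm B * trace_norm T * norm C"
proof -
  have b: "B o\<^sub>L T o\<^sub>L C \<in> bounded_ops" using assms by (simp add: trace_class_bounded)
  note tc = tc_bound_ideal[OF tc_bound_trace_norm[OF assms(1)] assms(2,3)]
  show "B o\<^sub>L T o\<^sub>L C \<in> trace_class" "trace_norm (B o\<^sub>L T o\<^sub>L C) \<le> norm B * trace_norm T * norm C"
    using tc_bound_imp_trace_class[OF b tc] by auto
qed

lemma norm_id_le: "norm (id_blinfun :: 'a::real_normed_vector op) \<le> 1"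
  by (rule norm_blinfun_bound) auto

lemma trace_class_compose_left [simp]: "T \<in> trace_class \<Longrightarrow> B \<in> bounded_ops \<Longrightarrow> B o\<^sub>L T \<in> trace_class"
  using trace_class_ideal[of T B id_blinfun] by simp

lemma trace_class_compose_right [simp]: "T \<in> trace_class \<Longrightarrow> B \<in> bounded_ops \<Longrightarrow> T o\<^sub>L B \<in> trace_class"
  using trace_class_ideal[of T id_blinfun B] by simp

lemma trace_norm_compose_left:
  assumes "T \<in> trace_class" "B \<in> bounded_ops"
  shows "trace_norm (B o\<^sub>L T) \<le> norm B * trace_norm T"
proof -
  have "trace_norm (B o\<^sub>L T) \<le> norm B * trace_norm T * norm (id_blinfun :: 'a op)"
    using trace_norm_ideal[OF assms, of id_blinfun] by simp
  also have "\<dots> \<le> norm B * trace_norm T"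
    by (intro mult_right_le_one_le norm_id_le) (simp_all add: trace_norm_nonneg assms)
  finally show ?thesis .
qed

lemma trace_norm_compose_right:
  assumes "T \<in> trace_class" "B \<in> bounded_ops"
  shows "trace_norm (T o\<^sub>L B) \<le> trace_norm T * norm B"
proof -
  have "trace_norm (T o\<^sub>L B) \<le> norm (id_blinfun :: 'a op) * (trace_norm T * norm B)"
    using trace_norm_ideal[OF assms(1) bounded_ops_id assms(2)] by (simp add: mult.assoc)
  also have "\<dots> \<le> trace_norm T * norm B"
    by (intro mult_left_le_one_le norm_id_le) (simp_all add: trace_norm_nonneg assms)
  finally show ?thesis .
qed

lemma scaleC_op_compose: "c *\<^sub>C T = (c *\<^sub>C id_blinfun) o\<^sub>L (T :: 'a::chilbert_space op)"
  by (rule blinfun_eqI) simp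

lemma trace_class_scaleC [simp]: "T \<in> trace_class \<Longrightarrow> c *\<^sub>C T \<in> trace_class"
  by (subst scaleC_op_compose) simp

lemma trace_norm_scaleC_le:
  assumes "T \<in> trace_class" shows "trace_norm (c *\<^sub>C T) \<le> cmod c * trace_norm T"
proof -
  have "norm (c *\<^sub>C id_blinfun :: 'a op) \<le> cmod c"
    by (rule norm_blinfun_bound) (simp_all add: norm_scaleC)
  then show ?thesis
    using trace_norm_compose_left[OF assms, of "c *\<^sub>C id_blinfun"] scaleC_op_compose[of c T]
    by (metis (no_types, lifting) assms bounded_ops_id bounded_ops_scaleC_op mult_right_mono order_trans
        trace_norm_nonneg)
qed

lemma trace_class_scaleR [simp]: "T \<in> trace_class \<Longrightarrow> r *\<^sub>R T \<in> trace_class"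
  by (metis scaleC_of_real trace_class_scaleC)

lemma trace_norm_scaleR:
  assumes "T \<in> trace_class" shows "trace_norm (r *\<^sub>R T) = \<bar>r\<bar> * trace_norm T"
proof -
  have le: "trace_norm (s *\<^sub>R S) \<le> \<bar>s\<bar> * trace_norm S" if "S \<in> trace_class" for s and S :: "'a op"
    using trace_norm_scaleC_le[OF that, of "complex_of_real s"] by (simp add: scaleC_of_real)
  show ?thesis
  proof (cases "r = 0")
    case True
    then show ?thesis using le[OF assms, of 0] trace_norm_nonneg[OF trace_class_scaleR[OF assms, of 0]] by simp
  next
    case False
    have "\<bar>r\<bar> * trace_norm T \<le> \<bar>r\<bar> * (\<bar>1/r\<bar> * trace_norm (r *\<^sub>R T))"
      using le[OF trace_class_scaleR[OF assms, of r], of "1/r"] False by (intro mult_left_mono) simp_all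
    then show ?thesis using le[OF assms, of r] False by (simp add: abs_divide)
  qed
qed

lemma trace_class_uminus [simp]: "T \<in> trace_class \<Longrightarrow> - T \<in> trace_class"
  using trace_class_scaleR[of T "-1"] by simp

lemma trace_class_diff [simp]: "T \<in> trace_class \<Longrightarrow> S \<in> trace_class \<Longrightarrow> T - S \<in> trace_class"
  using trace_class_add[of T "- S"] by simp

lemma trace_class_0 [simp]: "0 \<in> trace_class"
  by (rule tc_bound_imp_trace_class[of _ 0]) (auto simp: tc_bound_def cinner.zero_right)

lemma trace_class_sum [simp]: "(\<And>i. i \<in> F \<Longrightarrow> f i \<in> trace_class) \<Longrightarrow> sum f F \<in> trace_class"
  by (induction F rule: infinite_finite_induct) auto

lemma trace_norm_0 [simp]: "trace_norm 0 = 0"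
  using trace_norm_scaleR[of 0 0] by simp

lemma trace_norm_sum_le:
  "(\<And>i. i \<in> F \<Longrightarrow> f i \<in> trace_class) \<Longrightarrow> trace_norm (sum f F) \<le> (\<Sum>i\<in>F. trace_norm (f i))"
proof (induction F rule: infinite_finite_induct)
  case (insert i F)
  then have "trace_norm (f i + sum f F) \<le> trace_norm (f i) + trace_norm (sum f F)"
    by (intro trace_norm_triangle) auto
  then show ?case using insert by simp
qed auto

lemma trace_norm_eq_0: "T \<in> trace_class \<Longrightarrow> trace_norm T = 0 \<Longrightarrow> T = 0"
  using norm_le_trace_norm by fastforce


section \<open>The trace\<close>

text \<open>With \<open>T = U Q\<^sup>2\<close> both diagonal sums equal the sum of \<open>\<langle>Q e, S U Q e\<rangle>\<close> over one fixed basis.  This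
  gives at once the existence, the basis independence and the cyclicity of the trace.\<close>

lemma trace_factor:
  assumes T: "T \<in> trace_class" and S: "S \<in> bounded_ops"
  obtains a where
    "\<And>E. is_onb E \<Longrightarrow> ((\<lambda>e. cinner e ((T o\<^sub>L S) e)) has_sum a) E"
    "\<And>E. is_onb E \<Longrightarrow> ((\<lambda>e. cinner e ((S o\<^sub>L T) e)) has_sum a) E"
proof -
  let ?E = "std_basis :: 'a set" and ?P = "abs_op T" and ?Q = "sqrt_op (abs_op T)"
  have Tb: "T \<in> bounded_ops" by (rule trace_class_bounded[OF T])
  have pos: "positive_op ?P" by (rule positive_abs[OF Tb])
  have hQ: "hermitian ?Q" by (rule hermitian_sqrt[OF pos])
  have Qb [simp]: "?Q \<in> bounded_ops" and Qadj: "adj_op ?Q = ?Q" using hQ by (auto simp: hermitian_def)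
  obtain U where U: "U \<in> bounded_ops" "norm U \<le> 1" "T = U o\<^sub>L ?P"
    by (rule polar_decomposition[OF Tb])
  have TUQ: "T x = U (?Q (?Q x))" for x
    by (subst U(3)) (simp flip: blinfun_apply_blinfun_compose add: sqrt_square[OF pos] op_assoc)
  have sQ: "(\<lambda>e. (norm (?Q e))\<^sup>2) summable_on ?E"
    by (rule has_sum_imp_summable[OF trace_norm_has_sum[OF T is_onb_std_basis]])
  have sV: "(\<lambda>e. (norm ((V o\<^sub>L ?Q) e))\<^sup>2) summable_on ?E" for V :: "'a op"
  proof (rule summable_on_comparison_test)
    show "(\<lambda>e. (norm V)\<^sup>2 * (norm (?Q e))\<^sup>2) summable_on ?E"
      by (rule summable_on_cmult_right[OF sQ])
    show "(norm ((V o\<^sub>L ?Q) e))\<^sup>2 \<le> (norm V)\<^sup>2 * (norm (?Q e))\<^sup>2" for e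
      using norm_sq_apply_le[of V "?Q e"] by simp
  qed simp
  define a where "a = (\<Sum>\<^sub>\<infinity>e\<in>?E. cinner (?Q e) (S (U (?Q e))))"
  show thesis
  proof (rule that[of a])
    fix E :: "'a set" assume E: "is_onb E"
    have b1: "U o\<^sub>L ?Q \<in> bounded_ops" "adj_op S o\<^sub>L ?Q \<in> bounded_ops"
      using U(1) S by (simp_all add: adj_op_bounded)
    obtain b where b: "((\<lambda>e. cinner ((adj_op S o\<^sub>L ?Q) e) ((U o\<^sub>L ?Q) e)) has_sum b) ?E"
      "((\<lambda>e. cinner (adj_op (U o\<^sub>L ?Q) e) (adj_op (adj_op S o\<^sub>L ?Q) e)) has_sum b) E"
      by (rule hilbert_schmidt_swap[OF is_onb_std_basis E b1 sV sV])
    have "b = a" using infsumI[OF b(1)] by (simp add: a_def cinner_adj_left S)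
    moreover have "cinner (adj_op (U o\<^sub>L ?Q) e) (adj_op (adj_op S o\<^sub>L ?Q) e) = cinner e ((T o\<^sub>L S) e)" for e
      using U(1) S by (simp add: adj_compose adj_op_bounded Qadj hermitianD[OF hQ] cinner_adj_left TUQ)
    ultimately show "((\<lambda>e. cinner e ((T o\<^sub>L S) e)) has_sum a) E" using b(2) by simp
    have b2: "(S o\<^sub>L U) o\<^sub>L ?Q \<in> bounded_ops" using U(1) S by simp
    obtain c where c: "((\<lambda>e. cinner (?Q e) (((S o\<^sub>L U) o\<^sub>L ?Q) e)) has_sum c) ?E"
      "((\<lambda>e. cinner (adj_op ((S o\<^sub>L U) o\<^sub>L ?Q) e) (adj_op ?Q e)) has_sum c) E"
      by (rule hilbert_schmidt_swap[OF is_onb_std_basis E b2 Qb sV sQ])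
    have "c = a" using infsumI[OF c(1)] by (simp add: a_def)
    moreover have "cinner (adj_op ((S o\<^sub>L U) o\<^sub>L ?Q) e) (adj_op ?Q e) = cinner e ((S o\<^sub>L T) e)" for e
      using U(1) S by (simp add: cinner_adj_left b2 Qadj TUQ)
    ultimately show "((\<lambda>e. cinner e ((S o\<^sub>L T) e)) has_sum a) E" using c(2) by simp
  qed
qed

lemma trace_op_commute:
  assumes "T \<in> trace_class" "S \<in> bounded_ops"
  shows "trace_op (T o\<^sub>L S) = trace_op (S o\<^sub>L T)"
proof -
  obtain a where a: "\<And>E. is_onb E \<Longrightarrow> ((\<lambda>e. cinner e ((T o\<^sub>L S) e)) has_sum a) E"
    "\<And>E. is_onb E \<Longrightarrow> ((\<lambda>e. cinner e ((S o\<^sub>L T) e)) has_sum a) E"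
    using trace_factor[OF assms] by blast
  show ?thesis unfolding trace_op_eq
    using infsumI[OF a(1)[OF is_onb_std_basis]] infsumI[OF a(2)[OF is_onb_std_basis]] by simp
qed

lemma trace_op_has_sum:
  assumes "T \<in> trace_class" "is_onb E"
  shows "((\<lambda>e. cinner e (blinfun_apply T e)) has_sum trace_op T) E"
proof -
  obtain a where a: "\<And>E. is_onb E \<Longrightarrow> ((\<lambda>e. cinner e ((T o\<^sub>L id_blinfun) e)) has_sum a) E"
    using trace_factor[OF assms(1) bounded_ops_id] by metis
  have "trace_op T = a" unfolding trace_op_eq using infsumI[OF a[OF is_onb_std_basis]] by simp
  then show ?thesis using a[OF assms(2)] by simp
qed

lemma trace_op_eqI:
  "T \<in> trace_class \<Longrightarrow> ((\<lambda>e. cinner e (blinfun_apply T e)) has_sum a) std_basis \<Longrightarrow> trace_op T = a"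
  unfolding trace_op_eq by (rule infsumI)

lemma trace_op_add:
  assumes "T \<in> trace_class" "S \<in> trace_class"
  shows "trace_op (T + S) = trace_op T + trace_op S"
proof (rule trace_op_eqI)
  show "((\<lambda>e. cinner e ((T + S) e)) has_sum (trace_op T + trace_op S)) std_basis"
    unfolding blinfun.add_left cinner_add_right
    by (intro has_sum_add trace_op_has_sum assms is_onb_std_basis)
qed (use assms in simp)

lemma trace_op_scaleC:
  assumes "T \<in> trace_class"
  shows "trace_op (c *\<^sub>C T) = c * trace_op T"
proof (rule trace_op_eqI)
  show "((\<lambda>e. cinner e ((c *\<^sub>C T) e)) has_sum (c * trace_op T)) std_basis"
    unfolding blinfun_apply_scaleC cinner_scaleC_right
    by (intro has_sum_cmult_right trace_op_has_sum assms is_onb_std_basis)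
qed (use assms in simp)

lemma trace_op_scaleR: "T \<in> trace_class \<Longrightarrow> trace_op (r *\<^sub>R T) = r *\<^sub>R trace_op T"
  by (metis scaleC_of_real scaleR_conv_of_real trace_op_scaleC)

lemma trace_op_diff:
  assumes "T \<in> trace_class" "S \<in> trace_class"
  shows "trace_op (T - S) = trace_op T - trace_op S"
  using trace_op_add[of "T - S" S] assms by simp

lemma trace_op_0 [simp]: "trace_op 0 = 0"
  using trace_op_scaleR[of 0 0] by simp

lemma trace_op_sum:
  "(\<And>i. i \<in> F \<Longrightarrow> f i \<in> trace_class) \<Longrightarrow> trace_op (sum f F) = (\<Sum>i\<in>F. trace_op (f i))"
  by (induction F rule: infinite_finite_induct) (auto simp: trace_op_add)

lemma cmod_trace_op_le:
  assumes "T \<in> trace_class"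
  shows "cmod (trace_op T) \<le> trace_norm T"
proof (rule tendsto_upperbound)
  show "((\<lambda>F. cmod (\<Sum>e\<in>F. cinner e (T e))) \<longlongrightarrow> cmod (trace_op T)) (finite_subsets_at_top std_basis)"
    using trace_op_has_sum[OF assms is_onb_std_basis] unfolding has_sum_def by (rule tendsto_norm)
  show "\<forall>\<^sub>F F in finite_subsets_at_top std_basis. cmod (\<Sum>e\<in>F. cinner e (T e)) \<le> trace_norm T"
    by (rule eventually_finite_subsets_at_top_weakI)
      (intro tc_boundD[OF tc_bound_trace_norm[OF assms]] bessel_onb[OF is_onb_std_basis])
qed simp

lemma trace_positive:
  assumes "positive_op P" "P \<in> trace_class"
  shows "trace_op P = complex_of_real (trace_norm P)"
proof -
  have "trace_op P = complex_of_real (Re (trace_op P))"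
  proof -
    have "((\<lambda>e. complex_of_real (Re (cinner e (P e)))) has_sum complex_of_real (Re (trace_op P))) std_basis"
      by (intro has_sum_of_real has_sum_Re trace_op_has_sum assms is_onb_std_basis)
    then show ?thesis
      using trace_op_has_sum[OF assms(2) is_onb_std_basis] has_sum_unique
      by (simp add: Re_cinner hermitian_quadratic_real[OF positive_hermitian[OF assms(1)]]) blast
  qed
  then show ?thesis by (simp add: trace_norm_def abs_op_positive assms(1))
qed

lemma cmod_trace_compose_le:
  assumes "T \<in> trace_class" "S \<in> bounded_ops"
  shows "cmod (trace_op (T o\<^sub>L S)) \<le> trace_norm T * norm S"
  by (rule order_trans[OF cmod_trace_op_le trace_norm_compose_right]) (simp_all add: assms)

lemma trace_op_conj:
  assumes "T \<in> trace_class" "S \<in> bounded_ops" "B \<in> bounded_ops"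
  shows "trace_op (conj_by B T o\<^sub>L S) = trace_op (T o\<^sub>L conj_by B S)"
proof -
  have "trace_op (conj_by B T o\<^sub>L S) = trace_op (B o\<^sub>L (T o\<^sub>L (B o\<^sub>L S)))"
    by (simp add: conj_by_def op_assoc)
  also have "\<dots> = trace_op ((T o\<^sub>L (B o\<^sub>L S)) o\<^sub>L B)"
    using assms by (intro trace_op_commute[symmetric]) simp_all
  finally show ?thesis by (simp add: conj_by_def op_assoc)
qed

text \<open>By cyclicity the trace of \<open>P S\<close> is that of the positive operator obtained by conjugating \<open>P\<close> with the
  root of \<open>S\<close>.\<close>

lemma trace_positive_product:
  assumes "positive_op P" "P \<in> trace_class" "positive_op S"
  shows "trace_op (P o\<^sub>L S) \<in> \<real>\<^sub>\<ge>\<^sub>0"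
proof -
  let ?Q = "sqrt_op S"
  have Qb: "?Q \<in> bounded_ops" using hermitian_sqrt[OF assms(3)] by (rule hermitian_bounded)
  have "trace_op (P o\<^sub>L S) = trace_op (P o\<^sub>L conj_by ?Q id_blinfun)"
    by (simp add: conj_by_def sqrt_square assms(3))
  also have "\<dots> = trace_op (conj_by ?Q P)"
    using trace_op_conj[OF assms(2) bounded_ops_id Qb] by simp
  also have "\<dots> = complex_of_real (trace_norm (conj_by ?Q P))"
    unfolding conj_by_def using assms Qb
    by (intro trace_positive positive_sandwich hermitian_sqrt) simp_all
  also have "\<dots> \<in> \<real>\<^sub>\<ge>\<^sub>0"
    using assms Qb by (simp add: conj_by_def trace_norm_nonneg)
  finally show ?thesis .
qed


section \<open>Rank one operators and approximation\<close>

definition rank_one :: "'a::chilbert_space \<Rightarrow> 'a \<Rightarrow> 'a op" where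
  "rank_one x y = Blinfun (\<lambda>z. cinner y z *\<^sub>C x)"

lemma rank_one_apply [simp]: "blinfun_apply (rank_one x y) z = cinner y z *\<^sub>C x"
proof -
  have "bounded_linear (\<lambda>z. cinner y z *\<^sub>C x)"
  proof (rule bounded_linear_intro)
    show "norm (cinner y z *\<^sub>C x) \<le> norm z * (norm y * norm x)" for z
      using mult_right_mono[OF cmod_cinner_le[of y z], of "norm x"] by (simp add: norm_scaleC mult_ac)
    show "cinner y (r *\<^sub>R z) *\<^sub>C x = r *\<^sub>R (cinner y z *\<^sub>C x)" for r z
      by (metis cinner_scaleR_right scaleC_of_real scaleC_scaleC scaleR_conv_of_real)
  qed (simp add: cinner_add_right scaleC_add_left)
  then show ?thesis by (simp add: rank_one_def bounded_linear_Blinfun_apply)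
qed

lemma rank_one_bounded [simp]: "rank_one x y \<in> bounded_ops"
  by (simp add: bounded_ops_def cinner_scaleC_right scaleC_scaleC)

lemma
  shows trace_class_rank_one [simp]: "rank_one x y \<in> trace_class"
    and trace_norm_rank_one: "trace_norm (rank_one x y) \<le> norm x * norm y"
proof -
  have tc: "tc_bound (rank_one x y) (norm x * norm y)"
  proof (rule tc_boundI)
    fix F and u v :: "'a \<Rightarrow> 'a" assume uv: "bessel F u" "bessel F v"
    have L2: "L2_set (\<lambda>i. cmod (cinner (w i) z)) F \<le> norm z" if "bessel F w" for w and z :: 'a
      using that by (auto simp: L2_set_def bessel_def intro!: real_le_lsqrt sum_nonneg)
    have sym: "cmod (cinner y (u i)) = cmod (cinner (u i) y)" for i
      by (metis cinner_commute complex_mod_cnj)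
    have "cmod (\<Sum>i\<in>F. cinner (v i) (rank_one x y (u i)))
        \<le> (\<Sum>i\<in>F. cmod (cinner (v i) (rank_one x y (u i))))" by (rule norm_sum)
    also have "\<dots> = (\<Sum>i\<in>F. \<bar>cmod (cinner (v i) x)\<bar> * \<bar>cmod (cinner (u i) y)\<bar>)"
      by (simp add: cinner_scaleC_right norm_mult sym mult.commute)
    also have "\<dots> \<le> L2_set (\<lambda>i. cmod (cinner (v i) x)) F * L2_set (\<lambda>i. cmod (cinner (u i) y)) F"
      by (rule L2_set_mult_ineq)
    also have "\<dots> \<le> norm x * norm y" by (intro mult_mono L2 uv) (auto simp: L2_set_nonneg)
    finally show "cmod (\<Sum>i\<in>F. cinner (v i) (rank_one x y (u i))) \<le> norm x * norm y" .
  qed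
  show "rank_one x y \<in> trace_class" "trace_norm (rank_one x y) \<le> norm x * norm y"
    using tc_bound_imp_trace_class[OF rank_one_bounded tc] by auto
qed

lemma trace_rank_one: "trace_op (rank_one x y) = cinner y x"
proof (rule trace_op_eqI)
  show "((\<lambda>e. cinner e (rank_one x y e)) has_sum cinner y x) std_basis"
    using parseval[OF is_onb_std_basis, of y x] by (simp add: cinner_scaleC_right)
qed simp

lemma trace_rank_one_compose:
  assumes "S \<in> bounded_ops"
  shows "trace_op (rank_one x y o\<^sub>L S) = cinner y (S x)"
proof -
  have "S o\<^sub>L rank_one x y = rank_one (S x) y"
    by (rule blinfun_eqI) (simp add: bounded_ops_scaleC assms)
  then show ?thesis by (simp add: trace_op_commute assms trace_rank_one)
qed

lemma positive_rank_one: "positive_op (rank_one x x)"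
  by (simp add: positive_op_def cinner_scaleC_right cinner_self_mult)

lemma trace_separates_bounded:
  assumes "R \<in> bounded_ops" "S \<in> bounded_ops"
    and "\<And>T. T \<in> trace_class \<Longrightarrow> trace_op (T o\<^sub>L R) = trace_op (T o\<^sub>L S)"
  shows "R = S"
  using assms(3)[OF trace_class_rank_one] by (intro op_eqI) (simp add: trace_rank_one_compose assms(1,2))

lemma trace_separates_trace_class:
  assumes "R \<in> trace_class" "S \<in> trace_class"
    and "\<And>T. T \<in> bounded_ops \<Longrightarrow> trace_op (R o\<^sub>L T) = trace_op (S o\<^sub>L T)"
  shows "R = S"
proof (rule trace_separates_bounded)
  fix T :: "'a op" assume "T \<in> trace_class"
  then show "trace_op (T o\<^sub>L R) = trace_op (T o\<^sub>L S)"
    using assms(3)[of T] by (simp add: trace_op_commute trace_class_bounded assms(1,2))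
qed (simp_all add: trace_class_bounded assms)

lemma abs_op_trace_class:
  assumes "T \<in> trace_class"
  shows "abs_op T \<in> trace_class" "trace_norm (abs_op T) = trace_norm T"
proof -
  have Tb: "T \<in> bounded_ops" by (rule trace_class_bounded[OF assms])
  obtain U where "U \<in> bounded_ops" "abs_op T = adj_op U o\<^sub>L T" by (rule polar_decomposition[OF Tb])
  then show "abs_op T \<in> trace_class" by (metis adj_op_bounded assms trace_class_compose_left)
  show "trace_norm (abs_op T) = trace_norm T"
    unfolding trace_norm_def by (simp add: abs_op_positive positive_abs Tb)
qed

text \<open>Polarisation: with \<open>W\<^sub>k = (1 + (-i)\<^sup>k U) / 2\<close> the operator \<open>U P\<close> is the sum of the
  \<open>i\<^sup>k W\<^sub>k P W\<^sub>k\<^sup>*\<close> over \<open>k < 4\<close>.\<close>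

lemma positive_decomposition:
  fixes T :: "'a::chilbert_space op"
  assumes T: "T \<in> trace_class"
  obtains P where "\<And>k. positive_op (P k)" "\<And>k. P k \<in> trace_class"
    "\<And>k. trace_norm (P k) \<le> trace_norm T" "T = (\<Sum>k<4::nat. \<i> ^ k *\<^sub>C P k)"
proof -
  have Tb: "T \<in> bounded_ops" by (rule trace_class_bounded[OF T])
  obtain U where U: "U \<in> bounded_ops" "norm U \<le> 1" "T = U o\<^sub>L abs_op T"
    by (rule polar_decomposition[OF Tb])
  define W where "W k = (1/2) *\<^sub>R (id_blinfun + (-\<i>) ^ k *\<^sub>C U)" for k :: nat
  have Wb: "W k \<in> bounded_ops" for k using U(1) by (simp add: W_def)
  have nW: "norm (W k) \<le> 1" for k
  proof -
    have "norm ((-\<i>) ^ k *\<^sub>C U) \<le> 1"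
    proof (rule norm_blinfun_bound)
      fix x
      have "norm (U x) \<le> norm U * norm x" by (rule norm_blinfun)
      also have "\<dots> \<le> 1 * norm x" by (intro mult_right_mono U) simp
      finally show "norm (((-\<i>) ^ k *\<^sub>C U) x) \<le> 1 * norm x" by (simp add: norm_scaleC norm_power)
    qed simp
    then have "norm (id_blinfun + (-\<i>) ^ k *\<^sub>C U) \<le> 1 + 1"
      by (intro norm_triangle_mono norm_id_le)
    then show ?thesis by (simp add: W_def)
  qed
  define P where "P k = W k o\<^sub>L abs_op T o\<^sub>L adj_op (W k)" for k
  have nP: "trace_norm (P k) \<le> trace_norm T" for k
  proof -
    have "trace_norm (P k) \<le> norm (W k) * trace_norm T * norm (adj_op (W k))"
      using trace_norm_ideal[OF abs_op_trace_class(1)[OF T] Wb adj_op_bounded[OF Wb], of k k]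
      by (simp add: P_def abs_op_trace_class(2)[OF T])
    also have "\<dots> \<le> 1 * trace_norm T * 1"
      using nW[of k] order_trans[OF norm_adj_le[OF Wb] nW, of k] trace_norm_nonneg[OF T]
      by (intro mult_mono) auto
    finally show ?thesis by simp
  qed
  have adjW: "adj_op (W k) = (1/2) *\<^sub>R (id_blinfun + \<i> ^ k *\<^sub>C adj_op U)" for k
    using U(1) by (intro adj_op_eqI Wb)
      (simp add: W_def blinfun.add_left blinfun.scaleR_left cinner_scaleR_left cinner_scaleR_right
        cinner_add_left cinner_add_right cinner_scaleC_left cinner_scaleC_right cinner_adj_right)
  have "T = (\<Sum>k<4::nat. \<i> ^ k *\<^sub>C P k)"
  proof (rule blinfun_eqI)
    fix x
    let ?R = "abs_op T"
    have Rb: "?R \<in> bounded_ops" using positive_abs[OF Tb] by (rule positive_bounded)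
    define a b c d where "a = ?R x" and "b = U (?R x)" and "c = ?R (adj_op U x)" and "d = U (?R (adj_op U x))"
    have Wx: "W k v = (1/2) *\<^sub>R (v + (-\<i>) ^ k *\<^sub>C U v)" for k v
      by (simp add: W_def blinfun.scaleR_left blinfun.add_left)
    have adjWx: "adj_op (W k) x = (1/2) *\<^sub>R (x + \<i> ^ k *\<^sub>C adj_op U x)" for k
      by (simp add: adjW blinfun.scaleR_left blinfun.add_left)
    have Pk: "P k x = (1/4) *\<^sub>R (a + (-\<i>) ^ k *\<^sub>C b + \<i> ^ k *\<^sub>C c + ((-\<i>) ^ k * \<i> ^ k) *\<^sub>C d)" for k
      unfolding P_def a_def b_def c_def d_def
      by (simp add: Wx adjWx blinfun.add_right blinfun.scaleR_right
          bounded_ops_scaleC[OF U(1)] bounded_ops_scaleC[OF Rb] scaleC_add_right scaleC_scaleC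
          scaleC_scaleR scaleR_add_right)
    have "(\<Sum>k<4::nat. \<i> ^ k *\<^sub>C P k) x = (\<Sum>k<4::nat. \<i> ^ k *\<^sub>C P k x)"
      by (simp add: blinfun.sum_left)
    also have "\<dots> = b"
      unfolding Pk
      by (simp add: lessThan_nat_numeral lessThan_Suc numeral_eq_Suc scaleC_add_right scaleC_scaleC
          scaleC_scaleR scaleC_add_left[symmetric] scaleR_add_right)
        (simp flip: scaleR_add_left)
    also have "\<dots> = T x" by (subst U(3)) (simp add: b_def)
    finally show "T x = (\<Sum>k<4::nat. \<i> ^ k *\<^sub>C P k) x" ..
  qed
  moreover have "positive_op (P k)" for k
    unfolding P_def by (intro positive_conj Wb positive_abs Tb)
  moreover have "P k \<in> trace_class" for k
    unfolding P_def by (intro trace_class_ideal Wb adj_op_bounded abs_op_trace_class T)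
  ultimately show thesis using that nP by blast
qed

text \<open>For a finite part \<open>F\<close> of a basis and the root \<open>Q\<close> of \<open>|T|\<close>, the rank one operators of the pairs
  \<open>(Q e, Q e)\<close> with \<open>e \<in> F\<close> sum up to an operator below \<open>|T|\<close>.  The difference is positive, so its trace norm
  is its trace, a tail of the series for the trace norm of \<open>T\<close>.\<close>

lemma finite_rank_approximation:
  fixes T :: "'a::chilbert_space op"
  assumes T: "T \<in> trace_class" and d: "d > 0"
  obtains F and x y :: "'a \<Rightarrow> 'a" where "finite F" "trace_norm (T - (\<Sum>i\<in>F. rank_one (x i) (y i))) < d"
proof -
  let ?E = "std_basis :: 'a set" and ?P = "abs_op T" and ?Q = "sqrt_op (abs_op T)"
  have Tb: "T \<in> bounded_ops" by (rule trace_class_bounded[OF T])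
  have pos: "positive_op ?P" by (rule positive_abs[OF Tb])
  have hQ: "hermitian ?Q" by (rule hermitian_sqrt[OF pos])
  obtain U where U: "U \<in> bounded_ops" "norm U \<le> 1" "T = U o\<^sub>L ?P"
    by (rule polar_decomposition[OF Tb])
  note s = trace_norm_has_sum[OF T is_onb_std_basis]
  obtain F where F: "finite F" "F \<subseteq> ?E" and close: "dist (\<Sum>e\<in>F. (norm (?Q e))\<^sup>2) (trace_norm T) < d"
    using has_sum_finite_approximation[OF s, of "d/2"] d by force
  define G where "G = (\<Sum>e\<in>F. rank_one (?Q e) (?Q e))"
  have Gt: "G \<in> trace_class" by (simp add: G_def)
  have "positive_op (?P - G)"
    unfolding positive_iff
  proof (intro conjI allI)
    have "hermitian G"
      unfolding G_def using F(1)
      by induction (simp_all add: hermitian_0 hermitian_add positive_hermitian positive_rank_one)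
    then show "hermitian (?P - G)" by (intro hermitian_diff positive_hermitian[OF pos])
    fix z
    have "cinner z (G z) = complex_of_real (\<Sum>e\<in>F. (cmod (cinner e (?Q z)))\<^sup>2)"
    proof -
      have "cinner z (rank_one (?Q e) (?Q e) z) = complex_of_real ((cmod (cinner e (?Q z)))\<^sup>2)" for e
        unfolding rank_one_apply cinner_scaleC_right cinner_self_mult by (simp only: hermitianD[OF hQ])
      then show ?thesis by (simp add: G_def blinfun.sum_left cinner.sum_right)
    qed
    then have "inner z (G z) = (\<Sum>e\<in>F. (cmod (cinner e (?Q z)))\<^sup>2)"
      by (metis Re_cinner Re_complex_of_real)
    also have "\<dots> \<le> (norm (?Q z))\<^sup>2"
      using bessel_onb[OF is_onb_std_basis F] by (simp add: bessel_def)
    also have "\<dots> = inner z (?P z)"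
      using cinner_sqrt[OF pos, of z] by (metis Re_cinner Re_complex_of_real)
    finally show "0 \<le> inner z ((?P - G) z)" by (simp add: blinfun.diff_left inner_diff_right)
  qed
  moreover have "?P - G \<in> trace_class" using abs_op_trace_class(1)[OF T] Gt by simp
  ultimately have "complex_of_real (trace_norm (?P - G)) = trace_op ?P - trace_op G"
    using trace_positive trace_op_diff[OF abs_op_trace_class(1)[OF T] Gt] by metis
  also have "trace_op ?P = complex_of_real (trace_norm T)"
    using trace_positive[OF pos] abs_op_trace_class[OF T] by simp
  also have "trace_op G = complex_of_real (\<Sum>e\<in>F. (norm (?Q e))\<^sup>2)"
    by (simp add: G_def trace_op_sum trace_rank_one cinner_self)
  finally have "trace_norm (?P - G) = trace_norm T - (\<Sum>e\<in>F. (norm (?Q e))\<^sup>2)"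
    by (metis of_real_diff of_real_eq_iff)
  then have lt: "trace_norm (?P - G) < d" using close by (simp add: dist_real_def)
  have "T - (\<Sum>e\<in>F. rank_one (U (?Q e)) (?Q e)) = U o\<^sub>L (?P - G)"
    by (rule blinfun_eqI, subst U(3))
      (simp add: G_def blinfun.diff_left blinfun.diff_right blinfun.sum_left blinfun.sum_right
        bounded_ops_scaleC[OF U(1)])
  then have "trace_norm (T - (\<Sum>e\<in>F. rank_one (U (?Q e)) (?Q e))) \<le> norm U * trace_norm (?P - G)"
    using trace_norm_compose_left[OF \<open>?P - G \<in> trace_class\<close> U(1)] by simp
  also have "\<dots> \<le> trace_norm (?P - G)"
    using U(2) trace_norm_nonneg[OF \<open>?P - G \<in> trace_class\<close>] by (intro mult_left_le_one_le) auto
  finally have "trace_norm (T - (\<Sum>e\<in>F. rank_one (U (?Q e)) (?Q e))) < d" using lt by linarith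
  then show thesis by (rule that[OF F(1)])
qed

text \<open>The limit exists in the operator norm, and the bounds \<open>tc_bound\<close> on differences pass to it.\<close>

lemma trace_class_complete:
  assumes T: "\<And>n. T n \<in> trace_class"
    and C: "\<And>e. e > 0 \<Longrightarrow> \<exists>N. \<forall>m\<ge>N. \<forall>n\<ge>N. trace_norm (T m - T n) < e"
  obtains L where "L \<in> trace_class" "(\<lambda>n. trace_norm (T n - L)) \<longlonglongrightarrow> 0"
proof -
  have "Cauchy T"
  proof (rule metric_CauchyI)
    fix e :: real assume "e > 0"
    then obtain N where N: "\<And>m n. m \<ge> N \<Longrightarrow> n \<ge> N \<Longrightarrow> trace_norm (T m - T n) < e" using C by blast
    have "dist (T m) (T n) \<le> trace_norm (T m - T n)" for m n
      unfolding dist_norm by (rule norm_le_trace_norm) (simp add: T)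
    then show "\<exists>N. \<forall>m\<ge>N. \<forall>n\<ge>N. dist (T m) (T n) < e" using N by (meson le_less_trans)
  qed
  then obtain L where L: "T \<longlonglongrightarrow> L" using Cauchy_convergent convergent_def by blast
  have Lb: "L \<in> bounded_ops"
    using closed_sequentially[OF closed_bounded_ops _ L] T trace_class_bounded by blast
  have bound: "tc_bound (T n - L) e" if N: "\<And>m. m \<ge> N \<Longrightarrow> trace_norm (T n - T m) \<le> e" for n N e
  proof (rule tc_boundI)
    fix F and x y :: "'a \<Rightarrow> 'a" assume xy: "bessel F x" "bessel F y"
    have "(\<lambda>m. cmod (\<Sum>i\<in>F. cinner (y i) ((T n - T m) (x i)))) \<longlonglongrightarrow> cmod (\<Sum>i\<in>F. cinner (y i) ((T n - L) (x i)))"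
      by (intro tendsto_norm tendsto_sum cinner.tendsto blinfun.tendsto tendsto_intros L)
    moreover have "cmod (\<Sum>i\<in>F. cinner (y i) ((T n - T m) (x i))) \<le> e" if "m \<ge> N" for m
      using tc_boundD[OF tc_bound_trace_norm xy, of "T n - T m"] N[OF that] T by force
    ultimately show "cmod (\<Sum>i\<in>F. cinner (y i) ((T n - L) (x i))) \<le> e"
      by (meson LIMSEQ_le_const2)
  qed
  have main: "\<exists>N. \<forall>n\<ge>N. T n - L \<in> trace_class \<and> trace_norm (T n - L) \<le> e" if "e > 0" for e
  proof -
    obtain N where N: "\<And>m n. m \<ge> N \<Longrightarrow> n \<ge> N \<Longrightarrow> trace_norm (T m - T n) < e" using C[OF \<open>e > 0\<close>] by blast
    have "T n - L \<in> trace_class \<and> trace_norm (T n - L) \<le> e" if "n \<ge> N" for n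
      using tc_bound_imp_trace_class[of "T n - L", OF _ bound[of N n e]] N[OF that] Lb
        trace_class_bounded[OF T] by (auto intro: less_imp_le)
    then show ?thesis by blast
  qed
  obtain n where "T n - L \<in> trace_class" using main[of 1] by auto
  then have "T n - (T n - L) \<in> trace_class" by (rule trace_class_diff[OF T])
  then have Lt: "L \<in> trace_class" by simp
  have "(\<lambda>n. trace_norm (T n - L)) \<longlonglongrightarrow> 0"
  proof (rule LIMSEQ_I)
    fix r :: real assume "r > 0"
    then obtain N where "\<forall>n\<ge>N. trace_norm (T n - L) \<le> r / 2" using main[of "r/2"] by auto
    then show "\<exists>N. \<forall>n\<ge>N. norm (trace_norm (T n - L) - 0) < r"
      using \<open>r > 0\<close> trace_norm_nonneg[OF trace_class_diff[OF T Lt]] by (intro exI[of _ N]) force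
  qed
  then show thesis using that Lt by blast
qed


section \<open>Unital positive maps\<close>

definition unital_positive_map :: "('a::chilbert_space op \<Rightarrow> 'a op) \<Rightarrow> bool" where
  "unital_positive_map \<Theta> \<longleftrightarrow>
     (\<forall>S\<in>bounded_ops. \<Theta> S \<in> bounded_ops) \<and>
     (\<forall>S\<in>bounded_ops. \<forall>R\<in>bounded_ops. \<Theta> (S + R) = \<Theta> S + \<Theta> R) \<and>
     (\<forall>c. \<forall>S\<in>bounded_ops. \<Theta> (c *\<^sub>C S) = c *\<^sub>C \<Theta> S) \<and>
     (\<forall>S. positive_op S \<longrightarrow> positive_op (\<Theta> S)) \<and>
     \<Theta> id_blinfun = id_blinfun"

text \<open>The Bernstein polynomials in an operator, given by their Pascal type recursion; with it the
  moment identities below need only multiplication by \<open>X\<close> from the left.\<close>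

fun bernstein :: "'a::real_normed_vector op \<Rightarrow> nat \<Rightarrow> nat \<Rightarrow> 'a op" where
  "bernstein X 0 k = (if k = 0 then id_blinfun else 0)"
| "bernstein X (Suc n) 0 = (id_blinfun - X) o\<^sub>L bernstein X n 0"
| "bernstein X (Suc n) (Suc k) = ((id_blinfun - X) o\<^sub>L bernstein X n (Suc k)) + (X o\<^sub>L bernstein X n k)"

lemma bernstein_commute: "X o\<^sub>L bernstein X n k = bernstein X n k o\<^sub>L X"
proof (induction X n k rule: bernstein.induct)
  case (2 X n)
  then show ?case
    by (simp add: blinfun_compose.diff_left blinfun_compose.diff_right op_assoc)
      (simp flip: op_assoc)
next
  case (3 X n k)
  have "X o\<^sub>L (X o\<^sub>L bernstein X n (Suc k)) = (X o\<^sub>L bernstein X n (Suc k)) o\<^sub>L X"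
    "X o\<^sub>L (X o\<^sub>L bernstein X n k) = (X o\<^sub>L bernstein X n k) o\<^sub>L X"
    using 3 by (metis op_assoc)+
  then show ?case
    using 3 by (simp add: blinfun_compose.diff_left blinfun_compose.diff_right
        blinfun_compose.add_left blinfun_compose.add_right)
qed simp

lemma bernstein_commute_complement:
  "(id_blinfun - X) o\<^sub>L bernstein X n k = bernstein X n k o\<^sub>L (id_blinfun - X)"
  by (simp add: blinfun_compose.diff_left blinfun_compose.diff_right bernstein_commute)

lemma bernstein_positive:
  assumes "positive_op X" "positive_op (id_blinfun - X)"
  shows "positive_op (bernstein X n k)"
  using assms
proof (induction X n k rule: bernstein.induct)
  case (1 X k)
  then show ?case by (simp add: positive_id positive_0)
next
  case (2 X n)
  then show ?case
    unfolding bernstein.simps by (intro positive_commuting_product bernstein_commute_complement)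
next
  case (3 X n k)
  then show ?case
    unfolding bernstein.simps
    by (intro positive_add positive_commuting_product bernstein_commute_complement bernstein_commute)
qed

lemma bernstein_eq_0: "n < k \<Longrightarrow> bernstein X n k = 0"
  by (induction X n k rule: bernstein.induct) auto

text \<open>The weights 1, \<open>k\<close> and \<open>k\<^sup>2\<close> turn this into recursions for the moments of order 0, 1 and 2.\<close>

lemma bernstein_sum_Suc:
  fixes X :: "'a::real_normed_vector op"
  shows "(\<Sum>k\<le>Suc n. w k *\<^sub>R bernstein X (Suc n) k) =
    ((id_blinfun - X) o\<^sub>L (\<Sum>k\<le>n. w k *\<^sub>R bernstein X n k)) +
    (X o\<^sub>L (\<Sum>k\<le>n. w (Suc k) *\<^sub>R bernstein X n k))"
proof -
  have "(\<Sum>k\<le>Suc n. w k *\<^sub>R bernstein X (Suc n) k) =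
    w 0 *\<^sub>R bernstein X (Suc n) 0 + (\<Sum>k\<le>n. w (Suc k) *\<^sub>R bernstein X (Suc n) (Suc k))"
    by (rule sum.atMost_Suc_shift)
  also have "\<dots> = (w 0 *\<^sub>R ((id_blinfun - X) o\<^sub>L bernstein X n 0) +
      (\<Sum>k\<le>n. w (Suc k) *\<^sub>R ((id_blinfun - X) o\<^sub>L bernstein X n (Suc k)))) +
      (\<Sum>k\<le>n. w (Suc k) *\<^sub>R (X o\<^sub>L bernstein X n k))"
    by (simp add: scaleR_add_right sum.distrib)
  also have "w 0 *\<^sub>R ((id_blinfun - X) o\<^sub>L bernstein X n 0) +
      (\<Sum>k\<le>n. w (Suc k) *\<^sub>R ((id_blinfun - X) o\<^sub>L bernstein X n (Suc k)))
      = (\<Sum>k\<le>Suc n. w k *\<^sub>R ((id_blinfun - X) o\<^sub>L bernstein X n k))"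
    by (rule sum.atMost_Suc_shift[symmetric])
  also have "\<dots> = (\<Sum>k\<le>n. w k *\<^sub>R ((id_blinfun - X) o\<^sub>L bernstein X n k))"
    by (simp add: bernstein_eq_0)
  finally show ?thesis
    by (simp add: blinfun_compose.sum_right blinfun_compose.scaleR_right)
qed

lemma bernstein_sum_0: "(\<Sum>k\<le>n. bernstein X n k) = id_blinfun"
proof (induction n)
  case (Suc n)
  show ?case using bernstein_sum_Suc[of "\<lambda>_. 1" X n] Suc by simp
qed simp

lemma bernstein_sum_1: "(\<Sum>k\<le>n. real k *\<^sub>R bernstein X n k) = real n *\<^sub>R X"
proof (induction n)
  case (Suc n)
  have "(\<Sum>k\<le>n. real (Suc k) *\<^sub>R bernstein X n k) = real n *\<^sub>R X + id_blinfun"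
    using Suc by (simp add: scaleR_add_left sum.distrib bernstein_sum_0)
  then show ?case unfolding bernstein_sum_Suc[of real X n] Suc
    by (simp add: blinfun_compose.diff_left blinfun_compose.add_right blinfun_compose.scaleR_right
        scaleR_add_left scaleR_diff_right)
qed simp

lemma bernstein_sum_2:
  "(\<Sum>k\<le>n. (real k)\<^sup>2 *\<^sub>R bernstein X n k) = real n *\<^sub>R X + (real n * (real n - 1)) *\<^sub>R (X o\<^sub>L X)"
proof (induction n)
  case (Suc n)
  let ?S2 = "\<Sum>k\<le>n. (real k)\<^sup>2 *\<^sub>R bernstein X n k"
  have "(real (Suc k))\<^sup>2 *\<^sub>R bernstein X n k = (real k)\<^sup>2 *\<^sub>R bernstein X n k +
      2 *\<^sub>R (real k *\<^sub>R bernstein X n k) + bernstein X n k" for k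
  proof -
    have sq: "(real (Suc k))\<^sup>2 = (real k)\<^sup>2 + 2 * real k + 1"
      by (simp add: power2_eq_square algebra_simps)
    show ?thesis unfolding sq scaleR_add_left by simp
  qed
  then have "(\<Sum>k\<le>n. (real (Suc k))\<^sup>2 *\<^sub>R bernstein X n k) = ?S2 + 2 *\<^sub>R (real n *\<^sub>R X) + id_blinfun"
    by (simp only: sum.distrib scaleR_sum_right[symmetric] bernstein_sum_0 bernstein_sum_1)
  then have "(\<Sum>k\<le>Suc n. (real k)\<^sup>2 *\<^sub>R bernstein X (Suc n) k)
      = ((id_blinfun - X) o\<^sub>L ?S2) + (X o\<^sub>L (?S2 + 2 *\<^sub>R (real n *\<^sub>R X) + id_blinfun))"
    using bernstein_sum_Suc[of "\<lambda>k. (real k)\<^sup>2" X n] by simp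
  also have "\<dots> = ?S2 + (2 * real n) *\<^sub>R (X o\<^sub>L X) + X"
    by (simp add: blinfun_compose.diff_left blinfun_compose.add_right blinfun_compose.scaleR_right)
  finally have eq: "(\<Sum>k\<le>Suc n. (real k)\<^sup>2 *\<^sub>R bernstein X (Suc n) k) = \<dots>" .
  have "real (Suc n) * (real (Suc n) - 1) = real n * (real n - 1) + 2 * real n"
    by (simp add: algebra_simps)
  then have "(real (Suc n) * (real (Suc n) - 1)) *\<^sub>R (X o\<^sub>L X)
      = (real n * (real n - 1)) *\<^sub>R (X o\<^sub>L X) + (2 * real n) *\<^sub>R (X o\<^sub>L X)"
    by (simp only: scaleR_add_left)
  then show ?case unfolding eq Suc by (simp add: scaleR_add_left)
qed simp

lemma norm_bounds_hermitian:
  assumes "hermitian X"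
  shows "positive_op (norm X *\<^sub>R id_blinfun + X)" "positive_op (norm X *\<^sub>R id_blinfun - X)"
proof -
  have "\<bar>inner x (X x)\<bar> \<le> norm X * inner x x" for x
  proof -
    have "\<bar>inner x (X x)\<bar> \<le> norm x * norm (X x)" by (rule Cauchy_Schwarz_ineq2)
    also have "\<dots> \<le> norm x * (norm X * norm x)" by (intro mult_left_mono norm_blinfun) simp
    finally show ?thesis by (simp add: power2_norm_eq_inner[symmetric] power2_eq_square mult_ac)
  qed
  then have "0 \<le> norm X * inner x x + inner x (X x)" "0 \<le> norm X * inner x x - inner x (X x)" for x
    by (smt (verit))+
  then show "positive_op (norm X *\<^sub>R id_blinfun + X)" "positive_op (norm X *\<^sub>R id_blinfun - X)"
    by (simp_all add: positive_iff assms hermitian_add hermitian_diff hermitian_scaleR hermitian_id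
        blinfun.add_left blinfun.diff_left blinfun.scaleR_left inner_add_right inner_diff_right)
qed

definition anticomm :: "'a::chilbert_space op \<Rightarrow> 'a op \<Rightarrow> 'a op" where
  "anticomm X S = (X o\<^sub>L S) + (S o\<^sub>L X)"

lemma anticomm_bounded [simp]: "X \<in> bounded_ops \<Longrightarrow> S \<in> bounded_ops \<Longrightarrow> anticomm X S \<in> bounded_ops"
  by (simp add: anticomm_def)

lemma hermitian_anticomm:
  assumes "hermitian X" "hermitian S" shows "hermitian (anticomm X S)"
  using assms by (intro hermitianI)
    (simp_all add: hermitian_bounded anticomm_def blinfun.add_left cinner_add_left cinner_add_right
      hermitianD)

lemma hermitian_eqI:
  assumes "hermitian A" "hermitian B" "\<And>x. inner x (blinfun_apply A x) = inner x (blinfun_apply B x)"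
  shows "A = (B :: 'a::chilbert_space op)"
proof -
  have q: "inner x ((A - B) x) = 0" for x by (simp add: blinfun.diff_left inner_diff_right assms(3))
  then have "positive_op (A - B)" by (simp add: positive_iff hermitian_diff assms(1,2))
  then have "(A - B) x = 0" for x using positive_apply_eq_0 q by blast
  then show ?thesis by (intro blinfun_eqI) (simp add: blinfun.diff_left)
qed

lemma linear_quadratic_nonneg:
  fixes a b :: real
  assumes "\<And>r. 0 \<le> r * a + r\<^sup>2 * b"
  shows "a = 0"
proof (rule ccontr)
  assume a: "a \<noteq> 0"
  define c where "c = \<bar>b\<bar> + 1"
  have c: "c > 0" "b < c" by (auto simp: c_def)
  have "0 \<le> (- a / c) * a + (- a / c)\<^sup>2 * b" by (rule assms)
  also have "\<dots> = (a\<^sup>2 / c\<^sup>2) * (b - c)" using c by (simp add: power2_eq_square field_simps)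
  also have "\<dots> < 0" using a c by (intro mult_pos_neg) auto
  finally show False by simp
qed

lemma cartesian_decomposition:
  assumes "S \<in> bounded_ops"
  obtains H K :: "'a::chilbert_space op" where "hermitian H" "hermitian K" "S = H + \<i> *\<^sub>C K"
proof
  let ?H = "(1/2) *\<^sub>R (S + adj_op S)" and ?K = "(\<i> / 2) *\<^sub>C (adj_op S - S)"
  show "hermitian ?H" using assms
    by (intro hermitianI) (simp_all add: adj_op_bounded blinfun.add_left blinfun.scaleR_left
        cinner_scaleR_left cinner_scaleR_right cinner_add_left cinner_add_right
        cinner_adj_left cinner_adj_right add.commute)
  show "hermitian ?K" using assms
    by (intro hermitianI) (simp_all add: adj_op_bounded blinfun.diff_left
        cinner_scaleC_left cinner_scaleC_right cinner.diff_left cinner.diff_right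
        cinner_adj_left cinner_adj_right algebra_simps)
  have "\<i> *\<^sub>C ?K = (1/2) *\<^sub>R (S - adj_op S)"
    by (simp add: scaleC_scaleC flip: scaleC_of_real) (simp add: scaleC_diff_right)
  then show "S = ?H + \<i> *\<^sub>C ?K"
    by (simp add: algebra_simps) (simp flip: scaleR_add_left)
qed

context
  fixes \<Theta> :: "'a::chilbert_space op \<Rightarrow> 'a op"
  assumes upm: "unital_positive_map \<Theta>"
begin

lemma upm_bounded [simp]: "S \<in> bounded_ops \<Longrightarrow> \<Theta> S \<in> bounded_ops"
  and upm_add: "S \<in> bounded_ops \<Longrightarrow> R \<in> bounded_ops \<Longrightarrow> \<Theta> (S + R) = \<Theta> S + \<Theta> R"
  and upm_scaleC: "S \<in> bounded_ops \<Longrightarrow> \<Theta> (c *\<^sub>C S) = c *\<^sub>C \<Theta> S"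
  and upm_positive: "positive_op S \<Longrightarrow> positive_op (\<Theta> S)"
  and upm_id: "\<Theta> id_blinfun = id_blinfun"
  using upm by (auto simp: unital_positive_map_def)

lemma upm_scaleR: "S \<in> bounded_ops \<Longrightarrow> \<Theta> (r *\<^sub>R S) = r *\<^sub>R \<Theta> S"
  by (metis scaleC_of_real upm_scaleC)

lemma upm_0: "\<Theta> 0 = 0"
  using upm_scaleR[of 0 0] by simp

lemma upm_diff: "S \<in> bounded_ops \<Longrightarrow> R \<in> bounded_ops \<Longrightarrow> \<Theta> (S - R) = \<Theta> S - \<Theta> R"
  using upm_add[of "S - R" R] by simp

lemma upm_sum: "(\<And>i. i \<in> F \<Longrightarrow> f i \<in> bounded_ops) \<Longrightarrow> \<Theta> (sum f F) = (\<Sum>i\<in>F. \<Theta> (f i))"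
  by (induction F rule: infinite_finite_induct) (auto simp: upm_0 upm_add bounded_ops_sum)

lemma upm_norm_shift:
  assumes "hermitian X"
  shows "positive_op (norm X *\<^sub>R id_blinfun + \<Theta> X)" "positive_op (norm X *\<^sub>R id_blinfun - \<Theta> X)"
  using norm_bounds_hermitian[OF assms, THEN upm_positive] hermitian_bounded[OF assms]
  by (simp_all add: upm_add upm_diff upm_scaleR upm_id)

lemma upm_hermitian:
  assumes "hermitian X" shows "hermitian (\<Theta> X)"
  using hermitian_diff[OF positive_hermitian[OF upm_norm_shift(1)[OF assms]]
      hermitian_scaleR[OF hermitian_id, of "norm X"]] by simp

text \<open>Adding \<open>\<parallel>X\<parallel>\<close> turns \<open>\<Theta> X\<close> into a positive operator of norm at most \<open>2 \<parallel>X\<parallel>\<close>.\<close>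

lemma upm_norm_le:
  assumes "hermitian X" shows "norm (\<Theta> X) \<le> 3 * norm X"
proof -
  have "norm (norm X *\<^sub>R id_blinfun + \<Theta> X) \<le> 2 * norm X"
  proof (rule positive_norm_le[OF upm_norm_shift(1)[OF assms]])
    fix x
    show "inner x ((norm X *\<^sub>R id_blinfun + \<Theta> X) x) \<le> 2 * norm X * (norm x)\<^sup>2"
      using positive_inner_nonneg[OF upm_norm_shift(2)[OF assms], of x]
      by (simp add: blinfun.add_left blinfun.diff_left blinfun.scaleR_left inner_add_right
          inner_diff_right power2_norm_eq_inner)
  qed simp
  moreover have "norm (norm X *\<^sub>R id_blinfun :: 'a op) \<le> norm X"
    using mult_left_mono[OF norm_id_le, of "norm X"] by simp
  ultimately show ?thesis
    using norm_triangle_ineq4[of "norm X *\<^sub>R id_blinfun + \<Theta> X" "norm X *\<^sub>R id_blinfun"] by simp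
qed

text \<open>Let \<open>Q\<^sub>k\<close> be the image of the \<open>k\<close>-th Bernstein polynomial of degree \<open>n\<close>, a positive operator, and
  \<open>\<lambda>\<^sub>k = k / n\<close>.  The \<open>Q\<^sub>k\<close> sum up to 1, the \<open>\<lambda>\<^sub>k Q\<^sub>k\<close> to \<open>\<Theta> X\<close> and the \<open>\<lambda>\<^sub>k\<^sup>2 Q\<^sub>k\<close> to \<open>\<Theta> (X\<^sup>2)\<close> up to
  an error of order \<open>1/n\<close>.  Hence the sum of the positive operators \<open>(\<lambda>\<^sub>k - \<Theta> X) Q\<^sub>k (\<lambda>\<^sub>k - \<Theta> X)\<close> is
  \<open>\<Theta> (X\<^sup>2) - (\<Theta> X)\<^sup>2\<close> up to that error.\<close>

lemma kadison_unit_interval: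
  assumes X: "positive_op X" "positive_op (id_blinfun - X)"
  shows "(norm (\<Theta> X x))\<^sup>2 \<le> inner x (\<Theta> (X o\<^sub>L X) x)"
proof -
  define L where "L = \<Theta> X x"
  have Xb: "X \<in> bounded_ops" using X(1) by (rule positive_bounded)
  have step: "(norm L)\<^sup>2 \<le> (1 / real n) * inner x L + (1 - 1 / real n) * inner x (\<Theta> (X o\<^sub>L X) x)"
    if n: "n > 0" for n
  proof -
    define Q where "Q k = \<Theta> (bernstein X n k)" for k
    have bb: "bernstein X n k \<in> bounded_ops" for k
      using bernstein_positive[OF X] by (rule positive_bounded)
    have Qp: "positive_op (Q k)" for k unfolding Q_def by (intro upm_positive bernstein_positive X)
    have Q0: "(\<Sum>k\<le>n. Q k v) = v" for v
    proof -
      have "(\<Sum>k\<le>n. Q k) = id_blinfun"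
        using arg_cong[OF bernstein_sum_0[of X n], of \<Theta>] by (simp add: Q_def upm_sum bb upm_id)
      then show ?thesis by (metis blinfun.sum_left blinfun_apply_id_blinfun id_apply)
    qed
    have Q1: "(\<Sum>k\<le>n. real k *\<^sub>R Q k v) = real n *\<^sub>R \<Theta> X v" for v
    proof -
      have "(\<Sum>k\<le>n. real k *\<^sub>R Q k) = real n *\<^sub>R \<Theta> X"
        using arg_cong[OF bernstein_sum_1[of X n], of \<Theta>]
        by (simp add: Q_def upm_sum bb upm_scaleR Xb)
      then show ?thesis by (metis (no_types, lifting) blinfun.sum_left blinfun.scaleR_left sum.cong)
    qed
    have Q2: "(\<Sum>k\<le>n. (real k)\<^sup>2 *\<^sub>R Q k v)
        = real n *\<^sub>R \<Theta> X v + (real n * (real n - 1)) *\<^sub>R \<Theta> (X o\<^sub>L X) v" for v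
    proof -
      have "(\<Sum>k\<le>n. (real k)\<^sup>2 *\<^sub>R Q k) = real n *\<^sub>R \<Theta> X + (real n * (real n - 1)) *\<^sub>R \<Theta> (X o\<^sub>L X)"
        using arg_cong[OF bernstein_sum_2[of X n], of \<Theta>]
        by (simp add: Q_def upm_sum bb upm_scaleR upm_add Xb)
      from arg_cong[OF this, of "\<lambda>T. blinfun_apply T v"] show ?thesis
        by (simp add: blinfun.sum_left blinfun.scaleR_left blinfun.add_left)
    qed
    have sym: "inner u (Q k v) = inner (Q k u) v" for u v k
      by (metis Re_cinner hermitianD positive_hermitian Qp)
    \<comment> \<open>The vector is \<open>(\<lambda>\<^sub>k - \<Theta> X) x\<close>, multiplied by \<open>n\<close> to avoid fractions.\<close>
    have "0 \<le> inner (real k *\<^sub>R x - real n *\<^sub>R L) (Q k (real k *\<^sub>R x - real n *\<^sub>R L))" for k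
      by (rule positive_inner_nonneg[OF Qp])
    also have "inner (real k *\<^sub>R x - real n *\<^sub>R L) (Q k (real k *\<^sub>R x - real n *\<^sub>R L)) =
       inner x ((real k)\<^sup>2 *\<^sub>R Q k x) - 2 * real n * inner (real k *\<^sub>R Q k x) L
         + (real n)\<^sup>2 * inner L (Q k L)" for k
      by (simp add: blinfun.diff_right blinfun.scaleR_right inner_diff_left inner_diff_right
          sym[of x k L] inner_commute[of L "Q k x"] power2_eq_square algebra_simps)
    finally have "0 \<le> (\<Sum>k\<le>n. inner x ((real k)\<^sup>2 *\<^sub>R Q k x) - 2 * real n * inner (real k *\<^sub>R Q k x) L
         + (real n)\<^sup>2 * inner L (Q k L))" by (intro sum_nonneg) blast
    also have "\<dots> = inner x (\<Sum>k\<le>n. (real k)\<^sup>2 *\<^sub>R Q k x)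
        - 2 * real n * inner (\<Sum>k\<le>n. real k *\<^sub>R Q k x) L + (real n)\<^sup>2 * inner L (\<Sum>k\<le>n. Q k L)"
      by (simp only: sum.distrib sum_subtractf inner_sum_right inner_sum_left sum_distrib_left)
    also have "\<dots> = real n * inner x L + real n * (real n - 1) * inner x (\<Theta> (X o\<^sub>L X) x)
        - (real n)\<^sup>2 * (norm L)\<^sup>2"
      unfolding Q0 Q1 Q2 L_def[symmetric]
      by (simp add: inner_add_right dot_square_norm power2_eq_square[of "real n"])
    finally have le: "(real n)\<^sup>2 * (norm L)\<^sup>2 \<le> real n * inner x L + real n * (real n - 1) * inner x (\<Theta> (X o\<^sub>L X) x)"
      by simp
    have "(real n)\<^sup>2 * ((1 / real n) * inner x L + (1 - 1 / real n) * inner x (\<Theta> (X o\<^sub>L X) x))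
       = real n * inner x L + real n * (real n - 1) * inner x (\<Theta> (X o\<^sub>L X) x)"
      using n by (simp add: power2_eq_square field_simps)
    with le have "(real n)\<^sup>2 * (norm L)\<^sup>2 \<le>
      (real n)\<^sup>2 * ((1 / real n) * inner x L + (1 - 1 / real n) * inner x (\<Theta> (X o\<^sub>L X) x))" by simp
    then show ?thesis using n by (simp add: mult_le_cancel_left)
  qed
  have "(\<lambda>n. inverse (real (Suc n)) * inner x L + (1 - inverse (real (Suc n))) * inner x (\<Theta> (X o\<^sub>L X) x))
      \<longlonglongrightarrow> 0 * inner x L + (1 - 0) * inner x (\<Theta> (X o\<^sub>L X) x)"
    by (intro tendsto_intros LIMSEQ_inverse_real_of_nat)
  then have "(norm L)\<^sup>2 \<le> 0 * inner x L + (1 - 0) * inner x (\<Theta> (X o\<^sub>L X) x)"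
  proof (rule LIMSEQ_le_const)
    have "(norm L)\<^sup>2 \<le> inverse (real (Suc n)) * inner x L + (1 - inverse (real (Suc n))) * inner x (\<Theta> (X o\<^sub>L X) x)" for n
      using step[of "Suc n"] by (simp only: inverse_eq_divide zero_less_Suc)
    then show "\<exists>N. \<forall>n\<ge>N. (norm L)\<^sup>2 \<le> inverse (real (Suc n)) * inner x L
        + (1 - inverse (real (Suc n))) * inner x (\<Theta> (X o\<^sub>L X) x)" by blast
  qed
  then show ?thesis by (simp add: L_def)
qed

text \<open>Both sides change in the same way under \<open>X \<mapsto> a X + b\<close>, which moves \<open>X\<close> into the unit interval.\<close>

lemma kadison:
  assumes X: "hermitian X"
  shows "(norm (\<Theta> X x))\<^sup>2 \<le> inner x (\<Theta> (X o\<^sub>L X) x)"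
proof -
  define m c where "m = norm X" and "c = 2 * norm X + 1"
  have c: "c > 0" by (simp add: c_def add_nonneg_pos)
  have Xb: "X \<in> bounded_ops" using X by (rule hermitian_bounded)
  define Z where "Z = (1 / c) *\<^sub>R (m *\<^sub>R id_blinfun + X)"
  have Zb: "Z \<in> bounded_ops" using Xb by (simp add: Z_def)
  have 1: "positive_op Z"
    unfolding Z_def m_def using c by (intro positive_scaleR norm_bounds_hermitian X) simp
  have "id_blinfun - Z = (1 / c) *\<^sub>R (id_blinfun + (m *\<^sub>R id_blinfun - X))"
  proof -
    have "id_blinfun = (1 / c) *\<^sub>R (c *\<^sub>R (id_blinfun :: 'a op))" using c by simp
    also have "c *\<^sub>R (id_blinfun :: 'a op) = id_blinfun + m *\<^sub>R id_blinfun + m *\<^sub>R id_blinfun"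
    proof -
      have c2: "c = 1 + m + m" by (simp add: c_def m_def)
      show ?thesis unfolding c2 scaleR_add_left by simp
    qed
    finally have split: "(id_blinfun :: 'a op) = (1 / c) *\<^sub>R (id_blinfun + m *\<^sub>R id_blinfun + m *\<^sub>R id_blinfun)" .
    show ?thesis
      unfolding Z_def by (subst (1) split, simp only: scaleR_diff_right[symmetric]) (simp add: algebra_simps)
  qed
  then have 2: "positive_op (id_blinfun - Z)"
    using c by (simp only:) (intro positive_scaleR positive_add positive_id
        norm_bounds_hermitian(2)[OF X, folded m_def], simp)
  have XZ: "X = c *\<^sub>R Z - m *\<^sub>R id_blinfun" using c by (simp add: Z_def)
  have X2: "X o\<^sub>L X = c\<^sup>2 *\<^sub>R (Z o\<^sub>L Z) - (2 * c * m) *\<^sub>R Z + m\<^sup>2 *\<^sub>R id_blinfun"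
    unfolding XZ by (rule blinfun_eqI)
      (simp add: blinfun.diff_left blinfun.add_left blinfun.scaleR_left blinfun.diff_right
        blinfun.scaleR_right power2_eq_square algebra_simps flip: scaleR_add_left)
  have eq: "\<Theta> X x = c *\<^sub>R \<Theta> Z x - m *\<^sub>R x"
    by (subst XZ) (simp add: upm_diff upm_scaleR upm_id Zb blinfun.diff_left blinfun.scaleR_left)
  have "(norm (\<Theta> X x))\<^sup>2 = c\<^sup>2 * (norm (\<Theta> Z x))\<^sup>2 - 2 * c * m * inner x (\<Theta> Z x) + m\<^sup>2 * (norm x)\<^sup>2"
    unfolding eq power2_norm_eq_inner
    by (simp add: inner_diff_left inner_diff_right inner_commute power2_eq_square algebra_simps)
  moreover have "inner x (\<Theta> (X o\<^sub>L X) x)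
      = c\<^sup>2 * inner x (\<Theta> (Z o\<^sub>L Z) x) - 2 * c * m * inner x (\<Theta> Z x) + m\<^sup>2 * (norm x)\<^sup>2"
    unfolding X2 by (simp add: upm_diff upm_add upm_scaleR upm_id Zb blinfun.diff_left blinfun.add_left
        blinfun.scaleR_left inner_diff_right inner_add_right power2_norm_eq_inner)
  moreover have "c\<^sup>2 * (norm (\<Theta> Z x))\<^sup>2 \<le> c\<^sup>2 * inner x (\<Theta> (Z o\<^sub>L Z) x)"
    by (intro mult_left_mono kadison_unit_interval 1 2) simp
  ultimately show ?thesis by linarith
qed


section \<open>The Jordan algebra of fixed operators with fixed square\<close>

definition fixed_squares :: "'a op set" where
  "fixed_squares = {X. hermitian X \<and> \<Theta> X = X \<and> \<Theta> (X o\<^sub>L X) = X o\<^sub>L X}"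

text \<open>Kadison's inequality for \<open>X + r S\<close> says that a real polynomial \<open>r a + r\<^sup>2 b\<close> is nonnegative for all
  \<open>r\<close>: its constant term vanishes because \<open>\<Theta>\<close> fixes \<open>X\<close> and \<open>X\<^sup>2\<close>.  So \<open>a = 0\<close>, which is the claim for the
  quadratic forms.\<close>

lemma fixed_squares_anticomm_hermitian:
  assumes X: "X \<in> fixed_squares" and S: "hermitian S"
  shows "\<Theta> (anticomm X S) = anticomm X (\<Theta> S)"
proof (rule hermitian_eqI)
  have hX: "hermitian X" and fX: "\<Theta> X = X" "\<Theta> (X o\<^sub>L X) = X o\<^sub>L X"
    using X by (auto simp: fixed_squares_def)
  have Xb [simp]: "X \<in> bounded_ops" and Sb [simp]: "S \<in> bounded_ops"
    using hX S by (simp_all add: hermitian_bounded)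
  show "hermitian (\<Theta> (anticomm X S))" "hermitian (anticomm X (\<Theta> S))"
    by (intro upm_hermitian hermitian_anticomm hX S)+
  fix x
  have symX: "inner x (X y) = inner (X x) y" for x y by (metis Re_cinner hX hermitianD)
  have symS: "inner x (\<Theta> S y) = inner (\<Theta> S x) y" for x y
    by (metis Re_cinner upm_hermitian[OF S] hermitianD)
  define a b where "a = inner x (\<Theta> (anticomm X S) x) - inner x (anticomm X (\<Theta> S) x)"
    and "b = inner x (\<Theta> (S o\<^sub>L S) x) - (norm (\<Theta> S x))\<^sup>2"
  have "0 \<le> r * a + r\<^sup>2 * b" for r
  proof -
    have "(X + r *\<^sub>R S) o\<^sub>L (X + r *\<^sub>R S) = (X o\<^sub>L X) + r *\<^sub>R anticomm X S + r\<^sup>2 *\<^sub>R (S o\<^sub>L S)"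
      by (rule blinfun_eqI) (simp add: anticomm_def blinfun.add_left blinfun.add_right
          blinfun.scaleR_left blinfun.scaleR_right power2_eq_square algebra_simps)
    moreover have "hermitian (X + r *\<^sub>R S)" by (intro hermitian_add hermitian_scaleR hX S)
    ultimately have "(norm (X x + r *\<^sub>R \<Theta> S x))\<^sup>2
        \<le> inner x (X (X x)) + r * inner x (\<Theta> (anticomm X S) x) + r\<^sup>2 * inner x (\<Theta> (S o\<^sub>L S) x)"
      using kadison[of "X + r *\<^sub>R S" x]
      by (simp add: upm_add upm_scaleR fX blinfun.add_left blinfun.scaleR_left inner_add_right)
    moreover have "(norm (X x + r *\<^sub>R \<Theta> S x))\<^sup>2
        = inner x (X (X x)) + r * inner x (anticomm X (\<Theta> S) x) + r\<^sup>2 * (norm (\<Theta> S x))\<^sup>2"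
      unfolding power2_norm_eq_inner
      by (simp add: inner_add_left inner_add_right symX[of x] symS[of x] anticomm_def blinfun.add_left
          inner_commute[of "\<Theta> S x" "X x"] power2_eq_square algebra_simps)
    ultimately show ?thesis by (simp add: a_def b_def algebra_simps)
  qed
  then have "a = 0" by (rule linear_quadratic_nonneg)
  then show "inner x (\<Theta> (anticomm X S) x) = inner x (anticomm X (\<Theta> S) x)" by (simp add: a_def)
qed

lemma fixed_squares_anticomm:
  assumes X: "X \<in> fixed_squares" and S: "S \<in> bounded_ops"
  shows "\<Theta> (anticomm X S) = anticomm X (\<Theta> S)"
proof -
  obtain H K where HK: "hermitian H" "hermitian K" "S = H + \<i> *\<^sub>C K"
    by (rule cartesian_decomposition[OF S])
  have Xb [simp]: "X \<in> bounded_ops" using X by (simp add: fixed_squares_def hermitian_bounded)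
  have [simp]: "H \<in> bounded_ops" "K \<in> bounded_ops" using HK by (simp_all add: hermitian_bounded)
  have lin: "anticomm X (A + \<i> *\<^sub>C B) = anticomm X A + \<i> *\<^sub>C anticomm X B" for A B
    by (rule blinfun_eqI) (simp add: anticomm_def blinfun.add_left blinfun.add_right
        bounded_ops_scaleC[OF Xb] scaleC_add_right)
  show ?thesis
    unfolding HK(3) lin
    by (simp add: upm_add upm_scaleC fixed_squares_anticomm_hermitian[OF X] HK lin)
qed

lemma closed_fixed_squares: "closed fixed_squares"
  unfolding closed_sequential_limits
proof (intro allI impI, elim conjE)
  fix X L assume X: "\<forall>n. X n \<in> fixed_squares" and lim: "X \<longlonglongrightarrow> L"
  have hX: "hermitian (X n)" and fX: "\<Theta> (X n) = X n" "\<Theta> (X n o\<^sub>L X n) = X n o\<^sub>L X n" for n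
    using X by (auto simp: fixed_squares_def)
  have hL: "hermitian L" using closed_sequentially[OF closed_hermitian _ lim] hX by simp
  have fixed_lim: "\<Theta> K = K" if Y: "\<And>n. hermitian (Y n)" "\<And>n. \<Theta> (Y n) = Y n" "Y \<longlonglongrightarrow> K" for Y and K :: "'a op"
  proof -
    have hK: "hermitian K" using closed_sequentially[OF closed_hermitian _ Y(3)] Y(1) by simp
    have "norm (Y n - \<Theta> K) \<le> norm (Y n - K) * 3" for n
      using upm_norm_le[OF hermitian_diff[OF Y(1) hK], of n] Y(1)[of n] hK
      by (simp add: upm_diff hermitian_bounded Y(2))
    then have "(\<lambda>n. Y n - \<Theta> K) \<longlonglongrightarrow> 0"
      by (intro tendsto_0_le[OF LIM_zero[OF Y(3)]] always_eventually allI)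
    then have "Y \<longlonglongrightarrow> \<Theta> K" by (rule LIM_zero_cancel)
    then show ?thesis using Y(3) LIMSEQ_unique by blast
  qed
  have "\<Theta> L = L" by (rule fixed_lim[OF hX fX(1) lim])
  moreover have "\<Theta> (L o\<^sub>L L) = L o\<^sub>L L"
    by (rule fixed_lim[OF hermitian_compose_self[OF hX] fX(2) blinfun_compose.tendsto[OF lim lim]])
  ultimately show "L \<in> fixed_squares" using hL by (simp add: fixed_squares_def)
qed

text \<open>For a fixed \<open>Y\<close> that commutes with \<open>X\<close> also \<open>X Y\<close>, half an anticommutator, is fixed; two applications
  show that \<open>X\<^sup>3\<close> and \<open>X\<^sup>4\<close> are fixed.\<close>

lemma fixed_squares_square:
  assumes X: "X \<in> fixed_squares" shows "X o\<^sub>L X \<in> fixed_squares"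
proof -
  have hX: "hermitian X" and fX: "\<Theta> (X o\<^sub>L X) = X o\<^sub>L X" using X by (auto simp: fixed_squares_def)
  have Xb [simp]: "X \<in> bounded_ops" using hX by (rule hermitian_bounded)
  have half: "\<Theta> (X o\<^sub>L Y) = X o\<^sub>L Y" if "\<Theta> Y = Y" "Y \<in> bounded_ops" "X o\<^sub>L Y = Y o\<^sub>L X" for Y
  proof -
    have "2 *\<^sub>R \<Theta> (X o\<^sub>L Y) = 2 *\<^sub>R (X o\<^sub>L Y)"
      using fixed_squares_anticomm[OF X that(2)] that(1) that(3)[symmetric]
      by (simp add: anticomm_def upm_add that(2) scaleR_2)
    then show ?thesis by simp
  qed
  have "\<Theta> (X o\<^sub>L (X o\<^sub>L X)) = X o\<^sub>L (X o\<^sub>L X)" by (rule half[OF fX]) (simp_all add: op_assoc)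
  then have "\<Theta> (X o\<^sub>L (X o\<^sub>L (X o\<^sub>L X))) = X o\<^sub>L (X o\<^sub>L (X o\<^sub>L X))"
    by (rule half) (simp_all add: op_assoc)
  then show ?thesis using hX fX by (simp add: fixed_squares_def hermitian_compose_self op_assoc)
qed

lemma closed_square_algebra_fixed_squares: "closed_square_algebra fixed_squares"
proof -
  have "X + Y \<in> fixed_squares" if X: "X \<in> fixed_squares" and Y: "Y \<in> fixed_squares" for X Y
  proof -
    have h: "hermitian X" "hermitian Y" and f: "\<Theta> X = X" "\<Theta> (X o\<^sub>L X) = X o\<^sub>L X" "\<Theta> Y = Y" "\<Theta> (Y o\<^sub>L Y) = Y o\<^sub>L Y"
      using X Y by (auto simp: fixed_squares_def)
    have [simp]: "X \<in> bounded_ops" "Y \<in> bounded_ops" using h by (simp_all add: hermitian_bounded)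
    have sq: "(X + Y) o\<^sub>L (X + Y) = (X o\<^sub>L X) + anticomm X Y + (Y o\<^sub>L Y)"
      by (simp add: anticomm_def blinfun_compose.add_left blinfun_compose.add_right)
    have "\<Theta> ((X + Y) o\<^sub>L (X + Y)) = (X + Y) o\<^sub>L (X + Y)"
      unfolding sq by (simp add: upm_add f fixed_squares_anticomm[OF X])
    then show ?thesis using h f by (simp add: fixed_squares_def hermitian_add upm_add)
  qed
  moreover have "r *\<^sub>R X \<in> fixed_squares" if "X \<in> fixed_squares" for r X
    using that by (simp add: fixed_squares_def hermitian_scaleR upm_scaleR hermitian_bounded
        blinfun_compose.scaleR_left blinfun_compose.scaleR_right)
  moreover have "0 \<in> fixed_squares" by (simp add: fixed_squares_def hermitian_0 upm_0)
  moreover have "id_blinfun \<in> fixed_squares" by (simp add: fixed_squares_def hermitian_id upm_id)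
  ultimately show ?thesis
    using closed_fixed_squares fixed_squares_square by (simp add: closed_square_algebra_def subspace_def)
qed

text \<open>\<open>B S B\<close> is a combination of the anticommutators of \<open>B\<close> with that of \<open>B\<close> and \<open>S\<close>, and of \<open>B\<^sup>2\<close> with
  \<open>S\<close>.\<close>

lemma fixed_squares_conj:
  assumes B: "B \<in> fixed_squares" and S: "S \<in> bounded_ops"
  shows "\<Theta> (conj_by B S) = conj_by B (\<Theta> S)"
proof -
  have Bb [simp]: "B \<in> bounded_ops" using B by (simp add: fixed_squares_def hermitian_bounded)
  have eq: "conj_by B R = (1/2) *\<^sub>R (anticomm B (anticomm B R) - anticomm (B o\<^sub>L B) R)" for R
    by (rule blinfun_eqI) (simp add: conj_by_def anticomm_def blinfun.add_left blinfun.diff_left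
        blinfun.scaleR_left blinfun.add_right blinfun.scaleR_right scaleR_2[symmetric])
  show ?thesis
    unfolding eq using S fixed_squares_square[OF B]
    by (simp add: upm_scaleR upm_diff fixed_squares_anticomm[OF B] fixed_squares_anticomm)
qed

lemma fixed_conj_sqrt:
  assumes A: "positive_op A" and fixed: "\<Theta> A = A" "\<Theta> (A o\<^sub>L A) = A o\<^sub>L A" and S: "S \<in> bounded_ops"
  shows "\<Theta> (conj_by (sqrt_op A) S) = conj_by (sqrt_op A) (\<Theta> S)"
proof (rule fixed_squares_conj[OF _ S])
  have "A \<in> fixed_squares" using A fixed by (simp add: fixed_squares_def positive_hermitian)
  then show "sqrt_op A \<in> fixed_squares"
    by (rule sqrt_in_closed_square_algebra[OF A closed_square_algebra_fixed_squares])
qed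

end

declare upm_bounded [simp del]


section \<open>The dual of a stochastic map\<close>

lemma rank_one_add_left: "rank_one (x + y) z = rank_one x z + rank_one y z"
  by (rule blinfun_eqI) (simp add: blinfun.add_left scaleC_add_right)

lemma rank_one_add_right: "rank_one x (y + z) = rank_one x y + rank_one x z"
  by (rule blinfun_eqI) (simp add: blinfun.add_left cinner_add_left scaleC_add_left)

lemma rank_one_scaleC_left: "rank_one (c *\<^sub>C x) y = c *\<^sub>C rank_one x y"
  by (rule blinfun_eqI) (simp add: scaleC_scaleC mult.commute)

lemma rank_one_scaleC_right: "rank_one x (c *\<^sub>C y) = cnj c *\<^sub>C rank_one x y"
  by (rule blinfun_eqI) (simp add: cinner_scaleC_left scaleC_scaleC)

lemma scaleC_compose_left: "(c *\<^sub>C T) o\<^sub>L S = c *\<^sub>C (T o\<^sub>L (S :: 'a::chilbert_space op))"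
  by (rule blinfun_eqI) simp

lemma scaleC_compose_right:
  "T \<in> bounded_ops \<Longrightarrow> T o\<^sub>L (c *\<^sub>C S) = c *\<^sub>C (T o\<^sub>L (S :: 'a::chilbert_space op))"
  by (rule blinfun_eqI) (simp add: bounded_ops_scaleC)

context
  fixes \<Phi> :: "'a::chilbert_space op \<Rightarrow> 'a op"
  assumes sto: "stochastic_map \<Phi>"
begin

lemma stochastic_trace_class [simp]: "T \<in> trace_class \<Longrightarrow> \<Phi> T \<in> trace_class"
  and stochastic_add: "T \<in> trace_class \<Longrightarrow> R \<in> trace_class \<Longrightarrow> \<Phi> (T + R) = \<Phi> T + \<Phi> R"
  and stochastic_scaleC: "T \<in> trace_class \<Longrightarrow> \<Phi> (c *\<^sub>C T) = c *\<^sub>C \<Phi> T"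
  and stochastic_positive: "T \<in> trace_class \<Longrightarrow> positive_op T \<Longrightarrow> positive_op (\<Phi> T)"
  and stochastic_trace: "T \<in> trace_class \<Longrightarrow> trace_op (\<Phi> T) = trace_op T"
  using sto by (auto simp: stochastic_map_def)

lemma stochastic_scaleR: "T \<in> trace_class \<Longrightarrow> \<Phi> (r *\<^sub>R T) = r *\<^sub>R \<Phi> T"
  by (metis scaleC_of_real stochastic_scaleC)

lemma stochastic_0: "\<Phi> 0 = 0"
  using stochastic_scaleR[of 0 0] by simp

lemma stochastic_diff: "T \<in> trace_class \<Longrightarrow> R \<in> trace_class \<Longrightarrow> \<Phi> (T - R) = \<Phi> T - \<Phi> R"
  using stochastic_add[of "T - R" R] by simp

lemma stochastic_sum: "(\<And>i. i \<in> F \<Longrightarrow> f i \<in> trace_class) \<Longrightarrow> \<Phi> (sum f F) = (\<Sum>i\<in>F. \<Phi> (f i))"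
  by (induction F rule: infinite_finite_induct) (auto simp: stochastic_0 stochastic_add)

text \<open>On positive operators the trace norm is the trace, which is preserved, and every trace class
  operator is a combination of four positive ones of no larger trace norm.\<close>

lemma stochastic_trace_norm_le:
  assumes T: "T \<in> trace_class"
  shows "trace_norm (\<Phi> T) \<le> 4 * trace_norm T"
proof -
  obtain P where P: "\<And>k. positive_op (P k)" "\<And>k. P k \<in> trace_class"
    "\<And>k. trace_norm (P k) \<le> trace_norm T" "T = (\<Sum>k<4::nat. \<i> ^ k *\<^sub>C P k)"
    using positive_decomposition[OF T] by blast
  have eq: "trace_norm (\<Phi> (P k)) = trace_norm (P k)" for k
    using stochastic_trace[OF P(2)] trace_positive[OF P(1,2)]
      trace_positive[OF stochastic_positive[OF P(2,1)] stochastic_trace_class[OF P(2)]]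
    by (metis of_real_eq_iff)
  have "\<Phi> T = (\<Sum>k<4::nat. \<i> ^ k *\<^sub>C \<Phi> (P k))"
    by (subst P(4)) (simp add: stochastic_sum stochastic_scaleC P(2))
  then have "trace_norm (\<Phi> T) \<le> (\<Sum>k<4::nat. trace_norm (\<i> ^ k *\<^sub>C \<Phi> (P k)))"
    by (simp only:) (rule trace_norm_sum_le, simp add: P(2))
  also have "\<dots> \<le> (\<Sum>k<4::nat. trace_norm T)"
  proof (rule sum_mono)
    fix k
    have "trace_norm (\<i> ^ k *\<^sub>C \<Phi> (P k)) \<le> cmod (\<i> ^ k) * trace_norm (\<Phi> (P k))"
      by (rule trace_norm_scaleC_le) (simp add: P(2))
    then show "trace_norm (\<i> ^ k *\<^sub>C \<Phi> (P k)) \<le> trace_norm T" using P(3)[of k] by (simp add: norm_power eq)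
  qed
  finally show ?thesis by simp
qed

text \<open>The values on rank one operators form a bounded sesquilinear form, which determines \<open>R\<close>; both
  sides are continuous in trace norm and finite rank operators are dense.\<close>

lemma dual_map_exists:
  assumes S: "S \<in> bounded_ops"
  obtains R where "R \<in> bounded_ops" "\<And>T. T \<in> trace_class \<Longrightarrow> trace_op (\<Phi> T o\<^sub>L S) = trace_op (T o\<^sub>L R)"
proof -
  define B where "B x y = trace_op (\<Phi> (rank_one y x) o\<^sub>L S)" for x y
  obtain R where R: "R \<in> bounded_ops" "\<And>x y. B x y = cinner x (R y)"
  proof (rule bounded_form_represented)
    show "B (x + y) z = B x z + B y z" for x y z
      by (simp add: B_def rank_one_add_right stochastic_add blinfun_compose.add_left trace_op_add S)
    show "B x (y + z) = B x y + B x z" for x y z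
      by (simp add: B_def rank_one_add_left stochastic_add blinfun_compose.add_left trace_op_add S)
    show "B (c *\<^sub>C x) y = cnj c * B x y" for c x y
      by (simp add: B_def rank_one_scaleC_right stochastic_scaleC scaleC_compose_left trace_op_scaleC S)
    show "B x (c *\<^sub>C y) = c * B x y" for c x y
      by (simp add: B_def rank_one_scaleC_left stochastic_scaleC scaleC_compose_left trace_op_scaleC S)
    show "cmod (B x y) \<le> (4 * norm S) * norm x * norm y" for x y
    proof -
      have "cmod (B x y) \<le> trace_norm (\<Phi> (rank_one y x)) * norm S"
        unfolding B_def by (rule cmod_trace_compose_le) (simp_all add: S)
      also have "\<dots> \<le> (4 * (norm y * norm x)) * norm S"
        using stochastic_trace_norm_le[of "rank_one y x"] trace_norm_rank_one[of y x]
        by (intro mult_right_mono) auto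
      finally show ?thesis by (simp add: mult_ac)
    qed
  qed blast
  have rank1: "trace_op (\<Phi> (rank_one y x) o\<^sub>L S) = trace_op (rank_one y x o\<^sub>L R)" for x y
    using R(2)[of x y] by (simp add: B_def trace_rank_one_compose R(1))
  have "trace_op (\<Phi> T o\<^sub>L S) = trace_op (T o\<^sub>L R)" if T: "T \<in> trace_class" for T
  proof -
    have "cmod (trace_op (\<Phi> T o\<^sub>L S) - trace_op (T o\<^sub>L R)) \<le> 0 + d" if d: "d > 0" for d
    proof -
      define c where "c = 4 * norm S + norm R + 1"
      have c: "c > 0" by (simp add: c_def add_nonneg_pos)
      obtain F x y where F: "finite (F :: 'a set)" "trace_norm (T - (\<Sum>i\<in>F. rank_one (x i) (y i))) < d / c"
        using finite_rank_approximation[OF T, of "d / c"] d c by auto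
      define G where "G = (\<Sum>i\<in>F. rank_one (x i) (y i))"
      have G: "G \<in> trace_class" by (simp add: G_def)
      have "trace_op (\<Phi> G o\<^sub>L S) = trace_op (G o\<^sub>L R)"
        by (simp add: G_def stochastic_sum blinfun_compose.sum_left trace_op_sum S R(1) rank1)
      then have "trace_op (\<Phi> T o\<^sub>L S) - trace_op (T o\<^sub>L R)
          = trace_op (\<Phi> (T - G) o\<^sub>L S) - trace_op ((T - G) o\<^sub>L R)"
        by (simp add: stochastic_diff T G blinfun_compose.diff_left trace_op_diff S R(1))
      also have "cmod \<dots> \<le> cmod (trace_op (\<Phi> (T - G) o\<^sub>L S)) + cmod (trace_op ((T - G) o\<^sub>L R))"
        by (rule norm_triangle_ineq4)
      also have "\<dots> \<le> trace_norm (\<Phi> (T - G)) * norm S + trace_norm (T - G) * norm R"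
        by (intro add_mono cmod_trace_compose_le) (simp_all add: T G S R(1))
      also have "\<dots> \<le> 4 * trace_norm (T - G) * norm S + trace_norm (T - G) * norm R"
        by (intro add_mono mult_right_mono stochastic_trace_norm_le) (simp_all add: T G)
      also have "\<dots> \<le> c * trace_norm (T - G)"
        using trace_norm_nonneg[OF trace_class_diff[OF T G]] by (simp add: c_def algebra_simps)
      also have "\<dots> \<le> d" using F(2) c by (simp add: G_def[symmetric] field_simps)
      finally show ?thesis by simp
    qed
    then have "cmod (trace_op (\<Phi> T o\<^sub>L S) - trace_op (T o\<^sub>L R)) \<le> 0" by (rule field_le_epsilon)
    then show ?thesis by simp
  qed
  then show thesis using that R(1) by blast
qed

lemma dual_map_works:
  assumes S: "S \<in> bounded_ops"
  shows dual_map_bounded: "dual_map \<Phi> S \<in> bounded_ops"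
    and trace_dual_map: "T \<in> trace_class \<Longrightarrow> trace_op (T o\<^sub>L dual_map \<Phi> S) = trace_op (\<Phi> T o\<^sub>L S)"
proof -
  obtain R where R: "R \<in> bounded_ops" "\<And>T. T \<in> trace_class \<Longrightarrow> trace_op (\<Phi> T o\<^sub>L S) = trace_op (T o\<^sub>L R)"
    by (rule dual_map_exists[OF S]) blast
  have "dual_map \<Phi> S = R"
    unfolding dual_map_def
  proof (rule the_equality)
    fix R' assume R': "R' \<in> bounded_ops \<and> (\<forall>T\<in>trace_class. trace_op (\<Phi> T o\<^sub>L S) = trace_op (T o\<^sub>L R'))"
    then show "R' = R" using R by (intro trace_separates_bounded) auto
  qed (use R in blast)
  then show "dual_map \<Phi> S \<in> bounded_ops"
    "T \<in> trace_class \<Longrightarrow> trace_op (T o\<^sub>L dual_map \<Phi> S) = trace_op (\<Phi> T o\<^sub>L S)"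
    using R by auto
qed

lemma dual_map_eqI:
  assumes "S \<in> bounded_ops" "R \<in> bounded_ops"
    "\<And>T. T \<in> trace_class \<Longrightarrow> trace_op (\<Phi> T o\<^sub>L S) = trace_op (T o\<^sub>L R)"
  shows "dual_map \<Phi> S = R"
  using assms by (intro trace_separates_bounded) (simp_all add: dual_map_bounded trace_dual_map)

lemma dual_map_unital_positive: "unital_positive_map (dual_map \<Phi>)"
  unfolding unital_positive_map_def
proof (intro conjI ballI allI impI)
  fix S R :: "'a op" and c
  assume S: "S \<in> bounded_ops"
  show "dual_map \<Phi> S \<in> bounded_ops" by (rule dual_map_bounded[OF S])
  show "dual_map \<Phi> (c *\<^sub>C S) = c *\<^sub>C dual_map \<Phi> S"
    using S by (intro dual_map_eqI)
      (simp_all add: dual_map_bounded scaleC_compose_right trace_class_bounded trace_op_scaleC trace_dual_map)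
  assume R: "R \<in> bounded_ops"
  show "dual_map \<Phi> (S + R) = dual_map \<Phi> S + dual_map \<Phi> R"
    using S R by (intro dual_map_eqI)
      (simp_all add: dual_map_bounded blinfun_compose.add_right trace_op_add trace_dual_map)
next
  fix S :: "'a op" assume S: "positive_op S"
  have Sb: "S \<in> bounded_ops" using S by (rule positive_bounded)
  have "cinner x (dual_map \<Phi> S x) = trace_op (\<Phi> (rank_one x x) o\<^sub>L S)" for x
    using trace_dual_map[OF Sb trace_class_rank_one, of x x]
    by (simp add: trace_rank_one_compose dual_map_bounded Sb)
  moreover have "trace_op (\<Phi> (rank_one x x) o\<^sub>L S) \<in> \<real>\<^sub>\<ge>\<^sub>0" for x
    by (intro trace_positive_product stochastic_positive positive_rank_one S) simp_all
  ultimately show "positive_op (dual_map \<Phi> S)" by (simp add: positive_op_def dual_map_bounded Sb)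
next
  show "dual_map \<Phi> id_blinfun = id_blinfun" by (intro dual_map_eqI) (simp_all add: stochastic_trace)
qed

end

declare stochastic_trace_class [simp del]


section \<open>Limits in trace norm\<close>

lemma conj_by_bounded [simp]: "B \<in> bounded_ops \<Longrightarrow> S \<in> bounded_ops \<Longrightarrow> conj_by B S \<in> bounded_ops"
  by (simp add: conj_by_def)

lemma conj_by_trace_class [simp]: "B \<in> bounded_ops \<Longrightarrow> T \<in> trace_class \<Longrightarrow> conj_by B T \<in> trace_class"
  by (simp add: conj_by_def)

lemma conj_by_diff: "conj_by B (S - T) = conj_by B S - conj_by B T"
  by (simp add: conj_by_def blinfun_compose.diff_left blinfun_compose.diff_right)

lemma conj_by_scaleR: "conj_by B (r *\<^sub>R S) = r *\<^sub>R conj_by B S"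
  by (simp add: conj_by_def blinfun_compose.scaleR_left blinfun_compose.scaleR_right)

lemma trace_norm_tendsto_trace:
  assumes lim: "trace_norm_tendsto f L F" and f: "\<forall>\<^sub>F t in F. f t \<in> trace_class"
    and L: "L \<in> trace_class" and S: "S \<in> bounded_ops"
  shows "((\<lambda>t. trace_op (f t o\<^sub>L S)) \<longlongrightarrow> trace_op (L o\<^sub>L S)) F"
proof -
  have "((\<lambda>t. trace_op (f t o\<^sub>L S) - trace_op (L o\<^sub>L S)) \<longlongrightarrow> 0) F"
  proof (rule tendsto_0_le[OF lim[unfolded trace_norm_tendsto_def]])
    show "\<forall>\<^sub>F t in F. norm (trace_op (f t o\<^sub>L S) - trace_op (L o\<^sub>L S)) \<le> norm (trace_norm (f t - L)) * norm S"
      using f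
    proof eventually_elim
      case (elim t)
      have "trace_op (f t o\<^sub>L S) - trace_op (L o\<^sub>L S) = trace_op ((f t - L) o\<^sub>L S)"
        using elim L S by (simp add: blinfun_compose.diff_left trace_op_diff)
      then show ?case
        using cmod_trace_compose_le[OF trace_class_diff[OF elim L] S]
          trace_norm_nonneg[OF trace_class_diff[OF elim L]] by simp
    qed
  qed
  then show ?thesis by (rule LIM_zero_cancel)
qed

lemma trace_norm_tendsto_unique:
  fixes L K :: "'a::chilbert_space op"
  assumes "trace_norm_tendsto f L F" "trace_norm_tendsto f K F"
    and f: "\<forall>\<^sub>F t in F. f t \<in> trace_class" and L: "L \<in> trace_class" and K: "K \<in> trace_class"
    and F: "F \<noteq> bot"
  shows "L = K"
proof (rule trace_separates_trace_class[OF L K])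
  fix T :: "'a op" assume T: "T \<in> bounded_ops"
  show "trace_op (L o\<^sub>L T) = trace_op (K o\<^sub>L T)"
    by (rule tendsto_unique[OF F trace_norm_tendsto_trace[OF assms(1) f L T]
          trace_norm_tendsto_trace[OF assms(2) f K T]])
qed

text \<open>For use with \<open>g t - K\<close> the image of \<open>f t - L\<close> under a conjugation or a stochastic map.\<close>

lemma trace_norm_tendsto_image:
  assumes lim: "trace_norm_tendsto f L F"
    and le: "\<forall>\<^sub>F t in F. 0 \<le> trace_norm (g t - K) \<and> trace_norm (g t - K) \<le> c * trace_norm (f t - L)"
  shows "trace_norm_tendsto g K F"
  unfolding trace_norm_tendsto_def
proof (rule tendsto_sandwich[of "\<lambda>_. 0" _ F "\<lambda>t. c * trace_norm (f t - L)"])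
  have "((\<lambda>t. c * trace_norm (f t - L)) \<longlongrightarrow> c * 0) F"
    using lim unfolding trace_norm_tendsto_def by (intro tendsto_mult_left)
  then show "((\<lambda>t. c * trace_norm (f t - L)) \<longlongrightarrow> 0) F" by simp
qed (use le in \<open>auto elim: eventually_mono\<close>)

lemma trace_norm_conj_le:
  assumes "T \<in> trace_class" "B \<in> bounded_ops"
  shows "trace_norm (conj_by B T) \<le> (norm B)\<^sup>2 * trace_norm T"
  using trace_norm_ideal[OF assms assms(2)] by (simp add: conj_by_def power2_eq_square mult_ac)


section \<open>The trace class as a Banach space\<close>

text \<open>As a Banach space type the trace class supports the integrals of continuous functions with which
  elements of the domain of a generator are made.\<close>

typedef (overloaded) 'a tc = "trace_class :: 'a::chilbert_space op set"
  morphisms op_of_tc tc_of_op by (rule exI[of _ 0]) simp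

setup_lifting type_definition_tc

lemma op_of_tc_trace_class [simp]: "op_of_tc T \<in> trace_class"
  by (rule op_of_tc)

instantiation tc :: (chilbert_space) real_normed_vector
begin

lift_definition zero_tc :: "'a tc" is 0 by simp
lift_definition plus_tc :: "'a tc \<Rightarrow> 'a tc \<Rightarrow> 'a tc" is "(+)" by simp
lift_definition minus_tc :: "'a tc \<Rightarrow> 'a tc \<Rightarrow> 'a tc" is "(-)" by simp
lift_definition uminus_tc :: "'a tc \<Rightarrow> 'a tc" is uminus by simp
lift_definition scaleR_tc :: "real \<Rightarrow> 'a tc \<Rightarrow> 'a tc" is "(*\<^sub>R)" by simp
lift_definition norm_tc :: "'a tc \<Rightarrow> real" is trace_norm .
definition dist_tc :: "'a tc \<Rightarrow> 'a tc \<Rightarrow> real" where "dist_tc T S = norm (T - S)"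
definition sgn_tc :: "'a tc \<Rightarrow> 'a tc" where "sgn_tc T = scaleR (inverse (norm T)) T"
definition uniformity_tc :: "('a tc \<times> 'a tc) filter"
  where "uniformity_tc = (INF e\<in>{0<..}. principal {(x, y). dist x y < e})"
definition open_tc :: "'a tc set \<Rightarrow> bool"
  where "open_tc U \<longleftrightarrow> (\<forall>x\<in>U. eventually (\<lambda>(x', y). x' = x \<longrightarrow> y \<in> U) uniformity)"

instance
proof
  fix x y z :: "'a tc" and a b :: real and U :: "'a tc set"
  show "x + y + z = x + (y + z)" by transfer simp
  show "x + y = y + x" by transfer simp
  show "0 + x = x" by transfer simp
  show "- x + x = 0" by transfer simp
  show "x - y = x + - y" by transfer simp
  show "a *\<^sub>R (x + y) = a *\<^sub>R x + a *\<^sub>R y" by transfer (simp add: scaleR_add_right)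
  show "(a + b) *\<^sub>R x = a *\<^sub>R x + b *\<^sub>R x" by transfer (simp add: scaleR_add_left)
  show "a *\<^sub>R b *\<^sub>R x = (a * b) *\<^sub>R x" by transfer simp
  show "1 *\<^sub>R x = x" by transfer simp
  show "dist x y = norm (x - y)" by (rule dist_tc_def)
  show "sgn x = scaleR (inverse (norm x)) x" by (rule sgn_tc_def)
  show "uniformity = (INF e\<in>{0<..}. principal {(x, y). dist (x :: 'a tc) y < e})"
    by (rule uniformity_tc_def)
  show "open U = (\<forall>x\<in>U. \<forall>\<^sub>F (x', y) in uniformity. x' = x \<longrightarrow> y \<in> U)" by (rule open_tc_def)
  show "norm x = 0 \<longleftrightarrow> x = 0" by transfer (auto simp: trace_norm_eq_0)
  show "norm (x + y) \<le> norm x + norm y" by transfer (rule trace_norm_triangle)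
  show "norm (a *\<^sub>R x) = \<bar>a\<bar> * norm x" by transfer (rule trace_norm_scaleR)
qed

end

instance tc :: (chilbert_space) banach
proof
  fix X :: "nat \<Rightarrow> 'a tc" assume X: "Cauchy X"
  have "\<exists>N. \<forall>m\<ge>N. \<forall>n\<ge>N. trace_norm (op_of_tc (X m) - op_of_tc (X n)) < e" if "e > 0" for e
    using X that unfolding Cauchy_def dist_norm norm_tc.rep_eq minus_tc.rep_eq by blast
  then obtain L where L: "L \<in> trace_class" "(\<lambda>n. trace_norm (op_of_tc (X n) - L)) \<longlonglongrightarrow> 0"
    using trace_class_complete[of "\<lambda>n. op_of_tc (X n)", OF op_of_tc_trace_class] by blast
  have "norm (X n - tc_of_op L) = trace_norm (op_of_tc (X n) - L)" for n
    by (simp add: norm_tc.rep_eq minus_tc.rep_eq tc_of_op_inverse L(1))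
  then have "(\<lambda>n. norm (X n - tc_of_op L)) \<longlonglongrightarrow> 0" by (simp only: L(2))
  then have "(\<lambda>n. X n - tc_of_op L) \<longlonglongrightarrow> 0" by (rule tendsto_norm_zero_cancel)
  then have "X \<longlonglongrightarrow> tc_of_op L" by (rule LIM_zero_cancel)
  then show "convergent X" by (rule convergentI)
qed


section \<open>The weak-star generator and conjugation\<close>

lemma wstar_generatorI:
  fixes \<Theta> :: "real \<Rightarrow> 'a::chilbert_space op \<Rightarrow> 'a op"
  assumes S: "S \<in> bounded_ops" and L: "L \<in> bounded_ops"
    and lim: "wstar_tendsto (\<lambda>t. (\<Theta> t S - S) /\<^sub>R t) L (at_right 0)"
  shows "S \<in> wstar_generator_dom \<Theta>" and "wstar_generator \<Theta> S = L"
proof -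
  show "S \<in> wstar_generator_dom \<Theta>" using assms by (auto simp: wstar_generator_dom_def)
  show "wstar_generator \<Theta> S = L"
    unfolding wstar_generator_def
  proof (rule the_equality)
    fix K assume K: "K \<in> bounded_ops \<and> wstar_tendsto (\<lambda>t. (\<Theta> t S - S) /\<^sub>R t) K (at_right 0)"
    show "K = L"
    proof (rule trace_separates_bounded)
      fix T :: "'a op" assume "T \<in> trace_class"
      then show "trace_op (T o\<^sub>L K) = trace_op (T o\<^sub>L L)"
        using K lim unfolding wstar_tendsto_def
        by (intro tendsto_unique[OF trivial_limit_at_right_real]) blast+
    qed (use K L in simp_all)
  qed (use L lim in simp)
qed

lemma wstar_generatorD:
  fixes \<Theta> :: "real \<Rightarrow> 'a::chilbert_space op \<Rightarrow> 'a op"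
  assumes "S \<in> wstar_generator_dom \<Theta>"
  shows "S \<in> bounded_ops" "wstar_generator \<Theta> S \<in> bounded_ops"
    "wstar_tendsto (\<lambda>t. (\<Theta> t S - S) /\<^sub>R t) (wstar_generator \<Theta> S) (at_right 0)"
proof -
  obtain L where L: "S \<in> bounded_ops" "L \<in> bounded_ops"
    "wstar_tendsto (\<lambda>t. (\<Theta> t S - S) /\<^sub>R t) L (at_right 0)"
    using assms by (auto simp: wstar_generator_dom_def)
  with wstar_generatorI(2)[where \<Theta> = \<Theta>, OF L] show "S \<in> bounded_ops" "wstar_generator \<Theta> S \<in> bounded_ops"
    "wstar_tendsto (\<lambda>t. (\<Theta> t S - S) /\<^sub>R t) (wstar_generator \<Theta> S) (at_right 0)" by simp_all
qed

lemma conj_sqrt_id: "positive_op A \<Longrightarrow> conj_by (sqrt_op A) id_blinfun = A"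
  by (simp add: conj_by_def sqrt_square)

lemma conj_sqrt_self:
  assumes "positive_op A" shows "conj_by (sqrt_op A) A = A o\<^sub>L A"
proof -
  have "conj_by (sqrt_op A) (sqrt_op A o\<^sub>L sqrt_op A) = (sqrt_op A o\<^sub>L sqrt_op A) o\<^sub>L (sqrt_op A o\<^sub>L sqrt_op A)"
    by (simp add: conj_by_def op_assoc)
  then show ?thesis by (simp add: sqrt_square assms)
qed

text \<open>Conjugation is weak-star continuous, because under the trace pairing it moves to the trace class
  argument.\<close>

lemma dual_commute_imp_wstar_generator_commute:
  fixes \<Theta> :: "real \<Rightarrow> 'a::chilbert_space op \<Rightarrow> 'a op"
  assumes comm: "\<And>t S. t \<ge> 0 \<Longrightarrow> S \<in> bounded_ops \<Longrightarrow> conj_by B (\<Theta> t S) = \<Theta> t (conj_by B S)"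
    and Bb: "B \<in> bounded_ops"
    and bdd: "\<And>t S. t \<ge> 0 \<Longrightarrow> S \<in> bounded_ops \<Longrightarrow> \<Theta> t S \<in> bounded_ops"
    and S: "S \<in> wstar_generator_dom \<Theta>"
  shows "conj_by B S \<in> wstar_generator_dom \<Theta>"
    "wstar_generator \<Theta> (conj_by B S) = conj_by B (wstar_generator \<Theta> S)"
proof -
  note D = wstar_generatorD[OF S]
  have lim: "wstar_tendsto (\<lambda>t. (\<Theta> t (conj_by B S) - conj_by B S) /\<^sub>R t) (conj_by B (wstar_generator \<Theta> S)) (at_right 0)"
    unfolding wstar_tendsto_def
  proof
    fix T :: "'a op" assume T: "T \<in> trace_class"
    have "((\<lambda>t. trace_op (conj_by B T o\<^sub>L ((\<Theta> t S - S) /\<^sub>R t)))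
        \<longlongrightarrow> trace_op (conj_by B T o\<^sub>L wstar_generator \<Theta> S)) (at_right 0)"
      using D(3) T Bb unfolding wstar_tendsto_def by simp
    moreover have "\<forall>\<^sub>F t in at_right 0. trace_op (conj_by B T o\<^sub>L ((\<Theta> t S - S) /\<^sub>R t))
        = trace_op (T o\<^sub>L ((\<Theta> t (conj_by B S) - conj_by B S) /\<^sub>R t))"
      using eventually_at_right_less[of "0 :: real"]
      by eventually_elim
        (simp add: trace_op_conj T Bb bdd D(1) conj_by_diff conj_by_scaleR comm)
    ultimately show "((\<lambda>t. trace_op (T o\<^sub>L ((\<Theta> t (conj_by B S) - conj_by B S) /\<^sub>R t)))
        \<longlongrightarrow> trace_op (T o\<^sub>L conj_by B (wstar_generator \<Theta> S))) (at_right 0)"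
      unfolding trace_op_conj[OF T D(2) Bb] by (simp add: tendsto_cong)
  qed
  show "conj_by B S \<in> wstar_generator_dom \<Theta>"
    "wstar_generator \<Theta> (conj_by B S) = conj_by B (wstar_generator \<Theta> S)"
    using D Bb by (intro wstar_generatorI[where \<Theta> = \<Theta>, OF _ _ lim]; simp)+
qed


section \<open>Stochastic semigroups\<close>

text \<open>Consider the last point up to \<open>t\<close> at which the increment from \<open>f 0\<close> is below a line of small
  positive slope.  It cannot lie before \<open>t\<close>, because to the right of it the function moves more slowly
  than the line.\<close>

lemma right_derivative_zero_constant:
  fixes f :: "real \<Rightarrow> 'b::real_normed_vector"
  assumes cont: "continuous_on {0..} f"
    and deriv: "\<And>t. t \<ge> 0 \<Longrightarrow> ((\<lambda>h. (f (t + h) - f t) /\<^sub>R h) \<longlongrightarrow> 0) (at_right 0)"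
    and t: "t \<ge> 0"
  shows "f t = f 0"
proof -
  have "norm (f t - f 0) \<le> 0 + e" if e: "e > 0" for e
  proof (rule ccontr)
    assume "\<not> norm (f t - f 0) \<le> 0 + e"
    then have far: "norm (f t - f 0) > e" by simp
    \<comment> \<open>At \<open>t\<close> the line of slope \<open>d\<close> is still at most \<open>e\<close>.\<close>
    define d where "d = e / (t + 1)"
    have d: "d > 0" using e t by (simp add: d_def)
    have dt: "d * t \<le> e" using e t by (simp add: d_def field_simps)
    define Z where "Z = {u \<in> {0..t}. norm (f u - f 0) \<le> d * u}"
    have "continuous_on {0..t} f" using cont by (rule continuous_on_subset) auto
    then have closed: "closed Z" unfolding Z_def
      by (intro continuous_on_closed_Collect_le continuous_intros) auto
    have "{0..t} \<inter> Z = Z" by (auto simp: Z_def)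
    then have "compact Z" using compact_Int_closed[OF compact_Icc closed, of 0 t] by simp
    moreover have "Z \<noteq> {}" using t by (force simp: Z_def)
    ultimately obtain z where z: "z \<in> Z" "\<forall>u\<in>Z. u \<le> z"
      using compact_attains_sup[of Z] by blast
    have zt: "0 \<le> z" "z < t" "norm (f z - f 0) \<le> d * z"
      using z(1) far dt by (auto simp: Z_def less_le)
    have "\<forall>\<^sub>F h in at_right 0. norm ((f (z + h) - f z) /\<^sub>R h) < d"
      using deriv[OF zt(1)] d unfolding tendsto_iff by simp
    moreover have "\<forall>\<^sub>F h in at_right 0. 0 < h \<and> h < t - z"
      using eventually_at_right_real[of 0 "t - z"] zt(2) by (auto elim: eventually_mono)
    ultimately have "\<forall>\<^sub>F h in at_right 0. 0 < h \<and> h < t - z \<and> norm ((f (z + h) - f z) /\<^sub>R h) < d"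
      by eventually_elim simp
    then obtain h where h: "0 < h" "h < t - z" "norm ((f (z + h) - f z) /\<^sub>R h) < d"
      using eventually_happens'[OF trivial_limit_at_right_real] by blast
    have "norm (f (z + h) - f z) \<le> d * h"
      using h(1,3) unfolding norm_scaleR by (simp add: field_simps)
    moreover have "norm (f (z + h) - f 0) \<le> norm (f (z + h) - f z) + norm (f z - f 0)"
      using norm_triangle_ineq[of "f (z + h) - f z" "f z - f 0"] by simp
    ultimately have "norm (f (z + h) - f 0) \<le> d * (z + h)"
      using zt(3) by (simp add: algebra_simps)
    then have "z + h \<in> Z" using zt h by (simp add: Z_def)
    then show False using z(2) h(1) by force
  qed
  then have "norm (f t - f 0) \<le> 0" by (rule field_le_epsilon)
  then show ?thesis by simp
qed

context
  fixes \<Psi> :: "real \<Rightarrow> 'a::chilbert_space op \<Rightarrow> 'a op"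
  assumes sg: "stochastic_semigroup \<Psi>"
begin

lemma semigroup_stochastic: "t \<ge> 0 \<Longrightarrow> stochastic_map (\<Psi> t)"
  and semigroup_add: "s \<ge> 0 \<Longrightarrow> t \<ge> 0 \<Longrightarrow> T \<in> trace_class \<Longrightarrow> \<Psi> s (\<Psi> t T) = \<Psi> (s + t) T"
  and semigroup_0: "T \<in> trace_class \<Longrightarrow> \<Psi> 0 T = T"
  and semigroup_continuous: "T \<in> trace_class \<Longrightarrow> t \<ge> 0 \<Longrightarrow>
    trace_norm_tendsto (\<lambda>s. \<Psi> s T) (\<Psi> t T) (at t within {0..})"
  using sg unfolding stochastic_semigroup_def by auto

lemma semigroup_trace_class [simp]: "t \<ge> 0 \<Longrightarrow> T \<in> trace_class \<Longrightarrow> \<Psi> t T \<in> trace_class"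
  by (rule stochastic_trace_class[OF semigroup_stochastic])

lemma eventually_trace_class_quotient:
  assumes "T \<in> trace_class"
  shows "\<forall>\<^sub>F t in at_right 0. (\<Psi> t T - T) /\<^sub>R t \<in> trace_class"
  using eventually_at_right_less[of "0 :: real"] by eventually_elim (simp add: assms)

lemma generatorI:
  assumes T: "T \<in> trace_class" and L: "L \<in> trace_class"
    and lim: "trace_norm_tendsto (\<lambda>t. (\<Psi> t T - T) /\<^sub>R t) L (at_right 0)"
  shows "T \<in> generator_dom \<Psi>" and "generator \<Psi> T = L"
proof -
  show "T \<in> generator_dom \<Psi>" using assms by (auto simp: generator_dom_def)
  show "generator \<Psi> T = L"
    unfolding generator_def
  proof (rule the_equality)
    fix K assume K: "K \<in> trace_class \<and> trace_norm_tendsto (\<lambda>t. (\<Psi> t T - T) /\<^sub>R t) K (at_right 0)"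
    show "K = L"
      by (rule trace_norm_tendsto_unique[OF conjunct2[OF K] lim eventually_trace_class_quotient[OF T]
            conjunct1[OF K] L]) simp
  qed (use L lim in simp)
qed

lemma generatorD:
  assumes "T \<in> generator_dom \<Psi>"
  shows "T \<in> trace_class" "generator \<Psi> T \<in> trace_class"
    "trace_norm_tendsto (\<lambda>t. (\<Psi> t T - T) /\<^sub>R t) (generator \<Psi> T) (at_right 0)"
proof -
  obtain L where L: "T \<in> trace_class" "L \<in> trace_class"
    "trace_norm_tendsto (\<lambda>t. (\<Psi> t T - T) /\<^sub>R t) L (at_right 0)"
    using assms by (auto simp: generator_dom_def)
  with generatorI(2)[OF L] show "T \<in> trace_class" "generator \<Psi> T \<in> trace_class"
    "trace_norm_tendsto (\<lambda>t. (\<Psi> t T - T) /\<^sub>R t) (generator \<Psi> T) (at_right 0)" by simp_all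
qed

lemma generator_trace_tendsto:
  assumes "T \<in> generator_dom \<Psi>" "S \<in> bounded_ops"
  shows "((\<lambda>t. trace_op (((\<Psi> t T - T) /\<^sub>R t) o\<^sub>L S)) \<longlongrightarrow> trace_op (generator \<Psi> T o\<^sub>L S)) (at_right 0)"
  using generatorD[OF assms(1)] assms(2)
  by (intro trace_norm_tendsto_trace eventually_trace_class_quotient)

text \<open>Stochastic maps preserve the trace, so all difference quotients have trace 0.\<close>

lemma trace_generator:
  assumes "T \<in> generator_dom \<Psi>"
  shows "trace_op (generator \<Psi> T) = 0"
proof -
  have "\<forall>\<^sub>F t in at_right 0. trace_op (((\<Psi> t T - T) /\<^sub>R t) o\<^sub>L id_blinfun) = 0"
    using eventually_at_right_less[of "0 :: real"]
    by eventually_elim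
      (simp add: generatorD(1)[OF assms] trace_op_scaleR trace_op_diff stochastic_trace semigroup_stochastic)
  then have "((\<lambda>t. trace_op (((\<Psi> t T - T) /\<^sub>R t) o\<^sub>L id_blinfun)) \<longlongrightarrow> 0) (at_right 0)"
    by (rule tendsto_eventually)
  then show ?thesis
    using generator_trace_tendsto[OF assms bounded_ops_id] tendsto_unique[OF trivial_limit_at_right_real]
    by fastforce
qed

lemma semigroup_generator_dom:
  assumes T: "T \<in> generator_dom \<Psi>" and s: "s \<ge> 0"
  shows "\<Psi> s T \<in> generator_dom \<Psi>"
proof (rule generatorI(1)[OF _ _ trace_norm_tendsto_image[OF generatorD(3)[OF T]]])
  note tc = generatorD(1,2)[OF T]
  show "\<Psi> s T \<in> trace_class" "\<Psi> s (generator \<Psi> T) \<in> trace_class" using s tc by simp_all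
  show "\<forall>\<^sub>F t in at_right 0. 0 \<le> trace_norm ((\<Psi> t (\<Psi> s T) - \<Psi> s T) /\<^sub>R t - \<Psi> s (generator \<Psi> T)) \<and>
    trace_norm ((\<Psi> t (\<Psi> s T) - \<Psi> s T) /\<^sub>R t - \<Psi> s (generator \<Psi> T))
      \<le> 4 * trace_norm ((\<Psi> t T - T) /\<^sub>R t - generator \<Psi> T)"
    using eventually_at_right_less[of "0 :: real"]
  proof eventually_elim
    case (elim t)
    note sto = semigroup_stochastic[OF s]
    have "\<Psi> t (\<Psi> s T) = \<Psi> s (\<Psi> t T)" using elim s tc by (simp add: semigroup_add add.commute)
    then have "(\<Psi> t (\<Psi> s T) - \<Psi> s T) /\<^sub>R t - \<Psi> s (generator \<Psi> T)
        = \<Psi> s ((\<Psi> t T - T) /\<^sub>R t - generator \<Psi> T)"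
      using elim s tc by (simp add: stochastic_diff[OF sto] stochastic_scaleR[OF sto])
    then show ?case
      using elim s tc by (simp add: stochastic_trace_norm_le[OF sto] trace_norm_nonneg)
  qed
qed

lemma trace_dual_quotient:
  assumes "t \<ge> 0" "T \<in> trace_class" "S \<in> bounded_ops"
  shows "trace_op (T o\<^sub>L ((dual_map (\<Psi> t) S - S) /\<^sub>R t)) = trace_op (((\<Psi> t T - T) /\<^sub>R t) o\<^sub>L S)"
  using assms
  by (simp add: blinfun_compose.scaleR_left blinfun_compose.scaleR_right blinfun_compose.diff_left
      blinfun_compose.diff_right trace_op_scaleR trace_op_diff dual_map_bounded trace_dual_map
      semigroup_stochastic)

text \<open>By the semigroup law the traces in the assumption are the right difference quotients of
  \<open>s \<mapsto> tr (\<Psi>\<^sub>s T S)\<close> at \<open>s\<close>.\<close>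

lemma orbit_trace_constant:
  assumes T: "T \<in> trace_class" and S: "S \<in> bounded_ops" and t: "t \<ge> 0"
    and deriv: "\<And>s. s \<ge> 0 \<Longrightarrow>
      ((\<lambda>h. trace_op (((\<Psi> h (\<Psi> s T) - \<Psi> s T) /\<^sub>R h) o\<^sub>L S)) \<longlongrightarrow> 0) (at_right 0)"
  shows "trace_op (\<Psi> t T o\<^sub>L S) = trace_op (T o\<^sub>L S)"
proof -
  have "trace_op (\<Psi> t T o\<^sub>L S) = trace_op (\<Psi> 0 T o\<^sub>L S)"
  proof (rule right_derivative_zero_constant[OF _ _ t])
    show "continuous_on {0..} (\<lambda>t. trace_op (\<Psi> t T o\<^sub>L S))"
      unfolding continuous_on_def
      by (intro ballI trace_norm_tendsto_trace semigroup_continuous T S)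
        (auto simp: eventually_at_filter T)
    fix s :: real assume s: "s \<ge> 0"
    have "\<forall>\<^sub>F h in at_right 0. trace_op (((\<Psi> h (\<Psi> s T) - \<Psi> s T) /\<^sub>R h) o\<^sub>L S)
        = (trace_op (\<Psi> (s + h) T o\<^sub>L S) - trace_op (\<Psi> s T o\<^sub>L S)) /\<^sub>R h"
      using eventually_at_right_less[of "0 :: real"]
    proof eventually_elim
      case (elim h)
      have "\<Psi> (s + h) T = \<Psi> h (\<Psi> s T)" using elim s T by (simp add: semigroup_add add.commute)
      then show ?case
        using elim s T S by (simp add: blinfun_compose.scaleR_left blinfun_compose.diff_left
            trace_op_scaleR trace_op_diff)
    qed
    from tendsto_cong[OF this] deriv[OF s]
    show "((\<lambda>h. (trace_op (\<Psi> (s + h) T o\<^sub>L S) - trace_op (\<Psi> s T o\<^sub>L S)) /\<^sub>R h) \<longlongrightarrow> 0) (at_right 0)"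
      by simp
  qed
  then show ?thesis by (simp add: semigroup_0 T)
qed

text \<open>Testing the weak-star limit against \<open>\<Psi>\<^sub>s T\<close> gives the right derivative of \<open>s \<mapsto> tr (\<Psi>\<^sub>s T S)\<close> at every
  \<open>s\<close>.\<close>

lemma wstar_generator_kernel_fixed:
  assumes S: "S \<in> wstar_generator_dom (\<lambda>t. dual_map (\<Psi> t))"
    and ker: "wstar_generator (\<lambda>t. dual_map (\<Psi> t)) S = 0" and t: "t \<ge> 0"
  shows "dual_map (\<Psi> t) S = S"
proof (rule dual_map_eqI[OF semigroup_stochastic[OF t]])
  note D = wstar_generatorD[OF S, unfolded ker]
  show "S \<in> bounded_ops" "S \<in> bounded_ops" by (fact D(1))+
  fix T :: "'a op" assume T: "T \<in> trace_class"
  show "trace_op (\<Psi> t T o\<^sub>L S) = trace_op (T o\<^sub>L S)"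
  proof (rule orbit_trace_constant[OF T D(1) t])
    fix s :: real assume s: "s \<ge> 0"
    have "((\<lambda>h. trace_op (\<Psi> s T o\<^sub>L ((dual_map (\<Psi> h) S - S) /\<^sub>R h))) \<longlongrightarrow> 0) (at_right 0)"
      using D(3) semigroup_trace_class[OF s T] unfolding wstar_tendsto_def by fastforce
    moreover have "\<forall>\<^sub>F h in at_right 0. trace_op (\<Psi> s T o\<^sub>L ((dual_map (\<Psi> h) S - S) /\<^sub>R h))
        = trace_op (((\<Psi> h (\<Psi> s T) - \<Psi> s T) /\<^sub>R h) o\<^sub>L S)"
      using eventually_at_right_less[of "0 :: real"] by eventually_elim (simp add: trace_dual_quotient s T D(1))
    ultimately show "((\<lambda>h. trace_op (((\<Psi> h (\<Psi> s T) - \<Psi> s T) /\<^sub>R h) o\<^sub>L S)) \<longlongrightarrow> 0) (at_right 0)"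
      by (simp add: tendsto_cong)
  qed
qed


section \<open>The domain of the generator is dense\<close>

definition tc_semigroup :: "real \<Rightarrow> 'a tc \<Rightarrow> 'a tc" where
  "tc_semigroup t T = tc_of_op (\<Psi> t (op_of_tc T))"

lemma op_of_tc_semigroup: "t \<ge> 0 \<Longrightarrow> op_of_tc (tc_semigroup t T) = \<Psi> t (op_of_tc T)"
  by (simp add: tc_semigroup_def tc_of_op_inverse)

lemma bounded_linear_tc_semigroup:
  assumes t: "t \<ge> 0" shows "bounded_linear (tc_semigroup t)"
proof (rule bounded_linear_intro)
  note sto = semigroup_stochastic[OF t]
  show "tc_semigroup t (x + y) = tc_semigroup t x + tc_semigroup t y" for x y
    using t by (simp add: op_of_tc_inject[symmetric] op_of_tc_semigroup plus_tc.rep_eq stochastic_add[OF sto])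
  show "tc_semigroup t (r *\<^sub>R x) = r *\<^sub>R tc_semigroup t x" for r x
    using t by (simp add: op_of_tc_inject[symmetric] op_of_tc_semigroup scaleR_tc.rep_eq stochastic_scaleR[OF sto])
  show "norm (tc_semigroup t x) \<le> norm x * 4" for x
    using stochastic_trace_norm_le[OF sto, of "op_of_tc x"] t
    by (simp add: norm_tc.rep_eq op_of_tc_semigroup mult.commute)
qed

text \<open>The averages of the orbit of \<open>T\<close> over short intervals \<open>[0, h]\<close> are close to \<open>T\<close>.  They lie in the
  domain: with \<open>I u\<close> the integral of the orbit over \<open>[0, u]\<close>, the semigroup law gives
  \<open>\<Psi>\<^sub>r (I h) = I (r + h) - I r\<close>, and \<open>I\<close> has right derivatives.\<close>

lemma generator_dom_dense:
  assumes T: "T \<in> trace_class" and e: "e > 0"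
  obtains V where "V \<in> generator_dom \<Psi>" "trace_norm (V - T) < e"
proof -
  define f where "f s = tc_semigroup s (tc_of_op T)" for s
  have opf: "op_of_tc (f s) = \<Psi> s T" if "s \<ge> 0" for s
    using that by (simp add: f_def op_of_tc_semigroup tc_of_op_inverse T)
  have add: "tc_semigroup r (f s) = f (r + s)" if "r \<ge> 0" "s \<ge> 0" for r s
    using that by (simp add: op_of_tc_inject[symmetric] op_of_tc_semigroup opf semigroup_add T)
  have cont: "continuous_on {0..} f"
    unfolding continuous_on_def
  proof
    fix s :: real assume "s \<in> {0..}"
    then have s: "s \<ge> 0" by simp
    have "\<forall>\<^sub>F u in at s within {0..}. norm (f u - f s) = trace_norm (\<Psi> u T - \<Psi> s T)"
      using s by (auto simp: eventually_at_filter norm_tc.rep_eq minus_tc.rep_eq opf)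
    then have "((\<lambda>u. norm (f u - f s)) \<longlongrightarrow> 0) (at s within {0..})"
      using semigroup_continuous[OF T s] unfolding trace_norm_tendsto_def
      by (simp add: tendsto_cong)
    then have "((\<lambda>u. f u - f s) \<longlongrightarrow> 0) (at s within {0..})" by (rule tendsto_norm_zero_cancel)
    then show "(f \<longlongrightarrow> f s) (at s within {0..})" by (rule LIM_zero_cancel)
  qed
  have contI: "continuous_on {a..b} f" if "a \<ge> 0" for a b
    using cont by (rule continuous_on_subset) (use that in auto)
  have int: "f integrable_on {a..b}" if "a \<ge> 0" for a b
    using contI[OF that] by (rule integrable_continuous_interval[of a b, simplified])
  obtain h where h: "h > 0" "\<And>s. 0 \<le> s \<Longrightarrow> s \<le> h \<Longrightarrow> norm (f s - f 0) \<le> e / 2"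
  proof -
    have "\<exists>d>0. \<forall>s\<in>{0..}. dist s 0 < d \<longrightarrow> dist (f s) (f 0) < e / 2"
      using cont e unfolding continuous_on_iff by (metis atLeast_iff half_gt_zero order_refl)
    then obtain d where d: "d > 0" "\<And>s. s \<ge> 0 \<Longrightarrow> s < d \<Longrightarrow> norm (f s - f 0) < e / 2"
      by (auto simp: dist_norm)
    show thesis using d by (intro that[of "d / 2"]) (auto intro: less_imp_le)
  qed
  define I where "I u = integral {0..u} f" for u
  define V where "V = (1 / h) *\<^sub>R I h"
  have combine: "integral {a..b} f = I b - I a" if "0 \<le> a" "a \<le> b" for a b
    using Henstock_Kurzweil_Integration.integral_combine[OF that int[of 0 b]] by (simp add: I_def algebra_simps)
  have flow: "tc_semigroup r (I h) = I (r + h) - I r" if r: "r \<ge> 0" for r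
  proof -
    have "tc_semigroup r (I h) = integral {0..h} (tc_semigroup r \<circ> f)"
      unfolding I_def by (rule integral_linear[symmetric, OF int bounded_linear_tc_semigroup[OF r]]) simp
    also have "\<dots> = integral {0..h} (f \<circ> (+) r)"
      by (rule integral_cong) (use r in \<open>simp add: add\<close>)
    also have "\<dots> = integral {0 + r..h + r} f" by (rule integral_shift_Icc_real)
    also have "\<dots> = I (r + h) - I r" using combine[of r "h + r"] r h(1) by (simp add: add.commute)
    finally show ?thesis .
  qed
  have average: "norm ((I (a + r) - I a) /\<^sub>R r - c) \<le> b"
    if a: "a \<ge> 0" and r: "r > 0" and b: "\<And>s. a \<le> s \<Longrightarrow> s \<le> a + r \<Longrightarrow> norm (f s - c) \<le> b" for a r b c
  proof -
    have "(I (a + r) - I a) /\<^sub>R r - c = ((I (a + r) - I a) - r *\<^sub>R c) /\<^sub>R r"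
      using r by (simp add: scaleR_diff_right)
    also have "(I (a + r) - I a) - r *\<^sub>R c = integral {a..a + r} (\<lambda>s. f s - c)"
      using combine[of a "a + r"] a r
      by (simp add: Henstock_Kurzweil_Integration.integral_diff[OF int integrable_const_ivl])
    finally have eq: "(I (a + r) - I a) /\<^sub>R r - c = integral {a..a + r} (\<lambda>s. f s - c) /\<^sub>R r" .
    have "norm (integral (cbox a (a + r)) (\<lambda>s. f s - c)) \<le> b * measure lborel (cbox a (a + r))"
    proof (rule integrable_bound)
      show "0 \<le> b" using b[of a] r order_trans[OF norm_ge_zero] by auto
      show "(\<lambda>s. f s - c) integrable_on cbox a (a + r)"
        using int[OF a, of "a + r"] by (intro integrable_diff) auto
    qed (use b in auto)
    then have "norm (integral {a..a + r} (\<lambda>s. f s - c)) \<le> b * r" using r by simp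
    then show ?thesis unfolding eq using r by (simp add: field_simps)
  qed
  have near: "norm (V - f 0) \<le> e / 2"
  proof -
    have "norm ((I (0 + h) - I 0) /\<^sub>R h - f 0) \<le> e / 2"
      using h by (intro average) simp_all
    moreover have "I 0 = 0" by (simp add: I_def)
    ultimately show ?thesis by (simp add: V_def inverse_eq_divide)
  qed
  have right: "((\<lambda>r. (I (a + r) - I a) /\<^sub>R r) \<longlongrightarrow> f a) (at_right 0)" if a: "a \<ge> 0" for a
    unfolding tendsto_iff
  proof (intro allI impI)
    fix b :: real assume b: "b > 0"
    have "\<exists>d>0. \<forall>s\<in>{0..}. dist s a < d \<longrightarrow> dist (f s) (f a) < b / 2"
      using cont b a unfolding continuous_on_iff by (metis atLeast_iff half_gt_zero)
    then obtain d where d: "d > 0" "\<And>s. s \<ge> 0 \<Longrightarrow> \<bar>s - a\<bar> < d \<Longrightarrow> norm (f s - f a) < b / 2"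
      by (auto simp: dist_norm)
    have "\<forall>\<^sub>F r in at_right 0. 0 < r \<and> r < d"
      using eventually_at_right_real[of 0 d] d(1) by (auto elim: eventually_mono)
    then show "\<forall>\<^sub>F r in at_right 0. dist ((I (a + r) - I a) /\<^sub>R r) (f a) < b"
    proof eventually_elim
      case (elim r)
      have "norm ((I (a + r) - I a) /\<^sub>R r - f a) \<le> b / 2"
        using elim a by (intro average less_imp_le[OF d(2)]) auto
      then show ?case using b by (simp add: dist_norm)
    qed
  qed
  have "((\<lambda>r. (1 / h) *\<^sub>R ((I (h + r) - I h) /\<^sub>R r - (I (0 + r) - I 0) /\<^sub>R r))
      \<longlongrightarrow> (1 / h) *\<^sub>R (f h - f 0)) (at_right 0)"
    using h(1) by (intro tendsto_intros right) auto
  moreover have "\<forall>\<^sub>F r in at_right 0. (1 / h) *\<^sub>R ((I (h + r) - I h) /\<^sub>R r - (I (0 + r) - I 0) /\<^sub>R r)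
      = (tc_semigroup r V - V) /\<^sub>R r"
    using eventually_at_right_less[of "0 :: real"]
  proof eventually_elim
    case (elim r)
    have eq: "tc_semigroup r V = (1 / h) *\<^sub>R (I (h + r) - I r)"
      using flow[of r] elim linear_scale[OF bounded_linear.linear[OF bounded_linear_tc_semigroup[of r]]]
      by (simp add: V_def add.commute)
    have "I 0 = 0" by (simp add: I_def)
    then show ?case unfolding eq by (simp add: V_def algebra_simps)
  qed
  ultimately have "((\<lambda>r. (tc_semigroup r V - V) /\<^sub>R r) \<longlongrightarrow> (1 / h) *\<^sub>R (f h - f 0)) (at_right 0)"
    by (simp add: tendsto_cong)
  then have "((\<lambda>r. norm ((tc_semigroup r V - V) /\<^sub>R r - (1 / h) *\<^sub>R (f h - f 0))) \<longlongrightarrow> 0) (at_right 0)"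
    by (intro tendsto_norm_zero LIM_zero)
  moreover have "\<forall>\<^sub>F r in at_right 0. norm ((tc_semigroup r V - V) /\<^sub>R r - (1 / h) *\<^sub>R (f h - f 0))
      = trace_norm ((\<Psi> r (op_of_tc V) - op_of_tc V) /\<^sub>R r - op_of_tc ((1 / h) *\<^sub>R (f h - f 0)))"
    using eventually_at_right_less[of "0 :: real"]
    by eventually_elim (simp only: norm_tc.rep_eq minus_tc.rep_eq scaleR_tc.rep_eq op_of_tc_semigroup less_imp_le)
  ultimately have "trace_norm_tendsto (\<lambda>r. (\<Psi> r (op_of_tc V) - op_of_tc V) /\<^sub>R r)
      (op_of_tc ((1 / h) *\<^sub>R (f h - f 0))) (at_right 0)"
    unfolding trace_norm_tendsto_def by (simp add: tendsto_cong)
  then have "op_of_tc V \<in> generator_dom \<Psi>" by (intro generatorI(1)) simp_all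
  moreover have "trace_norm (op_of_tc V - T) < e"
    using near e by (simp add: norm_tc.rep_eq minus_tc.rep_eq opf semigroup_0 T)
  ultimately show thesis by (rule that)
qed

text \<open>On the domain the right derivative of \<open>s \<mapsto> tr (\<Psi>\<^sub>s T S)\<close> is the trace of the product of \<open>\<psi> (\<Psi>\<^sub>s T)\<close> and
  \<open>S\<close>, hence 0; density extends the resulting identity to all \<open>T\<close>.\<close>

lemma generator_annihilator_fixed:
  assumes S: "S \<in> bounded_ops" and t: "t \<ge> 0"
    and ann: "\<And>T. T \<in> generator_dom \<Psi> \<Longrightarrow> trace_op (generator \<Psi> T o\<^sub>L S) = 0"
  shows "dual_map (\<Psi> t) S = S"
proof (rule dual_map_eqI[OF semigroup_stochastic[OF t] S S])
  note sto = semigroup_stochastic[OF t]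
  have dom: "trace_op (\<Psi> t V o\<^sub>L S) = trace_op (V o\<^sub>L S)" if V: "V \<in> generator_dom \<Psi>" for V
  proof (rule orbit_trace_constant[OF generatorD(1)[OF V] S t])
    fix s :: real assume "s \<ge> 0"
    then have D: "\<Psi> s V \<in> generator_dom \<Psi>" by (rule semigroup_generator_dom[OF V])
    show "((\<lambda>h. trace_op (((\<Psi> h (\<Psi> s V) - \<Psi> s V) /\<^sub>R h) o\<^sub>L S)) \<longlongrightarrow> 0) (at_right 0)"
      using generator_trace_tendsto[OF D S] by (simp add: ann[OF D])
  qed
  fix T :: "'a op" assume T: "T \<in> trace_class"
  have "cmod (trace_op (\<Psi> t T o\<^sub>L S) - trace_op (T o\<^sub>L S)) \<le> 0 + d" if d: "d > 0" for d
  proof -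
    define c where "c = 5 * norm S + 1"
    have c: "c > 0" by (simp add: c_def add_nonneg_pos)
    obtain V where V: "V \<in> generator_dom \<Psi>" "trace_norm (V - T) < d / c"
      using generator_dom_dense[OF T, of "d / c"] d c by auto
    have Vt: "V \<in> trace_class" using V(1) by (rule generatorD(1))
    have D: "V - T \<in> trace_class" using Vt T by simp
    have "trace_op (\<Psi> t T o\<^sub>L S) - trace_op (T o\<^sub>L S)
        = trace_op ((V - T) o\<^sub>L S) - trace_op (\<Psi> t (V - T) o\<^sub>L S)"
      using dom[OF V(1)] t T Vt S
      by (simp add: stochastic_diff[OF sto] blinfun_compose.diff_left trace_op_diff)
    also have "cmod \<dots> \<le> cmod (trace_op ((V - T) o\<^sub>L S)) + cmod (trace_op (\<Psi> t (V - T) o\<^sub>L S))"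
      by (rule norm_triangle_ineq4)
    also have "\<dots> \<le> trace_norm (V - T) * norm S + trace_norm (\<Psi> t (V - T)) * norm S"
      by (intro add_mono cmod_trace_compose_le S) (simp_all add: Vt T t)
    also have "\<dots> \<le> trace_norm (V - T) * norm S + 4 * trace_norm (V - T) * norm S"
      by (intro add_mono mult_right_mono stochastic_trace_norm_le[OF sto] D) simp_all
    also have "\<dots> \<le> c * trace_norm (V - T)"
      using trace_norm_nonneg[OF D] by (simp add: c_def algebra_simps)
    also have "\<dots> \<le> d" using V(2) c by (simp add: field_simps)
    finally show ?thesis by simp
  qed
  then have "cmod (trace_op (\<Psi> t T o\<^sub>L S) - trace_op (T o\<^sub>L S)) \<le> 0" by (rule field_le_epsilon)
  then show "trace_op (\<Psi> t T o\<^sub>L S) = trace_op (T o\<^sub>L S)" by simp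
qed


section \<open>The equivalences\<close>

context
  fixes B :: "'a op"
  assumes Bb: "B \<in> bounded_ops"
begin

text \<open>Both \<open>\<Psi>\<^sub>t\<close> and conjugation by \<open>B\<close> move across the trace pairing, and each of the two spaces separates
  the points of the other.\<close>

lemma commute_iff_dual_commute:
  assumes t: "t \<ge> 0"
  shows "(\<forall>T\<in>trace_class. conj_by B (\<Psi> t T) = \<Psi> t (conj_by B T)) \<longleftrightarrow>
    (\<forall>S\<in>bounded_ops. conj_by B (dual_map (\<Psi> t) S) = dual_map (\<Psi> t) (conj_by B S))"
proof -
  note sto = semigroup_stochastic[OF t]
  have 1: "trace_op (conj_by B (\<Psi> t T) o\<^sub>L S) = trace_op (T o\<^sub>L dual_map (\<Psi> t) (conj_by B S))"
    if "T \<in> trace_class" "S \<in> bounded_ops" for T S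
    using that Bb t trace_op_conj[of "\<Psi> t T" S B] trace_dual_map[OF sto, of "conj_by B S" T] by simp
  have 2: "trace_op (\<Psi> t (conj_by B T) o\<^sub>L S) = trace_op (T o\<^sub>L conj_by B (dual_map (\<Psi> t) S))"
    if "T \<in> trace_class" "S \<in> bounded_ops" for T S
    using that Bb t trace_op_conj[of T "dual_map (\<Psi> t) S" B] trace_dual_map[OF sto, of S "conj_by B T"]
      dual_map_bounded[OF sto, of S] by simp
  show ?thesis
  proof (intro iffI ballI)
    fix S :: "'a op" assume "\<forall>T\<in>trace_class. conj_by B (\<Psi> t T) = \<Psi> t (conj_by B T)" and S: "S \<in> bounded_ops"
    then show "conj_by B (dual_map (\<Psi> t) S) = dual_map (\<Psi> t) (conj_by B S)"
      using Bb dual_map_bounded[OF sto] by (intro trace_separates_bounded) (auto simp flip: 1 2)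
  next
    fix T :: "'a op" assume "\<forall>S\<in>bounded_ops. conj_by B (dual_map (\<Psi> t) S) = dual_map (\<Psi> t) (conj_by B S)"
      and T: "T \<in> trace_class"
    then show "conj_by B (\<Psi> t T) = \<Psi> t (conj_by B T)"
      using Bb t by (intro trace_separates_trace_class) (simp_all add: 1 2)
  qed
qed

lemma commute_imp_generator_commute:
  assumes comm: "\<And>t T. t \<ge> 0 \<Longrightarrow> T \<in> trace_class \<Longrightarrow> conj_by B (\<Psi> t T) = \<Psi> t (conj_by B T)"
    and T: "T \<in> generator_dom \<Psi>"
  shows "conj_by B T \<in> generator_dom \<Psi>" "generator \<Psi> (conj_by B T) = conj_by B (generator \<Psi> T)"
proof -
  note D = generatorD[OF T]
  have lim: "trace_norm_tendsto (\<lambda>t. (\<Psi> t (conj_by B T) - conj_by B T) /\<^sub>R t) (conj_by B (generator \<Psi> T)) (at_right 0)"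
  proof (rule trace_norm_tendsto_image[OF D(3)])
    show "\<forall>\<^sub>F t in at_right 0.
      0 \<le> trace_norm ((\<Psi> t (conj_by B T) - conj_by B T) /\<^sub>R t - conj_by B (generator \<Psi> T)) \<and>
      trace_norm ((\<Psi> t (conj_by B T) - conj_by B T) /\<^sub>R t - conj_by B (generator \<Psi> T))
        \<le> (norm B)\<^sup>2 * trace_norm ((\<Psi> t T - T) /\<^sub>R t - generator \<Psi> T)"
      using eventually_at_right_less[of "0 :: real"]
    proof eventually_elim
      case (elim t)
      have "(\<Psi> t (conj_by B T) - conj_by B T) /\<^sub>R t - conj_by B (generator \<Psi> T)
          = conj_by B ((\<Psi> t T - T) /\<^sub>R t - generator \<Psi> T)"
        using comm[of t T] elim D(1) by (simp add: conj_by_diff conj_by_scaleR)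
      moreover have "(\<Psi> t T - T) /\<^sub>R t - generator \<Psi> T \<in> trace_class" using elim D by simp
      ultimately show ?case
        using Bb by (simp only: trace_norm_conj_le conj_by_trace_class trace_norm_nonneg simp_thms)
    qed
  qed
  show "conj_by B T \<in> generator_dom \<Psi>" "generator \<Psi> (conj_by B T) = conj_by B (generator \<Psi> T)"
    using D Bb by (intro generatorI[OF _ _ lim]; simp)+
qed

end

lemma wstar_generator_id:
  "id_blinfun \<in> wstar_generator_dom (\<lambda>t. dual_map (\<Psi> t))"
  "wstar_generator (\<lambda>t. dual_map (\<Psi> t)) id_blinfun = 0"
proof -
  have "wstar_tendsto (\<lambda>t. (dual_map (\<Psi> t) id_blinfun - id_blinfun) /\<^sub>R t) 0 (at_right 0)"
    unfolding wstar_tendsto_def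
  proof
    fix T :: "'a op"
    have "\<forall>\<^sub>F t in at_right 0. trace_op (T o\<^sub>L ((dual_map (\<Psi> t) id_blinfun - id_blinfun) /\<^sub>R t)) = trace_op (T o\<^sub>L 0)"
      using eventually_at_right_less[of "0 :: real"]
      by eventually_elim (simp add: upm_id[OF dual_map_unital_positive[OF semigroup_stochastic]])
    then show "((\<lambda>t. trace_op (T o\<^sub>L ((dual_map (\<Psi> t) id_blinfun - id_blinfun) /\<^sub>R t)))
        \<longlongrightarrow> trace_op (T o\<^sub>L 0)) (at_right 0)"
      by (rule tendsto_eventually)
  qed
  from wstar_generatorI[where \<Theta> = "\<lambda>t. dual_map (\<Psi> t)", OF bounded_ops_id bounded_ops_0 this]
  show "id_blinfun \<in> wstar_generator_dom (\<lambda>t. dual_map (\<Psi> t))"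
    "wstar_generator (\<lambda>t. dual_map (\<Psi> t)) id_blinfun = 0" .
qed

text \<open>As \<open>A\<close> is the conjugate of the identity, \<open>tr (\<psi> T A)\<close> is the trace of the conjugate of \<open>\<psi> T\<close>, which is
  \<open>\<psi>\<close> of the conjugate of \<open>T\<close> and so has trace 0; \<open>A\<^sup>2\<close> is the conjugate of \<open>A\<close>.\<close>

lemma generator_commute_imp_annihilates:
  assumes A: "positive_op A" and T: "T \<in> generator_dom \<Psi>"
    and comm: "\<And>T. T \<in> generator_dom \<Psi> \<Longrightarrow> conj_by (sqrt_op A) T \<in> generator_dom \<Psi> \<and>
      generator \<Psi> (conj_by (sqrt_op A) T) = conj_by (sqrt_op A) (generator \<Psi> T)"
  shows "trace_op (generator \<Psi> T o\<^sub>L A) = 0" "trace_op (generator \<Psi> T o\<^sub>L (A o\<^sub>L A)) = 0"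
proof -
  let ?M = "conj_by (sqrt_op A)"
  have Bb: "sqrt_op A \<in> bounded_ops" by (rule hermitian_bounded[OF hermitian_sqrt[OF A]])
  have shift: "trace_op (generator \<Psi> V o\<^sub>L ?M S) = trace_op (generator \<Psi> (?M V) o\<^sub>L S)"
    if "V \<in> generator_dom \<Psi>" "S \<in> bounded_ops" for V S
    using that comm[OF that(1)] generatorD(2)[OF that(1)] trace_op_conj[OF _ _ Bb] by simp
  have zero: "trace_op (generator \<Psi> V o\<^sub>L A) = 0" if "V \<in> generator_dom \<Psi>" for V
    using shift[OF that bounded_ops_id] trace_generator[of "?M V"] comm[OF that]
    by (simp add: conj_sqrt_id A)
  then show "trace_op (generator \<Psi> T o\<^sub>L A) = 0" using T by blast
  show "trace_op (generator \<Psi> T o\<^sub>L (A o\<^sub>L A)) = 0"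
    using shift[OF T positive_bounded[OF A]] zero[of "?M T"] comm[OF T] by (simp add: conj_sqrt_self A)
qed

end

declare semigroup_trace_class [simp del]

theorem theorem3p8:
  fixes \<Psi> :: "real \<Rightarrow> 'a::chilbert_space op \<Rightarrow> 'a op" and A :: "'a op"
  assumes "stochastic_semigroup \<Psi>" and "positive_op A"
  shows
    "let \<Psi>d = (\<lambda>t. dual_map (\<Psi> t));
         \<psi> = generator \<Psi>;
         \<psi>d = wstar_generator \<Psi>d;
         M = conj_by (sqrt_op A);
         i = (\<forall>t\<ge>0. \<Psi>d t A = A \<and> \<Psi>d t (A o\<^sub>L A) = A o\<^sub>L A);
         ii = (\<forall>t\<ge>0. \<forall>T\<in>trace_class. M (\<Psi> t T) = \<Psi> t (M T));
         iii = (\<forall>t\<ge>0. \<forall>S\<in>bounded_ops. M (\<Psi>d t S) = \<Psi>d t (M S));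
         iv = (\<forall>T\<in>generator_dom \<Psi>. M T \<in> generator_dom \<Psi> \<and> \<psi> (M T) = M (\<psi> T));
         v = (\<forall>S\<in>wstar_generator_dom \<Psi>d.
                M S \<in> wstar_generator_dom \<Psi>d \<and> \<psi>d (M S) = M (\<psi>d S));
         vi = (A \<in> wstar_generator_dom \<Psi>d \<and> A o\<^sub>L A \<in> wstar_generator_dom \<Psi>d \<and>
               \<psi>d A = 0 \<and> \<psi>d (A o\<^sub>L A) = 0)
     in (i \<longleftrightarrow> ii) \<and> (i \<longleftrightarrow> iii) \<and> (i \<longleftrightarrow> iv) \<and> (i \<longleftrightarrow> v) \<and> (i \<longleftrightarrow> vi)"
proof -
  note sg = assms(1) and A = assms(2)
  define \<Psi>d where "\<Psi>d = (\<lambda>t. dual_map (\<Psi> t))"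
  define M where "M = conj_by (sqrt_op A)"
  define i where "i \<longleftrightarrow> (\<forall>t\<ge>0. \<Psi>d t A = A \<and> \<Psi>d t (A o\<^sub>L A) = A o\<^sub>L A)"
  define ii where "ii \<longleftrightarrow> (\<forall>t\<ge>0. \<forall>T\<in>trace_class. M (\<Psi> t T) = \<Psi> t (M T))"
  define iii where "iii \<longleftrightarrow> (\<forall>t\<ge>0. \<forall>S\<in>bounded_ops. M (\<Psi>d t S) = \<Psi>d t (M S))"
  define iv where "iv \<longleftrightarrow> (\<forall>T\<in>generator_dom \<Psi>. M T \<in> generator_dom \<Psi> \<and> generator \<Psi> (M T) = M (generator \<Psi> T))"
  define v where "v \<longleftrightarrow> (\<forall>S\<in>wstar_generator_dom \<Psi>d.
    M S \<in> wstar_generator_dom \<Psi>d \<and> wstar_generator \<Psi>d (M S) = M (wstar_generator \<Psi>d S))"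
  define vi where "vi \<longleftrightarrow> (A \<in> wstar_generator_dom \<Psi>d \<and> A o\<^sub>L A \<in> wstar_generator_dom \<Psi>d \<and>
    wstar_generator \<Psi>d A = 0 \<and> wstar_generator \<Psi>d (A o\<^sub>L A) = 0)"
  have Ab: "A \<in> bounded_ops" by (rule positive_bounded[OF A])
  have Bb: "sqrt_op A \<in> bounded_ops" by (rule hermitian_bounded[OF hermitian_sqrt[OF A]])
  have M_id: "M id_blinfun = A" and M_A: "M A = A o\<^sub>L A"
    using conj_sqrt_id[OF A] conj_sqrt_self[OF A] by (simp_all add: M_def)
  have upm: "unital_positive_map (\<Psi>d t)" if "t \<ge> 0" for t
    unfolding \<Psi>d_def by (rule dual_map_unital_positive[OF semigroup_stochastic[OF sg that]])
  have "iii" if "i"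
    using that fixed_conj_sqrt[OF upm A] unfolding i_def iii_def M_def by simp
  moreover have "i" if "iii"
    unfolding i_def
  proof (intro allI impI)
    fix t :: real assume t: "t \<ge> 0"
    have comm: "\<Psi>d t (M S) = M (\<Psi>d t S)" if "S \<in> bounded_ops" for S
      using \<open>iii\<close> t that unfolding iii_def by simp
    have 1: "\<Psi>d t A = A"
      using comm[OF bounded_ops_id] by (simp add: M_id upm_id[OF upm[OF t]])
    have "\<Psi>d t (A o\<^sub>L A) = A o\<^sub>L A" using comm[OF Ab] by (simp add: M_A 1)
    with 1 show "\<Psi>d t A = A \<and> \<Psi>d t (A o\<^sub>L A) = A o\<^sub>L A" ..
  qed
  moreover have "ii \<longleftrightarrow> iii"
    using commute_iff_dual_commute[OF sg Bb] unfolding ii_def iii_def M_def \<Psi>d_def by blast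
  moreover have "iv" if "ii"
    using that commute_imp_generator_commute[OF sg Bb] unfolding ii_def iv_def M_def by blast
  moreover have "i" if "iv"
  proof -
    have ann: "trace_op (generator \<Psi> T o\<^sub>L A) = 0" "trace_op (generator \<Psi> T o\<^sub>L (A o\<^sub>L A)) = 0"
      if "T \<in> generator_dom \<Psi>" for T
      using generator_commute_imp_annihilates[OF sg A that] \<open>iv\<close> unfolding iv_def M_def by blast+
    show ?thesis
      unfolding i_def \<Psi>d_def using generator_annihilator_fixed[OF sg] ann Ab by simp
  qed
  moreover have "v" if "iii"
    using that dual_commute_imp_wstar_generator_commute[of "sqrt_op A" \<Psi>d, OF _ Bb] upm_bounded[OF upm]
    unfolding iii_def v_def M_def by blast
  moreover have "vi" if "v"
  proof -
    have id: "id_blinfun \<in> wstar_generator_dom \<Psi>d" "wstar_generator \<Psi>d id_blinfun = 0"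
      unfolding \<Psi>d_def by (rule wstar_generator_id[OF sg])+
    have M0: "M 0 = 0" by (simp add: M_def conj_by_def)
    have 1: "A \<in> wstar_generator_dom \<Psi>d" "wstar_generator \<Psi>d A = 0"
      using \<open>v\<close> id unfolding v_def by (metis M_id M0)+
    then have "A o\<^sub>L A \<in> wstar_generator_dom \<Psi>d" "wstar_generator \<Psi>d (A o\<^sub>L A) = 0"
      using \<open>v\<close> unfolding v_def by (metis M_A M0)+
    with 1 show ?thesis unfolding vi_def by blast
  qed
  moreover have "i" if "vi"
    using that wstar_generator_kernel_fixed[OF sg] unfolding i_def vi_def \<Psi>d_def by blast
  ultimately have "(i \<longleftrightarrow> ii) \<and> (i \<longleftrightarrow> iii) \<and> (i \<longleftrightarrow> iv) \<and> (i \<longleftrightarrow> v) \<and> (i \<longleftrightarrow> vi)" by blast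
  then show ?thesis
    unfolding Let_def i_def ii_def iii_def iv_def v_def vi_def M_def \<Psi>d_def .
qed

end
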